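(* Let $\mathbf m=(m_1,m_2)\in\{1,\dots,N_T\}^2$ satisfy the following two conditions. (i) There exist two constants $\mathfrak c>0$ and $q\in\mathbb N^*$, not depending on $\mathbf m$ and $N$, such that $\mathfrak L_\psi(m_2)\leqslant \mathfrak c N^q$. (ii) One has $$\mathfrak L_\varphi(m_1)\,(\|\Psi_{m_1}^{-1}\|_{\rm op}\vee 1)\leqslant \frac{\mathfrak c_\Lambda}{2}\cdot\frac{NT}{\log(NT)}\quad\text{with}\quad \mathfrak c_\Lambda=\frac{1-\log 2}{(1+p)T},\quad p=2(q+4)+1 .$$ Then there exists a constant $C>0$, not depending on $\mathbf m$ and $N$, such that for every $t\in(0,T]$, $$\mathbb E\big(\|\widehat p_{\mathbf m,t}-p_{I\times J,t}\|_N^2\big)\leqslant \min_{\tau\in\mathcal S_{\mathbf m}}\|\tau-p_{I\times J,t}\|_f^2+\frac{2m_1\mathfrak L_\psi(m_2)}{N}+\frac{C}{N}.$$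
   Context: Diffusion. $T>0$, $x_0\in\mathbb R$, $X=(X_t)_{t\in[0,2T]}$ is the unique strong solution of $X_t=x_0+\int_0^t b(X_s)ds+\int_0^t\sigma(X_s)dW_s$, where $W$ is a real Brownian motion on $[0,2T]$, $b,\sigma\in C^1(\mathbb R)$, $b',\sigma'$ are bounded, and there are $\alpha,A>0$ with $\alpha\leqslant|\sigma(x)|\leqslant\alpha+A$ for all $x\in\mathbb R$. Under these conditions the transition density $p_t(x,\cdot)$ (conditional density of $X_{s+t}$ given $X_s=x$) is well defined for $t\in(0,T]$. Put $f(\cdot)=\frac1T\int_0^Tp_s(x_0,\cdot)ds$, a probability density on $\mathbb R$. Observations. $X^1,\dots,X^N$ are $N$ independent copies of $X$ (same $x_0$, driven by independent Brownian motions $W^1,\dots,W^N$). Projection spaces. $N_T=[NT]+1$; $I,J\subset\mathbb R$ are non-empty intervals; $\varphi_1,\dots,\varphi_{N_T}$ are continuous functions $I\to\mathbb R$ forming an orthonormal family of $\mathbb L^2(I,dx)$ and $\psi_1,\dots,\psi_{N_T}$ are continuous functions $J\to\mathbb R$ forming an orthonormal family of $\mathbb L^2(J,dx)$ (all extended by $0$ outside $I$, resp. $J$). $\mathcal S_{\varphi,m_1}={\rm span}\{\varphi_1,\dots,\varphi_{m_1}\}$, $\mathcal S_{\psi,m_2}={\rm span}\{\psi_1,\dots,\psi_{m_2}\}$, and $\mathcal S_{\mathbf m}=\mathcal S_{\varphi,m_1}\otimes\mathcal S_{\psi,m_2}$ for $\mathbf m=(m_1,m_2)\in\{1,\dots,N_T\}^2$,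 where $(\varphi\otimes\psi)(x,y)=\varphi(x)\psi(y)$. $\mathfrak L_\varphi(m)=\sup_{x\in I}\sum_{j=1}^m\varphi_j(x)^2$, $\mathfrak L_\psi(m)=\sup_{x\in J}\sum_{j=1}^m\psi_j(x)^2$; these are assumed to be $\geqslant1$ (otherwise replaced by their maximum with $1$). Matrices. $\widehat\Psi_{m_1}=\big(\frac1{NT}\sum_{i=1}^N\int_0^T\varphi_j(X^i_s)\varphi_{j'}(X^i_s)ds\big)_{1\leqslant j,j'\leqslant m_1}$, $\Psi_{m_1}=\mathbb E(\widehat\Psi_{m_1})=\big(\int\varphi_j\varphi_{j'}f\big)_{j,j'}$, $\widehat Z_{\mathbf m,t}=\big(\frac1{NT}\sum_{i=1}^N\int_0^T\varphi_j(X^i_s)\psi_\ell(X^i_{s+t})ds\big)_{1\leqslant j\leqslant m_1,\,1\leqslant\ell\leqslant m_2}$. $\|\cdot\|_{\rm op}$ is the operator norm ($\|M\|_{\rm op}^2$ is the largest eigenvalue of $MM^*$). Estimator. $\widehat p_{\mathbf m,t}=\sum_{j=1}^{m_1}\sum_{\ell=1}^{m_2}[\widehat\Psi_{m_1}^{-1}\widehat Z_{\mathbf m,t}]_{j,\ell}\,\varphi_j\otimes\psi_\ell$; this is the unique minimizer over $\tau\in\mathcal S_{\mathbf m}$ of $\gamma_N(\tau)=\frac1{NT}\sum_{i=1}^N\big(\int_0^T\int_{\mathbb R}\tau(X^i_s,y)^2dyds-2\int_0^T\tau(X^i_s,X^i_{s+t})ds\big)$ when $\widehat\Psi_{m_1}$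 is invertible; $\widehat\Psi_{m_1}$ is implicitly taken (almost surely) invertible. Norms. $\|\tau\|_N^2=\frac1{NT}\sum_{i=1}^N\int_0^T\int_{\mathbb R}\tau(X^i_s,y)^2dyds$ and $\|\tau\|_f^2=\mathbb E(\|\tau\|_N^2)=\int_{\mathbb R}\int_{\mathbb R}\tau(x,y)^2f(x)dxdy$. $p_{I\times J,t}$ is the restriction of $p_t$ to $I\times J$ (extended by $0$). Throughout, $NT>1$ so that $\log(NT)>0$. *)

theory Defs
  imports
    "HOL-Probability.Probability"
    "Jordan_Normal_Form.Gauss_Jordan_Elimination"
    "Jordan_Normal_Form.Spectral_Radius"
begin

section \<open>Brownian motion, Ito integral, strong solutions\<close>

text \<open>A real process is a function \<open>real \<Rightarrow> 'a \<Rightarrow> real\<close> (time, outcome), used only for times in a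
  compact interval \<open>[0,S]\<close>.\<close>

definition natural_events :: "'a measure \<Rightarrow> (real \<Rightarrow> 'a \<Rightarrow> real) \<Rightarrow> real \<Rightarrow> 'a set set" where
  "natural_events M W t = {W u -` B \<inter> space M | u B. u \<in> {0..t} \<and> B \<in> sets borel}"

definition augmented_filtration :: "'a measure \<Rightarrow> (real \<Rightarrow> 'a \<Rightarrow> real) \<Rightarrow> real \<Rightarrow> 'a measure" where
  "augmented_filtration M W t = sigma (space M) (natural_events M W t \<union> null_sets M)"

definition brownian_motion :: "'a measure \<Rightarrow> real \<Rightarrow> (real \<Rightarrow> 'a \<Rightarrow> real) \<Rightarrow> bool" where
  "brownian_motion M S W \<longleftrightarrow>
     prob_space M \<and>
     (\<forall>t\<in>{0..S}. W t \<in> borel_measurable M) \<and>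
     (AE \<omega> in M. W 0 \<omega> = 0) \<and>
     (\<forall>\<omega>\<in>space M. continuous_on {0..S} (\<lambda>t. W t \<omega>)) \<and>
     (\<forall>s t. 0 \<le> s \<and> s < t \<and> t \<le> S \<longrightarrow>
        distributed M lborel (\<lambda>\<omega>. W t \<omega> - W s \<omega>) (normal_density 0 (sqrt (t - s))) \<and>
        prob_space.indep_set M
          (sigma_sets (space M) (natural_events M W s))
          {(\<lambda>\<omega>. W t \<omega> - W s \<omega>) -` B \<inter> space M | B. B \<in> sets borel})"

text \<open>Elementary processes \<open>\<Sum>k<n. \<xi> k * 1_(u k, u (k+1)]\<close> on \<open>[0,t]\<close>, and the Ito integral of a
  square integrable process as the limit in mean square of the integrals of elementary
  processes. The integral is defined up to null sets, hence a relation.\<close>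

definition elementary_process ::
  "(real \<Rightarrow> 'a measure) \<Rightarrow> real \<Rightarrow> nat \<Rightarrow> (nat \<Rightarrow> real) \<Rightarrow> (nat \<Rightarrow> 'a \<Rightarrow> real) \<Rightarrow> bool" where
  "elementary_process F t n u \<xi> \<longleftrightarrow>
     u 0 = 0 \<and> u n = t \<and> (\<forall>k<n. u k \<le> u (Suc k)) \<and>
     (\<forall>k<n. \<xi> k \<in> borel_measurable (F (u k)) \<and>
        (\<exists>B. \<forall>\<omega>\<in>space (F (u k)). \<bar>\<xi> k \<omega>\<bar> \<le> B))"

definition elementary_value ::
  "nat \<Rightarrow> (nat \<Rightarrow> real) \<Rightarrow> (nat \<Rightarrow> 'a \<Rightarrow> real) \<Rightarrow> real \<Rightarrow> 'a \<Rightarrow> real" where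
  "elementary_value n u \<xi> s \<omega> = (\<Sum>k<n. \<xi> k \<omega> * indicator {u k<..u (Suc k)} s)"

definition elementary_integral ::
  "(real \<Rightarrow> 'a \<Rightarrow> real) \<Rightarrow> nat \<Rightarrow> (nat \<Rightarrow> real) \<Rightarrow> (nat \<Rightarrow> 'a \<Rightarrow> real) \<Rightarrow> 'a \<Rightarrow> real" where
  "elementary_integral W n u \<xi> \<omega> = (\<Sum>k<n. \<xi> k \<omega> * (W (u (Suc k)) \<omega> - W (u k) \<omega>))"

definition has_ito_integral ::
  "'a measure \<Rightarrow> (real \<Rightarrow> 'a \<Rightarrow> real) \<Rightarrow> (real \<Rightarrow> 'a \<Rightarrow> real) \<Rightarrow> real \<Rightarrow> ('a \<Rightarrow> real) \<Rightarrow> bool" where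
  "has_ito_integral M W H t Z \<longleftrightarrow>
     Z \<in> borel_measurable M \<and>
     (\<exists>n u \<xi>. (\<forall>k. elementary_process (augmented_filtration M W) t (n k) (u k) (\<xi> k)) \<and>
        (\<lambda>k. \<integral>\<^sup>+\<omega>. (\<integral>\<^sup>+s\<in>{0..t}. ennreal ((elementary_value (n k) (u k) (\<xi> k) s \<omega> - H s \<omega>)\<^sup>2)
                \<partial>lborel) \<partial>M) \<longlonglongrightarrow> 0 \<and>
        (\<lambda>k. \<integral>\<^sup>+\<omega>. ennreal ((elementary_integral W (n k) (u k) (\<xi> k) \<omega> - Z \<omega>)\<^sup>2) \<partial>M) \<longlonglongrightarrow> 0)"

text \<open>The last clause is the equation
  \<open>X t = x0 + \<integral>_0^t b (X s) ds + \<integral>_0^t \<sigma> (X s) dW s\<close>, solved for the stochastic integral. The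
  square integrable Ito integral suffices for the bounded coefficients \<open>\<sigma>\<close> considered here.\<close>

definition strong_solution ::
  "'a measure \<Rightarrow> real \<Rightarrow> (real \<Rightarrow> real) \<Rightarrow> (real \<Rightarrow> real) \<Rightarrow> real \<Rightarrow>
   (real \<Rightarrow> 'a \<Rightarrow> real) \<Rightarrow> (real \<Rightarrow> 'a \<Rightarrow> real) \<Rightarrow> bool" where
  "strong_solution M S b \<sigma> x0 W X \<longleftrightarrow>
     brownian_motion M S W \<and>
     (\<forall>t\<in>{0..S}. X t \<in> borel_measurable (augmented_filtration M W t)) \<and>
     (\<forall>\<omega>\<in>space M. continuous_on {0..S} (\<lambda>t. X t \<omega>)) \<and>
     (\<forall>t\<in>{0..S}. has_ito_integral M W (\<lambda>s \<omega>. \<sigma> (X s \<omega>)) t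
        (\<lambda>\<omega>. X t \<omega> - x0 - (LBINT s:{0..t}. b (X s \<omega>))))"

definition path :: "real \<Rightarrow> (real \<Rightarrow> 'a \<Rightarrow> real) \<Rightarrow> 'a \<Rightarrow> real \<Rightarrow> real" where
  "path S X \<omega> = (\<lambda>t\<in>{0..S}. X t \<omega>)"

abbreviation path_space :: "real \<Rightarrow> (real \<Rightarrow> real) measure" where
  "path_space S \<equiv> PiM {0..S} (\<lambda>_. borel)"

text \<open>\<open>Xs 1, ..., Xs N\<close> on \<open>M\<close> are independent copies of the process \<open>X\<close> (living on \<open>M0\<close>), driven by
  independent Brownian motions \<open>Ws 1, ..., Ws N\<close>.\<close>

definition independent_copies ::
  "'b measure \<Rightarrow> (real \<Rightarrow> 'b \<Rightarrow> real) \<Rightarrow> real \<Rightarrow> (real \<Rightarrow> real) \<Rightarrow> (real \<Rightarrow> real) \<Rightarrow> real \<Rightarrow> nat \<Rightarrow>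
   'a measure \<Rightarrow> (nat \<Rightarrow> real \<Rightarrow> 'a \<Rightarrow> real) \<Rightarrow> (nat \<Rightarrow> real \<Rightarrow> 'a \<Rightarrow> real) \<Rightarrow> bool" where
  "independent_copies M0 X S b \<sigma> x0 N M Ws Xs \<longleftrightarrow>
     prob_space M \<and>
     (\<forall>i\<in>{1..N}. strong_solution M S b \<sigma> x0 (Ws i) (Xs i)) \<and>
     prob_space.indep_vars M (\<lambda>_. path_space S) (\<lambda>i. path S (Ws i)) {1..N} \<and>
     prob_space.indep_vars M (\<lambda>_. path_space S) (\<lambda>i. path S (Xs i)) {1..N} \<and>
     (\<forall>i\<in>{1..N}. distr M (path_space S) (path S (Xs i)) = distr M0 (path_space S) (path S X))"

text \<open>\<open>p t x\<close> is a density, jointly measurable in \<open>(t,x,y)\<close>, and it is the conditional density of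
  \<open>X (s+t)\<close> given \<open>X s\<close>. (The case \<open>s = 0\<close> says that \<open>p t x0\<close> is the density of \<open>X t\<close>.)\<close>

definition transition_density ::
  "'a measure \<Rightarrow> (real \<Rightarrow> 'a \<Rightarrow> real) \<Rightarrow> real \<Rightarrow> (real \<Rightarrow> real \<Rightarrow> real \<Rightarrow> real) \<Rightarrow> bool" where
  "transition_density M X T p \<longleftrightarrow>
     (\<lambda>(t, x, y). indicator {0<..T} t * p t x y) \<in> borel_measurable borel \<and>
     (\<forall>t\<in>{0<..T}. \<forall>x. (\<forall>y. 0 \<le> p t x y) \<and> (\<integral>\<^sup>+y. ennreal (p t x y) \<partial>lborel) = 1) \<and>
     (\<forall>t\<in>{0<..T}. \<forall>s. 0 \<le> s \<and> s + t \<le> 2 * T \<longrightarrow>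
        (\<forall>A\<in>sets borel. \<forall>B\<in>sets borel.
           emeasure M {\<omega>\<in>space M. X s \<omega> \<in> A \<and> X (s + t) \<omega> \<in> B} =
           (\<integral>\<^sup>+\<omega>. indicator A (X s \<omega>) * (\<integral>\<^sup>+y\<in>B. ennreal (p t (X s \<omega>) y) \<partial>lborel) \<partial>M)))"

definition mean_density ::
  "(real \<Rightarrow> real \<Rightarrow> real \<Rightarrow> real) \<Rightarrow> real \<Rightarrow> real \<Rightarrow> real \<Rightarrow> real" where
  "mean_density p x0 T x = (1 / T) * (LBINT s:{0<..T}. p s x0 x)"

section \<open>Projection spaces\<close>

text \<open>Basis functions are numbered from 1.\<close>

definition max_dim :: "nat \<Rightarrow> real \<Rightarrow> nat" where
  "max_dim N T = nat \<lfloor>real N * T\<rfloor> + 1"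

definition orthonormal_family :: "real set \<Rightarrow> nat \<Rightarrow> (nat \<Rightarrow> real \<Rightarrow> real) \<Rightarrow> bool" where
  "orthonormal_family I n \<phi> \<longleftrightarrow>
     (\<forall>j\<in>{1..n}. continuous_on I (\<phi> j) \<and> (\<forall>x. x \<notin> I \<longrightarrow> \<phi> j x = 0)) \<and>
     (\<forall>j\<in>{1..n}. \<forall>k\<in>{1..n}. integrable lborel (\<lambda>x. \<phi> j x * \<phi> k x) \<and>
        (LBINT x. \<phi> j x * \<phi> k x) = (if j = k then 1 else 0))"

definition tensor_space ::
  "(nat \<Rightarrow> real \<Rightarrow> real) \<Rightarrow> (nat \<Rightarrow> real \<Rightarrow> real) \<Rightarrow> nat \<Rightarrow> nat \<Rightarrow> (real \<Rightarrow> real \<Rightarrow> real) set" where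
  "tensor_space \<phi> \<psi> m1 m2 =
     {\<lambda>x y. \<Sum>j=1..m1. \<Sum>l=1..m2. a j l * (\<phi> j x * \<psi> l y) | a :: nat \<Rightarrow> nat \<Rightarrow> real. True}"

text \<open>Valued in \<open>ennreal\<close>, so that an infinite supremum is not confused with a real number.\<close>

definition frakL :: "real set \<Rightarrow> (nat \<Rightarrow> real \<Rightarrow> real) \<Rightarrow> nat \<Rightarrow> ennreal" where
  "frakL I \<phi> m = max 1 (SUP x\<in>I. ennreal (\<Sum>j=1..m. (\<phi> j x)\<^sup>2))"

section \<open>Matrices and the estimator\<close>

text \<open>Matrix indices start at 0, basis indices at 1.\<close>

definition Psi_hat ::
  "nat \<Rightarrow> real \<Rightarrow> (nat \<Rightarrow> real \<Rightarrow> 'a \<Rightarrow> real) \<Rightarrow> (nat \<Rightarrow> real \<Rightarrow> real) \<Rightarrow> nat \<Rightarrow> 'a \<Rightarrow> real mat" where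
  "Psi_hat N T Xs \<phi> m \<omega> = mat m m (\<lambda>(j, j').
     1 / (real N * T) *
     (\<Sum>i=1..N. LBINT s:{0..T}. \<phi> (j + 1) (Xs i s \<omega>) * \<phi> (j' + 1) (Xs i s \<omega>)))"

definition Psi :: "(real \<Rightarrow> real) \<Rightarrow> (nat \<Rightarrow> real \<Rightarrow> real) \<Rightarrow> nat \<Rightarrow> real mat" where
  "Psi f \<phi> m = mat m m (\<lambda>(j, j'). LBINT x. \<phi> (j + 1) x * \<phi> (j' + 1) x * f x)"

definition Z_hat ::
  "nat \<Rightarrow> real \<Rightarrow> (nat \<Rightarrow> real \<Rightarrow> 'a \<Rightarrow> real) \<Rightarrow> (nat \<Rightarrow> real \<Rightarrow> real) \<Rightarrow> (nat \<Rightarrow> real \<Rightarrow> real) \<Rightarrow>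
   nat \<Rightarrow> nat \<Rightarrow> real \<Rightarrow> 'a \<Rightarrow> real mat" where
  "Z_hat N T Xs \<phi> \<psi> m1 m2 t \<omega> = mat m1 m2 (\<lambda>(j, l).
     1 / (real N * T) *
     (\<Sum>i=1..N. LBINT s:{0..T}. \<phi> (j + 1) (Xs i s \<omega>) * \<psi> (l + 1) (Xs i (s + t) \<omega>)))"

definition inv_mat :: "real mat \<Rightarrow> real mat" where
  "inv_mat A = the (mat_inverse A)"

definition op_norm :: "real mat \<Rightarrow> real" where
  "op_norm A = sqrt (Max (spectrum (A * transpose_mat A)))"

definition p_hat ::
  "nat \<Rightarrow> real \<Rightarrow> (nat \<Rightarrow> real \<Rightarrow> 'a \<Rightarrow> real) \<Rightarrow> (nat \<Rightarrow> real \<Rightarrow> real) \<Rightarrow> (nat \<Rightarrow> real \<Rightarrow> real) \<Rightarrow>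
   nat \<Rightarrow> nat \<Rightarrow> real \<Rightarrow> 'a \<Rightarrow> real \<Rightarrow> real \<Rightarrow> real" where
  "p_hat N T Xs \<phi> \<psi> m1 m2 t \<omega> x y =
     (\<Sum>j=1..m1. \<Sum>l=1..m2.
        (inv_mat (Psi_hat N T Xs \<phi> m1 \<omega>) * Z_hat N T Xs \<phi> \<psi> m1 m2 t \<omega>) $$ (j - 1, l - 1) *
        (\<phi> j x * \<psi> l y))"

definition c_Lambda :: "real \<Rightarrow> nat \<Rightarrow> real" where
  "c_Lambda T q = (let p = 2 * (real q + 4) + 1 in (1 - ln 2) / ((1 + p) * T))"

section \<open>Norms\<close>

text \<open>Squared norms, valued in \<open>ennreal\<close>.\<close>

definition sqnorm_N ::
  "nat \<Rightarrow> real \<Rightarrow> (nat \<Rightarrow> real \<Rightarrow> 'a \<Rightarrow> real) \<Rightarrow> 'a \<Rightarrow> (real \<Rightarrow> real \<Rightarrow> real) \<Rightarrow> ennreal" where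
  "sqnorm_N N T Xs \<omega> \<tau> =
     ennreal (1 / (real N * T)) *
     (\<Sum>i=1..N. \<integral>\<^sup>+s\<in>{0..T}. (\<integral>\<^sup>+y. ennreal ((\<tau> (Xs i s \<omega>) y)\<^sup>2) \<partial>lborel) \<partial>lborel)"

definition sqnorm_f :: "(real \<Rightarrow> real) \<Rightarrow> (real \<Rightarrow> real \<Rightarrow> real) \<Rightarrow> ennreal" where
  "sqnorm_f f \<tau> = (\<integral>\<^sup>+x. (\<integral>\<^sup>+y. ennreal ((\<tau> x y)\<^sup>2 * f x) \<partial>lborel) \<partial>lborel)"

definition restrict_to ::
  "real set \<Rightarrow> real set \<Rightarrow> (real \<Rightarrow> real \<Rightarrow> real) \<Rightarrow> real \<Rightarrow> real \<Rightarrow> real" where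
  "restrict_to I J g x y = (if x \<in> I \<and> y \<in> J then g x y else 0)"

end

theory Submission
  imports Defs
begin

text \<open>
  Write the density as \<open>p t x = \<Sum>l. P l x * \<psi> l + remainder\<close>, where \<open>P l x\<close> is the conditional mean of
  \<open>\<psi> l (X (s + t))\<close> given \<open>X s = x\<close>. For each \<open>x\<close>, the squared distance from \<open>p t x\<close> to a candidate is a regression error
  \<open>\<Sum>l. (\<tau> l x - P l x)^2\<close> plus a term that is the same for all candidates. The estimator is thus ordinary least squares:
  for each \<open>l\<close> it regresses the bounded response \<open>\<psi> l (X (s + t))\<close> on the functions \<open>\<phi> j (X s)\<close>, under the empirical
  measure obtained by averaging over the copies and over \<open>s \<in> [0, T]\<close>. Density, process and time disappear at this point:
  each copy contributes a random measure on the plane (\<open>occ\<close>), these are independent, and their mean has first marginal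
  \<open>mean_density p x0 T\<close> and conditional means \<open>P l\<close> (\<open>mean_occ_first_marginal\<close>, \<open>mean_occ_conditional_mean\<close>).

  By the normal equations, the empirical risk of least squares exceeds that of any fixed candidate, in particular of
  the best one, by at most the supremum of \<open>2 <g, e> - <g, g>\<close>, where \<open>g\<close> ranges over the span, \<open>e\<close> is the noise and the
  inner products are empirical (\<open>regression_oracle\<close>). In a basis that is orthonormal for the mean measure, suppose that the
  empirical Gram matrix is at least \<open>1/2\<close>. Then the supremum is at most twice the squared empirical coefficients of the
  noise, whose expectation is at most \<open>2 m1 L / N\<close> by independence, with \<open>L\<close> the bound on the sum of squares of the
  \<open>\<psi> l\<close> (\<open>stochastic_term_bound\<close>). Otherwise it is at most the energy of the noise, of order \<open>N^q\<close>, so this event must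
  have probability of order \<open>N^(- q - 1)\<close>.

  That is a matrix Chernoff bound (\<open>matrix_Chernoff_lower_tail\<close>). The hypothesis on the Gram matrix bounds every summand,
  because the sum of squares of the orthonormalized basis is at most the bound for the \<open>\<phi> j\<close> times the norm of the inverse
  Gram matrix (\<open>whitened_basis\<close>, \<open>quadratic_form_ge_op_norm_inverse\<close>). The usual proofs use the matrix exponential and the
  inequality of Golden and Thompson or of Lieb. Here the potential is the trace of \<open>(1 - \<eta> S)^k\<close>, a polynomial in the entries;
  its decrease in one step (\<open>mtrace_power_step\<close>) is a differential inequality in one real variable, and \<open>k\<close> tends to
  infinity at the end, which recovers the exponent of the exponential potential.
\<close>

section \<open>Symmetric matrices of variable dimension\<close>

type_synonym rmat = "nat \<Rightarrow> nat \<Rightarrow> real"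

definition mmul :: "nat \<Rightarrow> rmat \<Rightarrow> rmat \<Rightarrow> rmat" where
  "mmul n A B = (\<lambda>i j. \<Sum>k<n. A i k * B k j)"

definition mtrace :: "nat \<Rightarrow> rmat \<Rightarrow> real" where
  "mtrace n A = (\<Sum>i<n. A i i)"

definition mone :: "nat \<Rightarrow> rmat" where
  "mone n = (\<lambda>i j. if i = j \<and> i < n then 1 else 0)"

primrec mpow :: "nat \<Rightarrow> rmat \<Rightarrow> nat \<Rightarrow> rmat" where
  "mpow n A 0 = mone n"
| "mpow n A (Suc k) = mmul n A (mpow n A k)"

definition dot :: "nat \<Rightarrow> (nat \<Rightarrow> real) \<Rightarrow> (nat \<Rightarrow> real) \<Rightarrow> real" where
  "dot n u v = (\<Sum>i<n. u i * v i)"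

definition act :: "nat \<Rightarrow> rmat \<Rightarrow> (nat \<Rightarrow> real) \<Rightarrow> nat \<Rightarrow> real" where
  "act n A v = (\<lambda>i. \<Sum>j<n. A i j * v j)"

text \<open>The entries outside the leading \<open>n \<times> n\<close> block are required to vanish, so that \<open>mone n\<close> is neutral and matrix
identities hold as equalities of functions. The dimension stays an ordinary variable.\<close>

definition symm :: "nat \<Rightarrow> rmat \<Rightarrow> bool" where
  "symm n A \<longleftrightarrow> (\<forall>i j. A i j \<noteq> 0 \<longrightarrow> i < n \<and> j < n) \<and> (\<forall>i j. A i j = A j i)"

definition psd :: "nat \<Rightarrow> rmat \<Rightarrow> bool" where
  "psd n A \<longleftrightarrow> symm n A \<and> (\<forall>v. 0 \<le> dot n v (act n A v))"

lemma symm_sym: "symm n A \<Longrightarrow> A i j = A j i"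
  by (auto simp: symm_def)

lemma symm_supp: "symm n A \<Longrightarrow> \<not> (i < n \<and> j < n) \<Longrightarrow> A i j = 0"
  by (auto simp: symm_def)

lemma psd_symm: "psd n A \<Longrightarrow> symm n A"
  by (auto simp: psd_def)

lemma psd_nonneg: "psd n A \<Longrightarrow> 0 \<le> dot n v (act n A v)"
  by (auto simp: psd_def)

lemma symm_lin: "symm n A \<Longrightarrow> symm n B \<Longrightarrow> symm n (\<lambda>i j. a * A i j + b * B i j)"
  unfolding symm_def by (metis add.right_neutral mult_zero_right)

lemma symm_mone: "symm n (mone n)"
  by (auto simp: symm_def mone_def)

lemma mmul_assoc: "mmul n (mmul n A B) C = mmul n A (mmul n B C)"
proof (intro ext)
  fix i j
  have "mmul n (mmul n A B) C i j = (\<Sum>k<n. \<Sum>l<n. A i l * B l k * C k j)"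
    by (simp add: mmul_def sum_distrib_right)
  also have "\<dots> = (\<Sum>l<n. \<Sum>k<n. A i l * B l k * C k j)"
    by (rule sum.swap)
  also have "\<dots> = mmul n A (mmul n B C) i j"
    by (simp add: mmul_def sum_distrib_left mult.assoc)
  finally show "mmul n (mmul n A B) C i j = mmul n A (mmul n B C) i j" .
qed

lemma mmul_mone_left: "(\<And>i j. \<not> i < n \<Longrightarrow> A i j = 0) \<Longrightarrow> mmul n (mone n) A = A"
proof (intro ext)
  fix i j assume A: "\<And>i j. \<not> i < n \<Longrightarrow> A i j = 0"
  have "mmul n (mone n) A i j = (\<Sum>k<n. if k = i then A i j else 0)"
    unfolding mmul_def mone_def by (intro sum.cong) auto
  then show "mmul n (mone n) A i j = A i j" using A[of i j] by auto
qed

lemma act_mone: "i < n \<Longrightarrow> act n (mone n) v i = v i"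
  by (simp add: act_def mone_def if_distrib[of "\<lambda>x. x * _"] cong: if_cong)

lemma act_mmul: "act n (mmul n A B) v = act n A (act n B v)"
proof
  fix i
  have "act n (mmul n A B) v i = (\<Sum>k<n. \<Sum>l<n. A i l * B l k * v k)"
    by (simp add: mmul_def act_def sum_distrib_right)
  also have "\<dots> = (\<Sum>l<n. \<Sum>k<n. A i l * B l k * v k)"
    by (rule sum.swap)
  also have "\<dots> = act n A (act n B v) i"
    by (simp add: act_def sum_distrib_left mult.assoc)
  finally show "act n (mmul n A B) v i = act n A (act n B v) i" .
qed

lemma act_lin: "act n (\<lambda>i j. a * A i j + b * B i j) v = (\<lambda>i. a * act n A v i + b * act n B v i)"
  by (rule ext) (simp add: act_def algebra_simps sum.distrib sum_distrib_left)

lemma dot_lin_right: "dot n u (\<lambda>i. a * v i + b * w i) = a * dot n u v + b * dot n u w"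
  by (simp add: dot_def algebra_simps sum.distrib sum_distrib_left)

lemma dot_lin_left: "dot n (\<lambda>i. a * v i + b * w i) u = a * dot n v u + b * dot n w u"
  by (simp add: dot_def algebra_simps sum.distrib sum_distrib_left)

lemma dot_commute: "dot n u v = dot n v u"
  by (simp add: dot_def mult.commute)

lemma dot_cong: "(\<And>i. i < n \<Longrightarrow> v i = w i) \<Longrightarrow> dot n u v = dot n u w"
  by (auto simp: dot_def)

lemma dot_mone: "dot n u (act n (mone n) v) = dot n u v"
  by (rule dot_cong) (rule act_mone)

lemma dot_self_nonneg: "0 \<le> dot n u u"
  by (auto simp: dot_def intro: sum_nonneg)

lemma act_dot_symm: "symm n A \<Longrightarrow> dot n u (act n A v) = dot n (act n A u) v"
proof -
  assume A: "symm n A"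
  have "dot n u (act n A v) = (\<Sum>i<n. \<Sum>j<n. u i * A i j * v j)"
    by (simp add: dot_def act_def sum_distrib_left mult.assoc)
  also have "\<dots> = (\<Sum>j<n. \<Sum>i<n. u i * A i j * v j)" by (rule sum.swap)
  also have "\<dots> = dot n (act n A u) v"
    by (simp add: dot_def act_def sum_distrib_left sum_distrib_right symm_sym[OF A, of _ "_"] mult_ac)
  finally show ?thesis .
qed

lemma mpow_Suc_right: "symm n A \<Longrightarrow> mmul n (mpow n A k) A = mpow n A (Suc k)"
proof (induction k)
  case 0
  have "mmul n A (mone n) = A"
    using 0 by (intro ext) (auto simp: mmul_def mone_def if_distrib[of "\<lambda>x. _ * x"] symm_supp cong: if_cong)
  then show ?case using 0 by (simp add: mmul_mone_left symm_supp)
qed (simp add: mmul_assoc)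

lemma symm_mpow: "symm n A \<Longrightarrow> symm n (mpow n A k)"
proof (induction k)
  case (Suc k)
  have P: "mpow n A k j i = mpow n A k i j" "A j i = A i j" for i j
    using Suc by (auto intro: symm_sym)
  have "mpow n A (Suc k) j i = mpow n A (Suc k) i j" for i j
  proof -
    have "mpow n A (Suc k) j i = mmul n (mpow n A k) A i j"
      unfolding mpow.simps mmul_def by (intro sum.cong refl) (simp add: P(1)[of i] P(2)[of j] mult.commute)
    then show ?thesis using mpow_Suc_right[OF Suc.prems] by simp
  qed
  moreover have "mpow n A (Suc k) i j = 0" if "\<not> i < n" for i j
    using that Suc.prems by (simp add: mmul_def symm_supp)
  ultimately show ?case unfolding symm_def by metis
qed (simp add: symm_mone)

lemma mpow_add: "symm n A \<Longrightarrow> mmul n (mpow n A a) (mpow n A b) = mpow n A (a + b)"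
  by (induction a) (simp_all add: mmul_assoc mmul_mone_left symm_supp[OF symm_mpow])

lemma mtrace_commute: "mtrace n (mmul n A B) = mtrace n (mmul n B A)"
  unfolding mtrace_def mmul_def by (subst sum.swap) (simp add: mult.commute)

lemma mtrace_lin: "mtrace n (\<lambda>i j. a * A i j + b * B i j) = a * mtrace n A + b * mtrace n B"
  by (simp add: mtrace_def sum.distrib sum_distrib_left)

lemma mmul_lin_left: "mmul n (\<lambda>i j. a * A i j + b * B i j) C = (\<lambda>i j. a * mmul n A C i j + b * mmul n B C i j)"
  by (intro ext) (simp add: mmul_def algebra_simps sum.distrib sum_distrib_left)

lemma mmul_lin_right: "mmul n C (\<lambda>i j. a * A i j + b * B i j) = (\<lambda>i j. a * mmul n C A i j + b * mmul n C B i j)"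
  by (intro ext) (simp add: mmul_def algebra_simps sum.distrib sum_distrib_left)

text \<open>A nonnegative quadratic polynomial has nonpositive discriminant; every Cauchy-Schwarz inequality for a
semidefinite form below is an instance.\<close>

lemma discriminant_bound:
  fixes a b c :: real
  assumes "\<And>x. 0 \<le> a + 2 * b * x + c * x\<^sup>2" "0 \<le> c"
  shows "b\<^sup>2 \<le> a * c"
proof (cases "c = 0")
  case True
  have "b = 0"
  proof (rule ccontr)
    assume "b \<noteq> 0"
    then show False using assms(1)[of "- (a + 1) / (2 * b)"] True by (simp add: field_simps)
  qed
  then show ?thesis using True by simp
next
  case False
  then have c: "c > 0" using assms by simp
  have "0 \<le> c * (a + 2 * b * (- b / c) + c * (- b / c)\<^sup>2)"
    using assms(1)[of "- b / c"] c by (intro mult_nonneg_nonneg) auto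
  also have "\<dots> = a * c - b\<^sup>2" using c by (simp add: field_simps power2_eq_square)
  finally show ?thesis by simp
qed

lemma psd_Cauchy_Schwarz:
  assumes "psd n P"
  shows "(dot n u (act n P v))\<^sup>2 \<le> dot n u (act n P u) * dot n v (act n P v)"
proof (rule discriminant_bound)
  show "0 \<le> dot n v (act n P v)" using assms by (rule psd_nonneg)
  fix x
  have s: "dot n v (act n P u) = dot n u (act n P v)"
    by (metis act_dot_symm dot_commute psd_symm assms)
  have l: "dot n (\<lambda>i. u i + x * v i) w = dot n u w + x * dot n v w" for w
    by (simp add: dot_def algebra_simps sum.distrib sum_distrib_left)
  have a: "act n P (\<lambda>i. u i + x * v i) = (\<lambda>i. 1 * act n P u i + x * act n P v i)"
    by (rule ext) (simp add: act_def algebra_simps sum.distrib sum_distrib_left)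
  have "0 \<le> dot n (\<lambda>i. u i + x * v i) (act n P (\<lambda>i. u i + x * v i))"
    using assms by (rule psd_nonneg)
  also have "\<dots> = dot n u (act n P u) + 2 * dot n u (act n P v) * x + dot n v (act n P v) * x\<^sup>2"
    unfolding a dot_lin_right l by (simp add: s algebra_simps power2_eq_square)
  finally show "0 \<le> dot n u (act n P u) + 2 * dot n u (act n P v) * x + dot n v (act n P v) * x\<^sup>2" .
qed

text \<open>\<open>A^(k+2) = A A^k A\<close> reduces the exponent by two, so no square root is needed.\<close>

lemma psd_mpow:
  assumes "psd n A"
  shows "psd n (mpow n A k)"
proof -
  have "0 \<le> dot n v (act n (mpow n A k) v)" for v
  proof (induction k arbitrary: v rule: less_induct)
    case (less k)
    consider "k = 0" | "k = 1" | j where "k = Suc (Suc j)"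
      by (metis One_nat_def not0_implies_Suc)
    then show ?case
    proof cases
      case 1
      then show ?thesis by (simp add: dot_mone dot_self_nonneg)
    next
      case 2
      then show ?thesis using psd_nonneg[OF assms]
        by (simp add: act_mmul dot_def act_def[of n A] act_mone)
    next
      case 3
      have "mpow n A k = mmul n A (mmul n (mpow n A j) A)"
        using mpow_Suc_right[OF psd_symm[OF assms], of j] 3 by simp
      then have "dot n v (act n (mpow n A k) v) = dot n (act n A v) (act n (mpow n A j) (act n A v))"
        by (simp add: act_mmul act_dot_symm[OF psd_symm[OF assms]])
      then show ?thesis using less[of j "act n A v"] 3 by simp
    qed
  qed
  then show ?thesis using symm_mpow[OF psd_symm[OF assms]] by (auto simp: psd_def)
qed

text \<open>A Cholesky factorization that also covers singular forms; it replaces the spectral theorem.\<close>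

lemma psd_factorization:
  assumes "\<And>i j. i < n \<Longrightarrow> j < n \<Longrightarrow> P i j = P j i"
    and "\<And>v. 0 \<le> dot n v (act n P v)"
  shows "\<exists>L. \<forall>i<n. \<forall>j<n. P i j = (\<Sum>k<n. L k i * L k j)"
  using assms
proof (induction n arbitrary: P)
  case (Suc n)
  \<comment> \<open>Eliminate the last variable: the Schur complement \<open>P'\<close> of the corner entry \<open>d\<close> is again positive
    semidefinite. For \<open>d = 0\<close> the last row vanishes, and division by zero gives \<open>P' = P\<close>.\<close>
  define d where "d = P n n"
  define w where "w i = P n i" for i
  have ex: "dot (Suc n) v (act (Suc n) P v) =
      dot n v (act n P v) + 2 * v n * (\<Sum>i<n. w i * v i) + d * (v n)\<^sup>2" for v
  proof -
    have *: "(\<Sum>i<n. v i * (v n * P i n)) = v n * (\<Sum>i<n. v i * P n i)"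
      unfolding sum_distrib_left
      by (intro sum.cong refl) (simp add: Suc.prems(1)[of _ n])
    show ?thesis
      by (simp add: dot_def act_def sum.distrib * w_def d_def power2_eq_square algebra_simps)
  qed
  have d0: "d \<ge> 0" using Suc.prems(2)[of "\<lambda>i. if i = n then 1 else 0"] unfolding ex
    by (simp add: dot_def)
  have w0: "w i = 0" if "d = 0" "i < n" for i
  proof -
    define a where "a = dot n (\<lambda>j. if j = i then 1 else 0) (act n P (\<lambda>j. if j = i then 1 else 0))"
    have "0 \<le> a + 2 * w i * x + 0 * x\<^sup>2" for x
    proof -
      define v where "v = (\<lambda>j. if j = i then 1 else if j = n then x else 0)"
      have "dot n v (act n P v) = a"
        unfolding a_def dot_def act_def v_def by (intro sum.cong refl arg_cong2[of _ _ _ _ "(*)"]) auto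
      moreover have "(\<Sum>j<n. w j * v j) = (\<Sum>j<n. if j = i then w i else 0)"
        by (intro sum.cong) (auto simp: v_def)
      moreover have "v n = x" using that by (simp add: v_def)
      ultimately show ?thesis using Suc.prems(2)[of v] that unfolding ex by (simp add: mult_ac)
    qed
    from discriminant_bound[OF this] show ?thesis by simp
  qed
  define P' where "P' i j = P i j - w i * w j / d" for i j
  have P': "dot n v (act n P' v) = dot n v (act n P v) - (\<Sum>i<n. w i * v i)\<^sup>2 / d" for v
  proof -
    have "(\<Sum>i<n. w i * v i)\<^sup>2 / d = (\<Sum>i<n. \<Sum>j<n. v i * (w i * w j / d * v j))"
      unfolding power2_eq_square sum_product sum_divide_distrib by (simp add: mult_ac)
    then show ?thesis
      by (simp add: dot_def act_def P'_def left_diff_distrib right_diff_distrib sum_subtractf sum_distrib_left)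
  qed
  have "\<exists>L. \<forall>i<n. \<forall>j<n. P' i j = (\<Sum>k<n. L k i * L k j)"
  proof (rule Suc.IH)
    show "P' i j = P' j i" if "i < n" "j < n" for i j
      using that Suc.prems(1)[of i j] by (simp add: P'_def mult.commute)
    fix v
    show "0 \<le> dot n v (act n P' v)"
    proof (cases "d = 0")
      case True
      then show ?thesis using Suc.prems(2)[of "\<lambda>i. if i = n then 0 else v i"]
        unfolding ex P' by (simp add: dot_def act_def)
    next
      case False
      define s where "s = (\<Sum>i<n. w i * v i)"
      define v' where "v' i = (if i = n then - s / d else v i)" for i
      have "dot n v' (act n P v') = dot n v (act n P v)" "(\<Sum>i<n. w i * v' i) = s"
        by (simp_all add: dot_def act_def v'_def s_def)
      then have "0 \<le> dot n v (act n P v) + 2 * (- s / d) * s + d * (- s / d)\<^sup>2"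
        using Suc.prems(2)[of v'] unfolding ex by (simp add: v'_def)
      also have "\<dots> = dot n v (act n P v) - s\<^sup>2 / d"
        using False by (simp add: field_simps power2_eq_square)
      finally show ?thesis unfolding P' s_def .
    qed
  qed
  then obtain L where L: "\<And>i j. i < n \<Longrightarrow> j < n \<Longrightarrow> P' i j = (\<Sum>k<n. L k i * L k j)" by blast
  define L' where "L' k i = (if k = n then (if i = n then sqrt d else w i / sqrt d)
      else (if i = n then 0 else L k i))" for k i
  have "P i j = (\<Sum>k<Suc n. L' k i * L' k j)" if "i < Suc n" "j < Suc n" for i j
  proof -
    have sq: "w i / sqrt d * sqrt d = w i" if "i < n" for i using w0[OF _ that] d0 by auto
    have sd: "sqrt d * sqrt d = d" using d0 by simp
    consider "i < n" "j < n" | "i = n" "j < n" | "i < n" "j = n" | "i = n" "j = n"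
      using \<open>i < Suc n\<close> \<open>j < Suc n\<close> by linarith
    then show ?thesis
    proof cases
      case 1
      have "w i / sqrt d * (w j / sqrt d) = w i * w j / d" using sd by simp
      then show ?thesis using L[OF 1] 1 using d0 by (simp add: L'_def P'_def)
    next
      case 2
      then show ?thesis using sq[of j] by (simp add: L'_def w_def mult.commute)
    next
      case 3
      then show ?thesis using sq[of i] Suc.prems(1)[of i n] by (simp add: L'_def w_def mult.commute)
    next
      case 4
      then show ?thesis using sd by (simp add: L'_def d_def)
    qed
  qed
  then show ?case by blast
qed simp

text \<open>With \<open>P = L^T L\<close> the trace is the sum of the values of \<open>Q\<close> on the rows of \<open>L\<close>. All trace inequalities
below come from this one.\<close>

lemma mtrace_mmul_nonneg:
  assumes P: "psd n P" and Q: "\<And>v. 0 \<le> dot n v (act n Q v)"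
  shows "0 \<le> mtrace n (mmul n P Q)"
proof -
  obtain L where L: "\<And>i j. i < n \<Longrightarrow> j < n \<Longrightarrow> P i j = (\<Sum>k<n. L k i * L k j)"
    using psd_factorization[of n P] symm_sym[OF psd_symm[OF P]] psd_nonneg[OF P] by metis
  have "mtrace n (mmul n P Q) = (\<Sum>i<n. \<Sum>j<n. \<Sum>k<n. L k i * L k j * Q j i)"
    by (simp add: mtrace_def mmul_def L sum_distrib_right)
  also have "\<dots> = (\<Sum>i<n. \<Sum>k<n. \<Sum>j<n. L k i * L k j * Q j i)"
    by (intro sum.cong refl sum.swap)
  also have "\<dots> = (\<Sum>k<n. \<Sum>i<n. \<Sum>j<n. L k i * L k j * Q j i)"
    by (rule sum.swap)
  also have "\<dots> = (\<Sum>k<n. \<Sum>j<n. \<Sum>i<n. L k i * L k j * Q j i)"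
    by (intro sum.cong refl sum.swap)
  also have "\<dots> = (\<Sum>k<n. dot n (L k) (act n Q (L k)))"
    by (simp add: dot_def act_def sum_distrib_left mult_ac)
  also have "\<dots> \<ge> 0" by (intro sum_nonneg Q)
  finally show ?thesis .
qed

section \<open>Traces of powers along a line of matrices\<close>

lemma mmul_mpow_commute: "symm n A \<Longrightarrow> mmul n A (mpow n A k) = mmul n (mpow n A k) A"
  using mpow_Suc_right by simp

lemma mmul_mpow_pull: "symm n A \<Longrightarrow> mmul n (mpow n A k) (mmul n A C) = mmul n A (mmul n (mpow n A k) C)"
  by (simp only: mmul_assoc[symmetric] mmul_mpow_commute)

text \<open>The trace of \<open>Y^a X Y^b X\<close>, the typical term in the second derivative of \<open>s \<mapsto> trace ((B - s X)^k)\<close>.\<close>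

definition sandwich :: "nat \<Rightarrow> rmat \<Rightarrow> rmat \<Rightarrow> nat \<Rightarrow> nat \<Rightarrow> real" where
  "sandwich n Y X a b = mtrace n (mmul n (mpow n Y a) (mmul n X (mmul n (mpow n Y b) X)))"

lemma sandwich_commute: "sandwich n Y X a b = sandwich n Y X b a"
  unfolding sandwich_def using mtrace_commute[of n "mmul n (mpow n Y a) X" "mmul n (mpow n Y b) X"]
  by (simp add: mmul_assoc)

text \<open>Second differences along \<open>a + b = const\<close> are traces of \<open>Y^p C Y^q C^T\<close> with the commutator \<open>C = Y X - X Y\<close>.\<close>

lemma sandwich_convex:
  assumes Y: "psd n Y" and X: "symm n X"
  shows "2 * sandwich n Y X (Suc p) (Suc q) \<le> sandwich n Y X (Suc (Suc p)) q + sandwich n Y X p (Suc (Suc q))"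
proof -
  note sY = psd_symm[OF Y]
  \<comment> \<open>\<open>C\<close> is the commutator of \<open>Y\<close> and \<open>X\<close> and \<open>D = - C\<close> its transpose, so \<open>C Y^q D\<close> is positive semidefinite.\<close>
  define C where "C = (\<lambda>i j. 1 * mmul n Y X i j + (-1) * mmul n X Y i j)"
  define D where "D = (\<lambda>i j. 1 * mmul n X Y i j + (-1) * mmul n Y X i j)"
  have CD: "dot n v (act n C w) = dot n (act n D v) w" for v w
  proof -
    have "dot n v (act n C w) = dot n v (act n Y (act n X w)) - dot n v (act n X (act n Y w))"
      unfolding C_def act_lin dot_lin_right by (simp add: act_mmul)
    also have "\<dots> = dot n (act n X (act n Y v)) w - dot n (act n Y (act n X v)) w"
      by (simp add: act_dot_symm[OF sY] act_dot_symm[OF X])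
    also have "\<dots> = dot n (act n D v) w"
      unfolding D_def act_lin dot_lin_left by (simp add: act_mmul)
    finally show ?thesis .
  qed
  have "0 \<le> mtrace n (mmul n (mpow n Y p) (mmul n C (mmul n (mpow n Y q) D)))"
    by (rule mtrace_mmul_nonneg[OF psd_mpow[OF Y]])
      (simp add: act_mmul CD psd_nonneg[OF psd_mpow[OF Y]])
  also have "\<dots> = mtrace n (mmul n (mpow n Y p) (mmul n (mmul n Y X) (mmul n (mpow n Y q) (mmul n X Y))))
      - mtrace n (mmul n (mpow n Y p) (mmul n (mmul n Y X) (mmul n (mpow n Y q) (mmul n Y X))))
      - mtrace n (mmul n (mpow n Y p) (mmul n (mmul n X Y) (mmul n (mpow n Y q) (mmul n X Y))))
      + mtrace n (mmul n (mpow n Y p) (mmul n (mmul n X Y) (mmul n (mpow n Y q) (mmul n Y X))))"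
    unfolding C_def D_def mmul_lin_right mmul_lin_left mtrace_lin by simp
  also have "mtrace n (mmul n (mpow n Y p) (mmul n (mmul n Y X) (mmul n (mpow n Y q) (mmul n X Y))))
      = sandwich n Y X (Suc (Suc p)) q"
    using mtrace_commute[of n "mmul n (mpow n Y p) (mmul n Y (mmul n X (mmul n (mpow n Y q) X)))" Y]
    by (simp add: sandwich_def mmul_assoc mmul_mpow_pull[OF sY])
  also have "mtrace n (mmul n (mpow n Y p) (mmul n (mmul n Y X) (mmul n (mpow n Y q) (mmul n Y X))))
      = sandwich n Y X (Suc p) (Suc q)"
    by (simp add: sandwich_def mmul_assoc mmul_mpow_pull[OF sY])
  also have "mtrace n (mmul n (mpow n Y p) (mmul n (mmul n X Y) (mmul n (mpow n Y q) (mmul n X Y))))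
      = sandwich n Y X (Suc p) (Suc q)"
    using mtrace_commute[of n "mmul n (mpow n Y p) (mmul n X (mmul n Y (mmul n (mpow n Y q) X)))" Y]
    by (simp add: sandwich_def mmul_assoc)
  also have "mtrace n (mmul n (mpow n Y p) (mmul n (mmul n X Y) (mmul n (mpow n Y q) (mmul n Y X))))
      = sandwich n Y X p (Suc (Suc q))"
    by (simp add: sandwich_def mmul_assoc mmul_mpow_pull[OF sY])
  finally show ?thesis by simp
qed

lemma convex_symmetric_sequence_le_endpoint:
  fixes f :: "nat \<Rightarrow> real"
  assumes conv: "\<And>u. Suc (Suc u) \<le> n \<Longrightarrow> 2 * f (Suc u) \<le> f u + f (Suc (Suc u))"
    and sym: "\<And>u. u \<le> n \<Longrightarrow> f (n - u) = f u" and "u \<le> n"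
  shows "f u \<le> f 0"
proof -
  define d where "d i = f (Suc i) - f i" for i
  have mono: "d i \<le> d (i + j)" if "i + j < n" for i j
    using that
  proof (induction j)
    case (Suc j)
    then show ?case using conv[of "i + j"] by (simp add: d_def)
  qed simp
  \<comment> \<open>Compare the first \<open>u\<close> increments with the last \<open>u\<close> ones; by symmetry the latter sum to \<open>f 0 - f u\<close>.\<close>
  have "f u - f 0 = (\<Sum>i<u. d i)" unfolding d_def by (rule sum_lessThan_telescope[symmetric])
  also have "\<dots> \<le> (\<Sum>i<u. d (i + (n - u)))"
    using \<open>u \<le> n\<close> by (intro sum_mono mono) auto
  also have "\<dots> = (\<Sum>i<u. f (Suc i + (n - u)) - f (i + (n - u)))"
    by (simp add: d_def)
  also have "\<dots> = f (u + (n - u)) - f (0 + (n - u))"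
    by (rule sum_lessThan_telescope)
  also have "\<dots> = f 0 - f u" using sym[OF \<open>u \<le> n\<close>] sym[of 0] \<open>u \<le> n\<close> by simp
  finally show ?thesis by simp
qed

text \<open>Only exponents \<open>0\<close> and \<open>1\<close> need an argument, since \<open>Y^(j+2) = Y Y^j Y\<close>; for \<open>j = 1\<close> this is \<open>Y^2 \<le> R Y\<close>.\<close>

lemma mpow_quad_upper:
  assumes Y: "psd n Y" and R: "\<And>v. dot n v (act n Y v) \<le> R * dot n v v"
  shows "dot n v (act n (mpow n Y (Suc j)) v) \<le> R * dot n v (act n (mpow n Y j) v)"
proof (induction j arbitrary: v rule: less_induct)
  case (less j)
  note sY = psd_symm[OF Y]
  have shift: "dot n v (act n (mpow n Y (Suc (Suc i))) v) = dot n (act n Y v) (act n (mpow n Y i) (act n Y v))" for i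
  proof -
    have "mpow n Y (Suc (Suc i)) = mmul n Y (mmul n (mpow n Y i) Y)"
      using mpow_Suc_right[OF sY, of i] by simp
    then show ?thesis by (simp add: act_mmul act_dot_symm[OF sY])
  qed
  have one: "dot n w (act n (mpow n Y (Suc 0)) w') = dot n w (act n Y w')" for w w'
    by (simp add: act_mmul act_dot_symm[OF sY] dot_mone)
  consider "j = 0" | "j = Suc 0" | i where "j = Suc (Suc i)" by (metis not0_implies_Suc)
  then show ?case
  proof cases
    case 1
    then show ?thesis using R[of v] one by (simp add: dot_mone)
  next
    case 2
    let ?w = "act n Y v"
    have w0: "dot n ?w ?w \<ge> 0" by (rule dot_self_nonneg)
    have "(dot n ?w ?w)\<^sup>2 = (dot n v (act n Y ?w))\<^sup>2" by (simp add: act_dot_symm[OF sY])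
    also have "\<dots> \<le> dot n v (act n Y v) * dot n ?w (act n Y ?w)"
      by (rule psd_Cauchy_Schwarz[OF Y])
    also have "\<dots> \<le> dot n v (act n Y v) * (R * dot n ?w ?w)"
      by (intro mult_left_mono R psd_nonneg Y)
    finally have "dot n ?w ?w * dot n ?w ?w \<le> R * dot n v ?w * dot n ?w ?w"
      by (simp add: power2_eq_square mult_ac)
    moreover have "0 \<le> R * dot n v ?w" if "dot n ?w ?w = 0"
    proof -
      have "\<forall>i<n. ?w i = 0" using that by (simp add: dot_def sum_nonneg_eq_0_iff)
      then show ?thesis by (simp add: dot_def)
    qed
    ultimately have "dot n ?w ?w \<le> R * dot n v ?w"
      using w0 mult_right_le_imp_le[of "dot n ?w ?w" "dot n ?w ?w" "R * dot n v ?w"]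
      by (cases "dot n ?w ?w = 0") auto
    then show ?thesis using 2 shift[of 0] one by (simp add: dot_mone)
  next
    case 3
    then show ?thesis using less[of i "act n Y v"] shift[of "Suc i"] shift[of i] by simp
  qed
qed

lemma mpow_quad_lower:
  assumes Y: "psd n Y" and l: "\<And>v. l * dot n v v \<le> dot n v (act n Y v)" and "0 \<le> l"
  shows "l * dot n v (act n (mpow n Y j) v) \<le> dot n v (act n (mpow n Y (Suc j)) v)"
proof (induction j arbitrary: v rule: less_induct)
  case (less j)
  note sY = psd_symm[OF Y]
  have shift: "dot n v (act n (mpow n Y (Suc (Suc i))) v) = dot n (act n Y v) (act n (mpow n Y i) (act n Y v))" for i
  proof -
    have "mpow n Y (Suc (Suc i)) = mmul n Y (mmul n (mpow n Y i) Y)"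
      using mpow_Suc_right[OF sY, of i] by simp
    then show ?thesis by (simp add: act_mmul act_dot_symm[OF sY])
  qed
  have one: "dot n w (act n (mpow n Y (Suc 0)) w') = dot n w (act n Y w')" for w w'
    by (simp add: act_mmul act_dot_symm[OF sY] dot_mone)
  consider "j = 0" | "j = Suc 0" | i where "j = Suc (Suc i)" by (metis not0_implies_Suc)
  then show ?case
  proof cases
    case 1
    then show ?thesis using l[of v] one by (simp add: dot_mone)
  next
    case 2
    define w where "w = (\<lambda>i. 1 * act n Y v i + (-l) * v i)"
    have "0 \<le> dot n w w + l * (dot n v (act n Y v) - l * dot n v v)"
      using l[of v] \<open>0 \<le> l\<close> dot_self_nonneg[of n w] by simp
    also have "dot n w w = dot n (act n Y v) (act n Y v) - 2 * l * dot n v (act n Y v) + l * l * dot n v v"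
      unfolding w_def dot_lin_right dot_lin_left
      using dot_commute[of n "act n Y v" v] by (simp add: algebra_simps)
    finally have "l * dot n v (act n Y v) \<le> dot n (act n Y v) (act n Y v)"
      by (simp add: algebra_simps)
    then show ?thesis using 2 shift[of 0] one by (simp add: dot_mone)
  next
    case 3
    then show ?thesis using less[of i "act n Y v"] shift[of "Suc i"] shift[of i] by simp
  qed
qed

text \<open>Convexity and symmetry push the exponents to the endpoint \<open>b = 0\<close>, where the matrices no longer interlace
and \<open>X^2 \<le> R X\<close> applies.\<close>

lemma sandwich_le:
  assumes Y: "psd n Y" and X: "psd n X" and R: "\<And>v. dot n v (act n X v) \<le> R * dot n v v"
  shows "sandwich n Y X a b \<le> R * mtrace n (mmul n (mpow n Y (a + b)) X)"
proof -
  note sX = psd_symm[OF X]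
  have "sandwich n Y X (a + b - b) b \<le> sandwich n Y X (a + b - 0) 0"
  proof (rule convex_symmetric_sequence_le_endpoint[where n = "a + b" and f = "\<lambda>u. sandwich n Y X (a + b - u) u"])
    fix u assume u: "Suc (Suc u) \<le> a + b"
    then obtain p where "a + b = p + Suc (Suc u)" by (metis add.commute le_Suc_ex)
    then show "2 * sandwich n Y X (a + b - Suc u) (Suc u)
        \<le> sandwich n Y X (a + b - u) u + sandwich n Y X (a + b - Suc (Suc u)) (Suc (Suc u))"
      using sandwich_convex[OF Y sX, of p u] by (simp add: Suc_diff_le)
  next
    fix u assume "u \<le> a + b"
    then show "sandwich n Y X (a + b - (a + b - u)) (a + b - u) = sandwich n Y X (a + b - u) u"
      using sandwich_commute by simp
  qed simp
  also have "sandwich n Y X (a + b - 0) 0 = mtrace n (mmul n (mpow n Y (a + b)) (mmul n X X))"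
    by (simp add: sandwich_def mmul_mone_left symm_supp[OF sX])
  also have "\<dots> \<le> R * mtrace n (mmul n (mpow n Y (a + b)) X)"
  proof -
    have "0 \<le> mtrace n (mmul n (mpow n Y (a + b)) (\<lambda>i j. R * X i j + (-1) * mmul n X X i j))"
    proof (rule mtrace_mmul_nonneg[OF psd_mpow[OF Y]])
      fix v
      have "dot n (act n X v) (act n X v) \<le> R * dot n v (act n X v)"
        using mpow_quad_upper[OF X R, of v "Suc 0"]
        by (simp add: act_mmul act_dot_symm[OF sX] dot_mone)
      then show "0 \<le> dot n v (act n (\<lambda>i j. R * X i j + (-1) * mmul n X X i j) v)"
        unfolding act_lin dot_lin_right by (simp add: act_mmul act_dot_symm[OF sX])
    qed
    then show ?thesis unfolding mmul_lin_right mtrace_lin by simp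
  qed
  finally show ?thesis by simp
qed

lemma mpow_has_derivative:
  fixes B X :: rmat and s :: real
  assumes "symm n B" "symm n X"
  defines "Y \<equiv> \<lambda>s i j. 1 * B i j + (-s) * X i j"
  shows "((\<lambda>s. mpow n (Y s) k i j) has_real_derivative
     - (\<Sum>a<k. mmul n (mpow n (Y s) a) (mmul n X (mpow n (Y s) (k - Suc a))) i j)) (at s)"
proof (induction k arbitrary: i j)
  case (Suc k)
  have sY: "symm n (Y s)" unfolding Y_def using assms by (intro symm_lin)
  let ?D = "\<lambda>l j. \<Sum>a<k. mmul n (mpow n (Y s) a) (mmul n X (mpow n (Y s) (k - Suc a))) l j"
  have "((\<lambda>s. mpow n (Y s) (Suc k) i j) has_real_derivative
      (\<Sum>l<n. (- X i l) * mpow n (Y s) k l j + (- ?D l j) * Y s i l)) (at s)"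
  proof -
    have "((\<lambda>s. Y s i l) has_real_derivative - X i l) (at s)" for l
      unfolding Y_def by (auto intro!: derivative_eq_intros)
    then have "((\<lambda>s. \<Sum>l<n. Y s i l * mpow n (Y s) k l j) has_real_derivative
      (\<Sum>l<n. (- X i l) * mpow n (Y s) k l j + (- ?D l j) * Y s i l)) (at s)"
      by (intro DERIV_sum DERIV_mult Suc.IH)
    moreover have "(\<lambda>s. mpow n (Y s) (Suc k) i j) = (\<lambda>s. \<Sum>l<n. Y s i l * mpow n (Y s) k l j)"
      by (simp add: mmul_def)
    ultimately show ?thesis by simp
  qed
  also have "(\<Sum>l<n. (- X i l) * mpow n (Y s) k l j + (- ?D l j) * Y s i l)
     = - (mmul n X (mpow n (Y s) k) i j + mmul n (Y s) ?D i j)"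
    by (simp add: mmul_def sum.distrib sum_negf sum_subtractf mult.commute)
  also have "mmul n (Y s) ?D i j = (\<Sum>a<k. mmul n (mpow n (Y s) (Suc a)) (mmul n X (mpow n (Y s) (k - Suc a))) i j)"
  proof -
    have "mmul n (Y s) ?D i j = (\<Sum>a<k. mmul n (Y s) (mmul n (mpow n (Y s) a) (mmul n X (mpow n (Y s) (k - Suc a)))) i j)"
      unfolding mmul_def[of n "Y s"] sum_distrib_left by (rule sum.swap)
    then show ?thesis by (simp add: mmul_assoc)
  qed
  also have "mmul n X (mpow n (Y s) k) i j = mmul n (mpow n (Y s) 0) (mmul n X (mpow n (Y s) k)) i j"
    unfolding mpow.simps by (subst mmul_mone_left) (simp_all add: mmul_def symm_supp[OF assms(2)])
  finally show ?case unfolding sum.lessThan_Suc_shift by simp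
qed (simp add: Y_def)

lemma mtrace_power_has_derivative:
  fixes B X :: rmat and s :: real
  assumes "symm n B" "symm n X"
  defines "Y \<equiv> \<lambda>s i j. 1 * B i j + (-s) * X i j"
  shows "((\<lambda>s. mtrace n (mpow n (Y s) k)) has_real_derivative
      - real k * mtrace n (mmul n (mpow n (Y s) (k - 1)) X)) (at s)"
    and "((\<lambda>s. mtrace n (mmul n (mpow n (Y s) k) X)) has_real_derivative
      - (\<Sum>a<k. sandwich n (Y s) X a (k - Suc a))) (at s)"
proof -
  have sY: "symm n (Y s)" unfolding Y_def using assms by (intro symm_lin)
  have "(\<lambda>i j. 1 * B i j + (-s) * X i j) = Y s" for s by (simp add: Y_def)
  note D = mpow_has_derivative[OF assms(1,2), unfolded this]
  have "((\<lambda>s. mtrace n (mpow n (Y s) k)) has_real_derivative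
     (\<Sum>i<n. - (\<Sum>a<k. mmul n (mpow n (Y s) a) (mmul n X (mpow n (Y s) (k - Suc a))) i i))) (at s)"
    unfolding mtrace_def by (intro DERIV_sum D)
  also have "(\<Sum>i<n. - (\<Sum>a<k. mmul n (mpow n (Y s) a) (mmul n X (mpow n (Y s) (k - Suc a))) i i))
     = - (\<Sum>a<k. mtrace n (mmul n (mpow n (Y s) a) (mmul n X (mpow n (Y s) (k - Suc a)))))"
    unfolding sum_negf mtrace_def by (subst sum.swap) simp
  also have "(\<Sum>a<k. mtrace n (mmul n (mpow n (Y s) a) (mmul n X (mpow n (Y s) (k - Suc a)))))
     = (\<Sum>a<k. mtrace n (mmul n (mpow n (Y s) (k - 1)) X))"
  proof (intro sum.cong refl)
    fix a assume "a \<in> {..<k}"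
    then have "k - Suc a + a = k - 1" by auto
    then have "mmul n (mmul n (mpow n (Y s) (k - Suc a)) (mpow n (Y s) a)) X = mmul n (mpow n (Y s) (k - 1)) X"
      using mpow_add[OF sY, of "k - Suc a" a] by simp
    then show "mtrace n (mmul n (mpow n (Y s) a) (mmul n X (mpow n (Y s) (k - Suc a))))
        = mtrace n (mmul n (mpow n (Y s) (k - 1)) X)"
      using mtrace_commute[of n "mmul n (mpow n (Y s) a) X" "mpow n (Y s) (k - Suc a)"]
      by (simp add: mmul_assoc)
  qed
  finally show "((\<lambda>s. mtrace n (mpow n (Y s) k)) has_real_derivative
      - real k * mtrace n (mmul n (mpow n (Y s) (k - 1)) X)) (at s)" by simp
  have "((\<lambda>s. mtrace n (mmul n (mpow n (Y s) k) X)) has_real_derivative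
     (\<Sum>i<n. \<Sum>l<n. (- (\<Sum>a<k. mmul n (mpow n (Y s) a) (mmul n X (mpow n (Y s) (k - Suc a))) i l)) * X l i)) (at s)"
    unfolding mtrace_def mmul_def[of n _ X] by (intro DERIV_sum DERIV_cmult_right D)
  also have "(\<Sum>i<n. \<Sum>l<n. (- (\<Sum>a<k. mmul n (mpow n (Y s) a) (mmul n X (mpow n (Y s) (k - Suc a))) i l)) * X l i)
     = - (\<Sum>i<n. \<Sum>l<n. \<Sum>a<k. mmul n (mpow n (Y s) a) (mmul n X (mpow n (Y s) (k - Suc a))) i l * X l i)"
    by (simp add: sum_negf sum_distrib_right)
  also have "(\<Sum>i<n. \<Sum>l<n. \<Sum>a<k. mmul n (mpow n (Y s) a) (mmul n X (mpow n (Y s) (k - Suc a))) i l * X l i)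
     = (\<Sum>i<n. \<Sum>a<k. \<Sum>l<n. mmul n (mpow n (Y s) a) (mmul n X (mpow n (Y s) (k - Suc a))) i l * X l i)"
    by (intro sum.cong refl sum.swap)
  also have "\<dots> = (\<Sum>a<k. \<Sum>i<n. \<Sum>l<n. mmul n (mpow n (Y s) a) (mmul n X (mpow n (Y s) (k - Suc a))) i l * X l i)"
    by (rule sum.swap)
  also have "\<dots> = (\<Sum>a<k. mtrace n (mmul n (mmul n (mpow n (Y s) a) (mmul n X (mpow n (Y s) (k - Suc a)))) X))"
    by (simp add: mtrace_def mmul_def[of n _ X])
  also have "\<dots> = (\<Sum>a<k. sandwich n (Y s) X a (k - Suc a))"
    by (simp add: sandwich_def mmul_assoc)
  finally show "((\<lambda>s. mtrace n (mmul n (mpow n (Y s) k) X)) has_real_derivative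
      - (\<Sum>a<k. sandwich n (Y s) X a (k - Suc a))) (at s)" .
qed

text \<open>The one-step estimate behind the matrix Chernoff bound: subtracting \<open>\<eta> X\<close> lowers the trace of the \<open>k\<close>-th
power by almost its first order term. It is a polynomial form of
\<open>trace (exp (H - \<theta> X)) \<le> trace (exp H) - (1 - exp (- R \<theta>)) / R * trace (exp H X)\<close>, usually deduced from the
Golden-Thompson inequality. Here it follows from a differential inequality: the second derivative is at most
\<open>c\<close> times the negative of the first, because the \<open>sandwich\<close> terms are dominated by the first derivative.\<close>

lemma mtrace_power_step:
  assumes B: "symm n B" and X: "psd n X" and R: "\<And>v. dot n v (act n X v) \<le> R * dot n v v" "0 < R"
    and l: "\<And>v. l * dot n v v \<le> dot n v (act n (\<lambda>i j. 1 * B i j + (-\<eta>) * X i j) v)" "0 < l"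
    and \<eta>: "0 \<le> \<eta>" and k: "0 < k"
  defines "c \<equiv> real k * R / l"
  shows "mtrace n (mpow n (\<lambda>i j. 1 * B i j + (-\<eta>) * X i j) k)
    \<le> mtrace n (mpow n B k) - (real k * (1 - exp (- c * \<eta>)) / c) * mtrace n (mmul n (mpow n B (k - 1)) X)"
proof -
  define Y where "Y s = (\<lambda>i j. 1 * B i j + (-s) * X i j)" for s
  note sX = psd_symm[OF X]
  have c: "0 < c" using R l k by (simp add: c_def)
  have Yl: "l * dot n v v \<le> dot n v (act n (Y s) v)" if "0 \<le> s" "s \<le> \<eta>" for s v
  proof -
    have "s * dot n v (act n X v) \<le> \<eta> * dot n v (act n X v)"
      using that by (intro mult_right_mono psd_nonneg X)
    then show ?thesis using l(1)[of v] unfolding Y_def act_lin dot_lin_right by simp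
  qed
  have Ypsd: "psd n (Y s)" if "0 \<le> s" "s \<le> \<eta>" for s
  proof -
    have "symm n (Y s)" unfolding Y_def by (intro symm_lin B sX)
    moreover have "0 \<le> dot n v (act n (Y s) v)" for v
      using Yl[OF that, of v] l(2) dot_self_nonneg[of n v] mult_nonneg_nonneg[of l "dot n v v"] by linarith
    ultimately show ?thesis by (simp add: psd_def)
  qed
  \<comment> \<open>\<open>- h\<close> is the derivative of the trace of the power along \<open>Y s = B - s X\<close>, and \<open>h' \<ge> - c h\<close>
    forces \<open>h\<close> to decrease at most exponentially.\<close>
  define h where "h s = real k * mtrace n (mmul n (mpow n (Y s) (k - 1)) X)" for s
  define h' where "h' s = - (real k * (\<Sum>a<k - 1. sandwich n (Y s) X a (k - 1 - Suc a)))" for s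
  have dh: "(h has_real_derivative h' s) (at s)" for s
    unfolding h_def h'_def
    using DERIV_cmult[OF mtrace_power_has_derivative(2)[OF B sX, of "k - 1" s, folded Y_def], of "real k"]
    by simp
  have tr0: "0 \<le> mtrace n (mmul n (mpow n (Y s) j) X)" if "0 \<le> s" "s \<le> \<eta>" for s j
    by (intro mtrace_mmul_nonneg psd_mpow Ypsd that psd_nonneg X)
  have h'c: "0 \<le> h' s + c * h s" if s: "0 \<le> s" "s \<le> \<eta>" for s
  proof (cases "k = 1")
    case True
    then have "h' s = 0" by (simp add: h'_def)
    moreover have "0 \<le> c * h s" using tr0[OF s] c by (simp add: h_def)
    ultimately show ?thesis by linarith
  next
    case False
    then have "k = Suc (Suc (k - 2))" using k by linarith
    then obtain j where j: "k = Suc (Suc j)" by blast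
    let ?t = "\<lambda>j. mtrace n (mmul n (mpow n (Y s) j) X)"
    have "(\<Sum>a<k - 1. sandwich n (Y s) X a (k - 1 - Suc a)) \<le> (\<Sum>a<k - 1. R * ?t j)"
    proof (intro sum_mono)
      fix a assume "a \<in> {..<k - 1}"
      then have "a + (k - 1 - Suc a) = j" using j by auto
      then show "sandwich n (Y s) X a (k - 1 - Suc a) \<le> R * ?t j"
        using sandwich_le[OF Ypsd[OF s] X R(1), of a "k - 1 - Suc a"] by simp
    qed
    also have "\<dots> = real (Suc j) * (R * ?t j)" using j by simp
    also have "\<dots> \<le> real k * (R * ?t j)"
      using j R tr0[OF s] by (intro mult_right_mono) auto
    also have "?t j \<le> ?t (Suc j) / l"
    proof -
      have "0 \<le> mtrace n (mmul n X (\<lambda>i j'. 1 * mpow n (Y s) (Suc j) i j' + (-l) * mpow n (Y s) j i j'))"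
      proof (rule mtrace_mmul_nonneg[OF X])
        fix v
        show "0 \<le> dot n v (act n (\<lambda>i j'. 1 * mpow n (Y s) (Suc j) i j' + (-l) * mpow n (Y s) j i j') v)"
          using mpow_quad_lower[OF Ypsd[OF s] Yl[OF s], of v j] l(2)
          unfolding act_lin dot_lin_right by simp
      qed
      then have "l * ?t j \<le> ?t (Suc j)"
        unfolding mmul_lin_right mtrace_lin mtrace_commute[of n X] by simp
      then show ?thesis using l(2) by (simp add: field_simps)
    qed
    finally have "(\<Sum>a<k - 1. sandwich n (Y s) X a (k - 1 - Suc a)) \<le> real k * (R * (?t (Suc j) / l))"
      using R k by simp
    then have "real k * (\<Sum>a<k - 1. sandwich n (Y s) X a (k - 1 - Suc a)) \<le> real k * (real k * (R * (?t (Suc j) / l)))"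
      by (intro mult_left_mono) auto
    also have "\<dots> = c * h s" using j by (simp add: c_def h_def)
    finally show ?thesis by (simp add: h'_def)
  qed
  have hexp: "h 0 * exp (- c * s) \<le> h s" if "0 \<le> s" "s \<le> \<eta>" for s
  proof -
    have "h 0 * exp (c * 0) \<le> h s * exp (c * s)"
    proof (rule DERIV_nonneg_imp_nondecreasing[OF that(1)])
      fix u assume u: "0 \<le> u" "u \<le> s"
      have "((\<lambda>s. h s * exp (c * s)) has_real_derivative (h' u + c * h u) * exp (c * u)) (at u)"
        by (rule derivative_eq_intros dh refl)+ (simp add: algebra_simps)
      moreover have "0 \<le> (h' u + c * h u) * exp (c * u)" using h'c[of u] u that by simp
      ultimately show "\<exists>y. ((\<lambda>s. h s * exp (c * s)) has_real_derivative y) (at u) \<and> 0 \<le> y" by blast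
    qed
    then have "h 0 * exp (- c * s) \<le> h s * exp (c * s) * exp (- c * s)"
      by (intro mult_right_mono) auto
    then show ?thesis by (simp add: mult.assoc mult_exp_exp)
  qed
  define G where "G s = mtrace n (mpow n (Y s) k) + h 0 * ((1 - exp (- c * s)) / c)" for s
  have "G \<eta> \<le> G 0"
  proof (rule DERIV_nonpos_imp_nonincreasing[OF \<eta>])
    fix u assume u: "0 \<le> u" "u \<le> \<eta>"
    have "((\<lambda>s. mtrace n (mpow n (Y s) k)) has_real_derivative - h u) (at u)"
      using mtrace_power_has_derivative(1)[OF B sX, of k u, folded Y_def] by (simp add: h_def)
    moreover have "((\<lambda>s. h 0 * ((1 - exp (- c * s)) / c)) has_real_derivative h 0 * exp (- c * u)) (at u)"
      using c by (auto intro!: derivative_eq_intros)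
    ultimately have "(G has_real_derivative - h u + h 0 * exp (- c * u)) (at u)"
      unfolding G_def by (rule DERIV_add)
    then show "\<exists>y. (G has_real_derivative y) (at u) \<and> y \<le> 0" using hexp[OF u] by (intro exI conjI) auto
  qed
  have "Y 0 = B" by (simp add: Y_def)
  then have h0: "h 0 = real k * mtrace n (mmul n (mpow n B (k - 1)) X)"
    and G0: "G 0 = mtrace n (mpow n B k)" by (simp_all add: h_def G_def)
  have "h 0 * ((1 - exp (- c * \<eta>)) / c) =
      (real k * (1 - exp (- c * \<eta>)) / c) * mtrace n (mmul n (mpow n B (k - 1)) X)"
    unfolding h0 by simp
  then have "mtrace n (mpow n (Y \<eta>) k)
    \<le> mtrace n (mpow n B k) - (real k * (1 - exp (- c * \<eta>)) / c) * mtrace n (mmul n (mpow n B (k - 1)) X)"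
    using \<open>G \<eta> \<le> G 0\<close> unfolding G0 unfolding G_def by linarith
  then show ?thesis unfolding Y_def .
qed

section \<open>The lower tail of the matrix Chernoff inequality\<close>

lemma psd_mone: "psd n (mone n)"
  by (simp add: psd_def symm_mone dot_mone dot_self_nonneg)

lemma mtrace_nonneg:
  assumes "psd n P"
  shows "0 \<le> mtrace n P"
proof -
  have "mmul n (mone n) P = P"
    using symm_supp[OF psd_symm[OF assms]] by (intro mmul_mone_left) blast
  then show ?thesis using mtrace_mmul_nonneg[OF psd_mone psd_nonneg[OF assms]] by simp
qed

lemma dot_Cauchy_Schwarz: "(dot n u v)\<^sup>2 \<le> dot n u u * dot n v v"
  using psd_Cauchy_Schwarz[OF psd_mone, of n u v] by (simp add: dot_mone)

lemma quad_le_mtrace: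
  assumes "psd n P"
  shows "dot n v (act n P v) \<le> dot n v v * mtrace n P"
proof -
  obtain L where L: "\<And>i j. i < n \<Longrightarrow> j < n \<Longrightarrow> P i j = (\<Sum>k<n. L k i * L k j)"
    using psd_factorization[of n P] symm_sym[OF psd_symm[OF assms]] psd_nonneg[OF assms] by metis
  have "dot n v (act n P v) = (\<Sum>i<n. \<Sum>j<n. \<Sum>k<n. v i * L k i * (L k j * v j))"
    by (simp add: dot_def act_def L sum_distrib_left sum_distrib_right mult_ac)
  also have "\<dots> = (\<Sum>i<n. \<Sum>k<n. \<Sum>j<n. v i * L k i * (L k j * v j))"
    by (intro sum.cong refl sum.swap)
  also have "\<dots> = (\<Sum>k<n. \<Sum>i<n. \<Sum>j<n. v i * L k i * (L k j * v j))"
    by (rule sum.swap)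
  also have "\<dots> = (\<Sum>k<n. (dot n v (L k))\<^sup>2)"
    by (simp add: dot_def power2_eq_square sum_product mult_ac)
  also have "\<dots> \<le> (\<Sum>k<n. dot n v v * dot n (L k) (L k))"
    by (intro sum_mono dot_Cauchy_Schwarz)
  also have "\<dots> = dot n v v * mtrace n P"
  proof -
    have "mtrace n P = (\<Sum>i<n. \<Sum>k<n. L k i * L k i)" by (simp add: mtrace_def L)
    also have "\<dots> = (\<Sum>k<n. \<Sum>i<n. L k i * L k i)" by (rule sum.swap)
    finally show ?thesis by (simp add: sum_distrib_left dot_def)
  qed
  finally show ?thesis .
qed

text \<open>Jensen's inequality for the spectral measure of \<open>B\<close> at \<open>v\<close>, obtained from the log-convexity of the moments
\<open>k \<mapsto> v^T B^k v\<close>.\<close>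

lemma quad_power_le:
  assumes B: "psd n B"
  shows "(dot n v (act n B v)) ^ k * dot n v v \<le> (dot n v v) ^ k * dot n v (act n (mpow n B k) v)"
proof -
  note sB = psd_symm[OF B]
  define m where "m j = dot n v (act n (mpow n B j) v)" for j
  have m0: "0 \<le> m j" for j unfolding m_def by (intro psd_nonneg psd_mpow B)
  have m_Suc: "m (Suc j) = dot n v (act n (mpow n B j) (act n B v))" for j
    unfolding m_def using mpow_Suc_right[OF sB, of j] by (metis act_mmul)
  have conv: "(m (Suc j))\<^sup>2 \<le> m j * m (Suc (Suc j))" for j
  proof -
    have e: "m (Suc (Suc j)) = dot n (act n B v) (act n (mpow n B j) (act n B v))"
      unfolding m_Suc by (simp add: act_mmul act_dot_symm[OF sB])
    show ?thesis unfolding e unfolding m_Suc unfolding m_def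
      by (rule psd_Cauchy_Schwarz[OF psd_mpow[OF B]])
  qed
  have step: "m (Suc 0) * m j \<le> m 0 * m (Suc j)" for j
  proof (induction j)
    case (Suc j)
    show ?case
    proof (cases "m (Suc j) = 0")
      case False
      then have p: "0 < m (Suc j)" using m0[of "Suc j"] by simp
      have pj: "0 < m j"
      proof (rule ccontr)
        assume "\<not> 0 < m j"
        then have "m j = 0" using m0[of j] by simp
        then show False using conv[of j] p by simp
      qed
      have "m (Suc 0) * m (Suc j) * m j = (m (Suc 0) * m j) * m (Suc j)" by simp
      also have "\<dots> \<le> (m 0 * m (Suc j)) * m (Suc j)" using Suc.IH p by (intro mult_right_mono) auto
      also have "\<dots> = m 0 * (m (Suc j))\<^sup>2" by (simp add: power2_eq_square)
      also have "\<dots> \<le> m 0 * (m j * m (Suc (Suc j)))" by (intro mult_left_mono conv m0)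
      finally have "m (Suc 0) * m (Suc j) * m j \<le> m 0 * m (Suc (Suc j)) * m j" by (simp add: mult_ac)
      then show ?thesis using pj by simp
    qed (use m0 in simp)
  qed simp
  have "m (Suc 0) ^ k * m 0 \<le> m 0 ^ k * m k"
  proof (induction k)
    case (Suc k)
    have "m (Suc 0) ^ Suc k * m 0 = m (Suc 0) * (m (Suc 0) ^ k * m 0)" by simp
    also have "\<dots> \<le> m (Suc 0) * (m 0 ^ k * m k)" by (intro mult_left_mono Suc.IH m0)
    also have "\<dots> = m 0 ^ k * (m (Suc 0) * m k)" by simp
    also have "\<dots> \<le> m 0 ^ k * (m 0 * m (Suc k))" by (intro mult_left_mono step zero_le_power m0)
    finally show ?case by (simp add: mult_ac)
  qed simp
  moreover have "m (Suc 0) = dot n v (act n B v)" unfolding m_Suc by (simp add: dot_mone)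
  moreover have "m 0 = dot n v v" by (simp add: m_def dot_mone)
  ultimately show ?thesis by (simp add: m_def)
qed

lemma mpow_entry_measurable:
  assumes "\<And>i j. i < n \<Longrightarrow> j < n \<Longrightarrow> (\<lambda>x. A x i j) \<in> borel_measurable M" "i < n" "j < n"
  shows "(\<lambda>x. mpow n (A x) k i j) \<in> borel_measurable M"
  using assms(2,3)
proof (induction k arbitrary: i j)
  case (Suc k)
  then show ?case unfolding mpow.simps mmul_def
    by (intro borel_measurable_sum borel_measurable_times assms(1)) auto
qed (simp add: mone_def)

text \<open>Boundedness, uniform over the random matrices, makes all entries of their powers integrable.\<close>

lemma mpow_entry_bounded:
  assumes "0 \<le> b"
  shows "\<exists>C\<ge>0. \<forall>A. (\<forall>i<n. \<forall>j<n. \<bar>A i j\<bar> \<le> b) \<longrightarrow> (\<forall>i<n. \<forall>j<n. \<bar>mpow n A k i j\<bar> \<le> C)"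
proof (induction k)
  case 0
  show ?case by (intro exI[of _ 1]) (auto simp: mone_def)
next
  case (Suc k)
  then obtain C where C: "C \<ge> 0" "\<And>A. (\<forall>i<n. \<forall>j<n. \<bar>A i j\<bar> \<le> b) \<Longrightarrow> (\<forall>i<n. \<forall>j<n. \<bar>mpow n A k i j\<bar> \<le> C)"
    by blast
  have "\<bar>mpow n A (Suc k) i j\<bar> \<le> n * (b * C)"
    if A: "\<forall>i<n. \<forall>j<n. \<bar>A i j\<bar> \<le> b" and ij: "i < n" "j < n" for A :: rmat and i j
  proof -
    have "\<bar>mpow n A (Suc k) i j\<bar> \<le> (\<Sum>l<n. \<bar>A i l * mpow n A k l j\<bar>)"
      unfolding mpow.simps mmul_def by (rule sum_abs)
    also have "\<dots> \<le> (\<Sum>l<n. b * C)"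
      using A C(2)[OF A] C(1) ij assms by (intro sum_mono) (auto simp: abs_mult intro!: mult_mono)
    finally show ?thesis by simp
  qed
  then show ?case using C(1) assms by (intro exI[of _ "n * (b * C)"]) auto
qed

lemma psd_entry_le:
  assumes X: "psd n X" and R: "\<And>v. dot n v (act n X v) \<le> R * dot n v v" and ij: "i < n" "j < n"
  shows "\<bar>X i j\<bar> \<le> R"
proof -
  define e where "e i = (\<lambda>j. if j = i then 1 else 0 :: real)" for i :: nat
  have ae: "act n X (e j) i = X i j" if "j < n" for i j
    using that by (simp add: act_def e_def if_distrib[of "\<lambda>x. _ * x"] cong: if_cong)
  have de: "dot n (e i) w = w i" if "i < n" for i w
    using that by (simp add: dot_def e_def if_distrib[of "\<lambda>x. x * _"] cong: if_cong)
  have d: "X i i \<le> R" "0 \<le> X i i" if "i < n" for i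
    using R[of "e i"] psd_nonneg[OF X, of "e i"] that by (simp_all add: ae de) (simp_all add: e_def)
  have "(X i j)\<^sup>2 \<le> X i i * X j j"
    using psd_Cauchy_Schwarz[OF X, of "e i" "e j"] ij by (simp add: ae de)
  also have "\<dots> \<le> R * R" using d ij by (intro mult_mono) (auto intro: order_trans)
  finally have "(X i j)\<^sup>2 \<le> R\<^sup>2" by (simp add: power2_eq_square)
  then show ?thesis using abs_le_square_iff[of "X i j" R] d[OF ij(1)] by linarith
qed

text \<open>The exponent obtained from the polynomial potential \<open>trace ((1 - \<eta> S)^k)\<close> converges to the one that the
exponential potential gives.\<close>

lemma matrix_Chernoff_limit:
  fixes N R :: real
  assumes "0 < R"
  defines "lam \<equiv> \<lambda>k::nat. 1 - N * ln 2 / k"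
  shows "(\<lambda>k. exp (- (lam k * (1 - exp (- (ln 2 / lam k))) / R)) / (1 + (- (ln 2 / (2 * R))) / k) ^ k)
    \<longlonglongrightarrow> exp (- ((1 - ln 2) / (2 * R)))"
proof -
  have "(\<lambda>k::nat. N * ln 2 / real k) \<longlonglongrightarrow> 0"
    by (rule lim_const_over_n)
  then have lam: "lam \<longlonglongrightarrow> 1" unfolding lam_def using tendsto_diff[OF tendsto_const[of 1]] by fastforce
  have "(\<lambda>k. exp (- (lam k * (1 - exp (- (ln 2 / lam k))) / R)) / (1 + (- (ln 2 / (2 * R))) / k) ^ k)
     \<longlonglongrightarrow> exp (- (1 * (1 - exp (- (ln 2 / 1))) / R)) / exp (- (ln 2 / (2 * R)))"
    using assms by (intro tendsto_intros lam tendsto_exp_limit_sequentially) auto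
  also have "exp (- (1 * (1 - exp (- (ln 2 / 1))) / R)) / exp (- (ln 2 / (2 * R)))
      = exp (- ((1 - ln 2) / (2 * R)))"
  proof -
    have "- (1 * (1 - exp (- (ln 2 / 1))) / R) - (- (ln 2 / (2 * R))) = - ((1 - ln 2) / (2 * R))"
      using assms by (simp add: exp_minus field_simps)
    then show ?thesis unfolding exp_diff[symmetric] by (simp only:)
  qed
  finally show ?thesis .
qed

text \<open>The lower tail of the matrix Chernoff inequality at level \<open>1/2\<close>. The potential is the trace of
\<open>(1 - \<eta> S i)^k\<close> for the partial sums \<open>S i\<close>. The next summand is independent of the past and its mean is a multiple
of the identity, so \<open>mtrace_power_step\<close> contracts the expected potential at every step. A direction in which
the full sum is below \<open>1/2\<close> makes the potential at least \<open>(1 - \<eta> / 2)^k\<close>, and Markov's inequality applies.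
Finally \<open>k\<close> tends to infinity.\<close>

lemma (in prob_space) matrix_Chernoff_lower_tail:
  fixes X :: "nat \<Rightarrow> 'a \<Rightarrow> rmat"
  assumes indep: "indep_vars (\<lambda>_. PiM ({..<n} \<times> {..<n}) (\<lambda>_. borel))
       (\<lambda>i \<omega>. \<lambda>p\<in>{..<n} \<times> {..<n}. X i \<omega> (fst p) (snd p)) {1..N}"
    and psdX: "\<And>i \<omega>. i \<in> {1..N} \<Longrightarrow> \<omega> \<in> space M \<Longrightarrow> psd n (X i \<omega>)"
    and R: "\<And>i \<omega> v. i \<in> {1..N} \<Longrightarrow> \<omega> \<in> space M \<Longrightarrow> dot n v (act n (X i \<omega>) v) \<le> R * dot n v v" "0 < R"
    and mean: "\<And>i j l. i \<in> {1..N} \<Longrightarrow> j < n \<Longrightarrow> l < n \<Longrightarrow>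
       expectation (\<lambda>\<omega>. X i \<omega> j l) = (if j = l then 1 / N else 0)"
    and N: "0 < N"
  shows "\<exists>Bad\<in>events. prob Bad \<le> n * exp (- ((1 - ln 2) / (2 * R))) \<and>
    (\<forall>\<omega>\<in>space M - Bad. \<forall>v. dot n v v / 2 \<le> dot n v (act n (\<lambda>j l. \<Sum>i\<in>{1..N}. X i \<omega> j l) v))"
proof -
  define S where "S i \<omega> = (\<lambda>j l. \<Sum>r\<in>{1..i}. X r \<omega> j l)" for i \<omega>
  have S_Suc: "S (Suc i) \<omega> = (\<lambda>j l. 1 * S i \<omega> j l + 1 * X (Suc i) \<omega> j l)" for i \<omega>
    by (simp add: S_def)
  have S_psd: "psd n (S i \<omega>)" "dot n v (act n (S i \<omega>) v) \<le> (i * R) * dot n v v"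
    if "i \<le> N" "\<omega> \<in> space M" for i \<omega> v
  proof -
    have "psd n (S i \<omega>) \<and> (\<forall>v. dot n v (act n (S i \<omega>) v) \<le> (i * R) * dot n v v)"
      using that(1)
    proof (induction i)
      case 0
      then show ?case by (simp add: S_def psd_def symm_def act_def dot_def)
    next
      case (Suc i)
      have P: "psd n (X (Suc i) \<omega>)" using Suc that by (intro psdX) auto
      have "psd n (S (Suc i) \<omega>)"
        unfolding psd_def S_Suc act_lin dot_lin_right
        using Suc.IH P Suc.prems symm_lin[of n "S i \<omega>" "X (Suc i) \<omega>" 1 1] by (auto simp: psd_def)
      moreover have "dot n v (act n (S (Suc i) \<omega>) v) \<le> (Suc i * R) * dot n v v" for v
      proof -
        have "dot n v (act n (S i \<omega>) v) \<le> i * R * dot n v v" using Suc by auto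
        moreover have "dot n v (act n (X (Suc i) \<omega>) v) \<le> R * dot n v v"
          using Suc.prems that by (intro R) auto
        moreover have "Suc i * R * dot n v v = i * R * dot n v v + R * dot n v v"
          by (simp add: algebra_simps)
        ultimately show ?thesis unfolding S_Suc act_lin dot_lin_right by linarith
      qed
      ultimately show ?case by blast
    qed
    then show "psd n (S i \<omega>)" "dot n v (act n (S i \<omega>) v) \<le> (i * R) * dot n v v" by auto
  qed
  have X_meas[measurable]: "(\<lambda>\<omega>. X i \<omega> j l) \<in> borel_measurable M" if "i \<in> {1..N}" "j < n" "l < n" for i j l
  proof -
    have "(\<lambda>\<omega>. \<lambda>p\<in>{..<n} \<times> {..<n}. X i \<omega> (fst p) (snd p)) \<in> measurable M (PiM ({..<n} \<times> {..<n}) (\<lambda>_. borel))"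
      using indep that(1) unfolding indep_vars_def2 by blast
    from measurable_compose[OF this measurable_component_singleton[of "(j, l)"]]
    have "(\<lambda>\<omega>. (\<lambda>p\<in>{..<n} \<times> {..<n}. X i \<omega> (fst p) (snd p)) (j, l)) \<in> borel_measurable M"
      using that by blast
    then show ?thesis using that by simp
  qed
  have X_bd: "\<bar>X i \<omega> j l\<bar> \<le> R" if "i \<in> {1..N}" "j < n" "l < n" "\<omega> \<in> space M" for i j l \<omega>
    using that by (intro psd_entry_le[of n]) (auto intro: psdX R(1))
  define Bm where "Bm \<eta> i \<omega> = (\<lambda>j l. 1 * mone n j l + (-\<eta>) * S i \<omega> j l)" for \<eta> i \<omega>
  have Bm_Suc: "Bm \<eta> (Suc i) \<omega> = (\<lambda>j l. 1 * Bm \<eta> i \<omega> j l + (-\<eta>) * X (Suc i) \<omega> j l)" for \<eta> i \<omega>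
    by (simp add: Bm_def S_Suc algebra_simps)
  have Bm_meas[measurable]: "(\<lambda>\<omega>. Bm \<eta> i \<omega> j l) \<in> borel_measurable M" if "i \<le> N" "j < n" "l < n" for \<eta> i j l
    unfolding Bm_def S_def using that by (intro borel_measurable_add borel_measurable_times borel_measurable_sum X_meas) auto
  have pow_int: "integrable M (\<lambda>\<omega>. mpow n (Bm \<eta> i \<omega>) k j l)" if i: "i \<le> N" and jl: "j < n" "l < n" for \<eta> i j l k
  proof -
    define b where "b = 1 + \<bar>\<eta>\<bar> * (i * R)"
    have b: "\<bar>Bm \<eta> i \<omega> j l\<bar> \<le> b" if "\<omega> \<in> space M" "j < n" "l < n" for \<omega> j l
    proof -
      have "\<bar>S i \<omega> j l\<bar> \<le> i * R" using that i by (intro psd_entry_le[of n] S_psd) auto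
      then have "\<bar>\<eta>\<bar> * \<bar>S i \<omega> j l\<bar> \<le> \<bar>\<eta>\<bar> * (i * R)" by (intro mult_left_mono) auto
      moreover have "\<bar>mone n j l\<bar> \<le> 1" by (simp add: mone_def)
      moreover have "\<bar>Bm \<eta> i \<omega> j l\<bar> \<le> \<bar>mone n j l\<bar> + \<bar>\<eta>\<bar> * \<bar>S i \<omega> j l\<bar>"
        unfolding Bm_def abs_mult[symmetric] by (simp add: abs_le_iff) linarith
      ultimately show ?thesis unfolding b_def by linarith
    qed
    have "0 \<le> b" using R by (simp add: b_def)
    then obtain C where "\<And>A. (\<forall>i<n. \<forall>j<n. \<bar>A i j\<bar> \<le> b) \<Longrightarrow> (\<forall>i<n. \<forall>j<n. \<bar>mpow n A k i j\<bar> \<le> C)"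
      using mpow_entry_bounded[of b n k] by blast
    then have "\<bar>mpow n (Bm \<eta> i \<omega>) k j l\<bar> \<le> C" if "\<omega> \<in> space M" for \<omega>
      using b[OF that] jl by blast
    then show ?thesis using i jl
      by (intro integrable_const_bound[where B = C] mpow_entry_measurable) auto
  qed
  have tr_int: "integrable M (\<lambda>\<omega>. mtrace n (mpow n (Bm \<eta> i \<omega>) k))" if "i \<le> N" for \<eta> i k
    unfolding mtrace_def using that by (intro Bochner_Integration.integrable_sum pow_int) auto
  have prod_mean: "integrable M (\<lambda>\<omega>. mpow n (Bm \<eta> i \<omega>) k j l * X (Suc i) \<omega> l j)"
      "expectation (\<lambda>\<omega>. mpow n (Bm \<eta> i \<omega>) k j l * X (Suc i) \<omega> l j)
        = expectation (\<lambda>\<omega>. mpow n (Bm \<eta> i \<omega>) k j l) * (if l = j then 1 / N else 0)"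
    if i: "Suc i \<le> N" and jl: "j < n" "l < n" for \<eta> i j l k
  proof -
    let ?P = "{..<n} \<times> {..<n}"
    let ?E = "\<lambda>i \<omega>. \<lambda>p\<in>?P. X i \<omega> (fst p) (snd p)"
    define B' where "B' w = (\<lambda>j l. if j < n \<and> l < n then mone n j l - \<eta> * (\<Sum>r\<in>{1..i}. w r (j, l)) else 0)"
      for w :: "nat \<Rightarrow> nat \<times> nat \<Rightarrow> real"
    define g where "g w = mpow n (B' w) k j l" for w
    have iv: "indep_var (PiM {1..i} (\<lambda>_. PiM ?P (\<lambda>_. borel))) (\<lambda>\<omega>. restrict (\<lambda>r. ?E r \<omega>) {1..i})
        (PiM {Suc i} (\<lambda>_. PiM ?P (\<lambda>_. borel))) (\<lambda>\<omega>. restrict (\<lambda>r. ?E r \<omega>) {Suc i})"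
      using i by (intro indep_var_restrict[OF indep]) auto
    have gm: "g \<in> borel_measurable (PiM {1..i} (\<lambda>_. PiM ?P (\<lambda>_. borel)))"
      unfolding g_def
    proof (rule mpow_entry_measurable)
      fix j l assume jl: "j < n" "l < n"
      have wm: "(\<lambda>w. w r (j, l)) \<in> borel_measurable (PiM {1..i} (\<lambda>_. PiM ?P (\<lambda>_. borel)))" if "r \<in> {1..i}" for r
        using measurable_compose[OF measurable_component_singleton[of r "{1..i}" "\<lambda>_. PiM ?P (\<lambda>_. borel)"]
            measurable_component_singleton[of "(j, l)" ?P "\<lambda>_. borel"]] that jl by blast
      then show "(\<lambda>x. B' x j l) \<in> borel_measurable (PiM {1..i} (\<lambda>_. PiM ?P (\<lambda>_. borel)))"
        using jl by (auto simp: B'_def simp del: One_nat_def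
            intro!: borel_measurable_diff borel_measurable_times borel_measurable_sum wm)
    qed (use jl in auto)
    have hm: "(\<lambda>w. w (Suc i) (l, j)) \<in> borel_measurable (PiM {Suc i} (\<lambda>_. PiM ?P (\<lambda>_. borel)))"
      using measurable_compose[OF measurable_component_singleton[of "Suc i" "{Suc i}" "\<lambda>_. PiM ?P (\<lambda>_. borel)"]
            measurable_component_singleton[of "(l, j)" ?P "\<lambda>_. borel"]] jl by blast
    have iv2: "indep_var borel (\<lambda>\<omega>. g (restrict (\<lambda>r. ?E r \<omega>) {1..i})) borel (\<lambda>\<omega>. X (Suc i) \<omega> l j)"
      using indep_var_compose[OF iv gm hm] jl by (simp add: comp_def)
    have gB: "g (restrict (\<lambda>r. ?E r \<omega>) {1..i}) = mpow n (Bm \<eta> i \<omega>) k j l" if \<omega>: "\<omega> \<in> space M" for \<omega>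
    proof -
      have "B' (restrict (\<lambda>r. ?E r \<omega>) {1..i}) = Bm \<eta> i \<omega>"
      proof (intro ext)
        fix a b
        show "B' (restrict (\<lambda>r. ?E r \<omega>) {1..i}) a b = Bm \<eta> i \<omega> a b"
          using symm_supp[OF psd_symm[OF S_psd(1)[of i \<omega>]], of a b] i \<omega>
          by (auto simp: B'_def Bm_def S_def mone_def)
      qed
      then show ?thesis by (simp add: g_def)
    qed
    have gint: "integrable M (\<lambda>\<omega>. g (restrict (\<lambda>r. ?E r \<omega>) {1..i}))"
      using pow_int[of i j l \<eta> k] i jl gB by (subst Bochner_Integration.integrable_cong[OF refl gB]) auto
    have Xint: "integrable M (\<lambda>\<omega>. X (Suc i) \<omega> l j)"
      using X_bd[of "Suc i" l j] i jl by (intro integrable_const_bound[where B = R]) auto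
    have "integrable M (\<lambda>\<omega>. g (restrict (\<lambda>r. ?E r \<omega>) {1..i}) * X (Suc i) \<omega> l j)"
      by (rule indep_var_integrable[OF iv2 gint Xint])
    then show "integrable M (\<lambda>\<omega>. mpow n (Bm \<eta> i \<omega>) k j l * X (Suc i) \<omega> l j)"
      by (subst (asm) Bochner_Integration.integrable_cong[OF refl, where g = "\<lambda>\<omega>. mpow n (Bm \<eta> i \<omega>) k j l * X (Suc i) \<omega> l j"])
         (simp_all add: gB del: One_nat_def)
    have "expectation (\<lambda>\<omega>. g (restrict (\<lambda>r. ?E r \<omega>) {1..i}) * X (Suc i) \<omega> l j)
        = expectation (\<lambda>\<omega>. g (restrict (\<lambda>r. ?E r \<omega>) {1..i})) * expectation (\<lambda>\<omega>. X (Suc i) \<omega> l j)"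
      by (rule indep_var_lebesgue_integral[OF iv2 gint Xint])
    also have "expectation (\<lambda>\<omega>. g (restrict (\<lambda>r. ?E r \<omega>) {1..i}) * X (Suc i) \<omega> l j)
        = expectation (\<lambda>\<omega>. mpow n (Bm \<eta> i \<omega>) k j l * X (Suc i) \<omega> l j)"
      by (intro Bochner_Integration.integral_cong refl) (simp add: gB del: One_nat_def)
    also have "expectation (\<lambda>\<omega>. g (restrict (\<lambda>r. ?E r \<omega>) {1..i})) = expectation (\<lambda>\<omega>. mpow n (Bm \<eta> i \<omega>) k j l)"
      by (intro Bochner_Integration.integral_cong refl) (simp add: gB del: One_nat_def)
    finally show "expectation (\<lambda>\<omega>. mpow n (Bm \<eta> i \<omega>) k j l * X (Suc i) \<omega> l j)
        = expectation (\<lambda>\<omega>. mpow n (Bm \<eta> i \<omega>) k j l) * (if l = j then 1 / N else 0)"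
      using mean[of "Suc i" l j] i jl by simp
  qed
  have tr_mean: "integrable M (\<lambda>\<omega>. mtrace n (mmul n (mpow n (Bm \<eta> i \<omega>) k) (X (Suc i) \<omega>)))"
      "expectation (\<lambda>\<omega>. mtrace n (mmul n (mpow n (Bm \<eta> i \<omega>) k) (X (Suc i) \<omega>)))
        = expectation (\<lambda>\<omega>. mtrace n (mpow n (Bm \<eta> i \<omega>) k)) / N"
    if i: "Suc i \<le> N" for \<eta> i k
  proof -
    show "integrable M (\<lambda>\<omega>. mtrace n (mmul n (mpow n (Bm \<eta> i \<omega>) k) (X (Suc i) \<omega>)))"
      unfolding mtrace_def mmul_def using i by (intro Bochner_Integration.integrable_sum prod_mean) auto
    have "expectation (\<lambda>\<omega>. mtrace n (mmul n (mpow n (Bm \<eta> i \<omega>) k) (X (Suc i) \<omega>)))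
        = (\<Sum>j<n. \<Sum>l<n. expectation (\<lambda>\<omega>. mpow n (Bm \<eta> i \<omega>) k j l * X (Suc i) \<omega> l j))"
      unfolding mtrace_def mmul_def using i
      by (subst Bochner_Integration.integral_sum, intro Bochner_Integration.integrable_sum prod_mean, simp_all add: prod_mean)
    also have "\<dots> = (\<Sum>j<n. expectation (\<lambda>\<omega>. mpow n (Bm \<eta> i \<omega>) k j j) / N)"
      using i by (intro sum.cong refl) (simp add: prod_mean if_distrib[of "\<lambda>x. _ * x"] cong: if_cong)
    also have "\<dots> = expectation (\<lambda>\<omega>. mtrace n (mpow n (Bm \<eta> i \<omega>) k)) / N"
      unfolding mtrace_def using i
      by (subst Bochner_Integration.integral_sum) (auto intro!: pow_int simp: sum_divide_distrib)
    finally show "expectation (\<lambda>\<omega>. mtrace n (mmul n (mpow n (Bm \<eta> i \<omega>) k) (X (Suc i) \<omega>)))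
        = expectation (\<lambda>\<omega>. mtrace n (mpow n (Bm \<eta> i \<omega>) k)) / N" .
  qed
  \<comment> \<open>\<open>\<eta> k\<close> makes \<open>(1 - \<eta> S)^k\<close> close to \<open>exp (- \<theta> S)\<close> with \<open>\<theta> = ln 2 / R\<close>, the optimal exponent for the level
    \<open>1/2\<close>; \<open>lam k\<close> bounds all partial matrices \<open>Bm\<close> from below, as \<open>S \<le> N R\<close>.\<close>
  define lam where "lam k = 1 - N * ln 2 / real k" for k :: nat
  define \<eta> where "\<eta> k = ln 2 / (R * real k)" for k :: nat
  define \<delta> where "\<delta> k = lam k * (1 - exp (- (ln 2 / lam k))) / R" for k
  have ln2: "0 < ln (2::real)" "ln (2::real) < 1"
    using ln_less_self[of "2::real"] exp_gt_one[of 1] ln_2_less_1 by auto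
  have decay: "expectation (\<lambda>\<omega>. mtrace n (mpow n (Bm (\<eta> k) i \<omega>) k)) \<le> n * exp (- \<delta> k * (i / N))"
    if k: "N < k" and "i \<le> N" for i k
    using \<open>i \<le> N\<close>
  proof (induction i)
    case 0
    have "Bm \<eta>' 0 \<omega> = mone n" for \<eta>' \<omega> by (simp add: Bm_def S_def)
    moreover have "mpow n (mone n) k = mone n"
      by (induction k) (simp_all add: mmul_mone_left symm_supp[OF symm_mone])
    moreover have "mtrace n (mone n) = n" by (simp add: mtrace_def mone_def)
    ultimately show ?case by (simp add: prob_space)
  next
    case (Suc i)
    let ?B = "\<lambda>\<omega>. Bm (\<eta> k) i \<omega>"
    have k0: "0 < real k" "N < real k" using k by auto
    have lam: "0 < lam k"
    proof -
      have "real N * ln 2 \<le> real N * 1" using ln2 by (intro mult_left_mono) auto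
      then show ?thesis using k0 by (simp add: lam_def field_simps)
    qed
    have eta: "0 \<le> \<eta> k" using ln2 R k0 by (simp add: \<eta>_def)
    have low: "lam k * dot n v v \<le> dot n v (act n (Bm (\<eta> k) r \<omega>) v)" if "r \<le> N" "\<omega> \<in> space M" for r \<omega> v
    proof -
      have "\<eta> k * dot n v (act n (S r \<omega>) v) \<le> \<eta> k * ((N * R) * dot n v v)"
      proof (rule mult_left_mono[OF order_trans[OF S_psd(2)[OF that]] eta])
        show "r * R * dot n v v \<le> N * R * dot n v v"
          using that R by (intro mult_right_mono dot_self_nonneg) auto
      qed
      also have "\<dots> = (1 - lam k) * dot n v v" using R k0 by (simp add: \<eta>_def lam_def)
      finally show ?thesis unfolding Bm_def act_lin dot_lin_right dot_mone by (simp add: algebra_simps)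
    qed
    have psdB: "psd n (Bm (\<eta> k) r \<omega>)" if "r \<le> N" "\<omega> \<in> space M" for r \<omega>
    proof -
      have "0 \<le> lam k * dot n v v" for v using lam dot_self_nonneg[of n v] by simp
      then have "0 \<le> dot n v (act n (Bm (\<eta> k) r \<omega>) v)" for v using low[OF that] order_trans by blast
      moreover have "symm n (Bm (\<eta> k) r \<omega>)"
        unfolding Bm_def by (intro symm_lin symm_mone psd_symm[OF S_psd(1)] that)
      ultimately show ?thesis by (simp add: psd_def)
    qed
    have step: "mtrace n (mpow n (Bm (\<eta> k) (Suc i) \<omega>) k)
        \<le> mtrace n (mpow n (?B \<omega>) k) - \<delta> k * mtrace n (mmul n (mpow n (?B \<omega>) (k - 1)) (X (Suc i) \<omega>))"
      if \<omega>: "\<omega> \<in> space M" for \<omega>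
    proof -
      have "mtrace n (mpow n (\<lambda>j l. 1 * ?B \<omega> j l + (- \<eta> k) * X (Suc i) \<omega> j l) k)
        \<le> mtrace n (mpow n (?B \<omega>) k) - (real k * (1 - exp (- (real k * R / lam k) * \<eta> k)) / (real k * R / lam k))
             * mtrace n (mmul n (mpow n (?B \<omega>) (k - 1)) (X (Suc i) \<omega>))"
        using Suc.prems \<omega> k0 lam eta R low[of "Suc i" \<omega>]
        by (intro mtrace_power_step psd_symm[OF psdB] psdX) (auto simp: Bm_Suc)
      moreover have "real k * (1 - exp (- (real k * R / lam k) * \<eta> k)) / (real k * R / lam k) = \<delta> k"
        using k0 R lam by (simp add: \<delta>_def \<eta>_def field_simps)
      ultimately show ?thesis by (simp add: Bm_Suc)
    qed
    have d0: "0 \<le> \<delta> k" using lam ln2 R by (simp add: \<delta>_def)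
    have "expectation (\<lambda>\<omega>. mtrace n (mpow n (Bm (\<eta> k) (Suc i) \<omega>) k))
       \<le> expectation (\<lambda>\<omega>. mtrace n (mpow n (?B \<omega>) k) - \<delta> k * mtrace n (mmul n (mpow n (?B \<omega>) (k - 1)) (X (Suc i) \<omega>)))"
      using Suc.prems
      by (intro integral_mono step Bochner_Integration.integrable_diff integrable_mult_right tr_int tr_mean) auto
    also have "\<dots> = expectation (\<lambda>\<omega>. mtrace n (mpow n (?B \<omega>) k))
        - \<delta> k * (expectation (\<lambda>\<omega>. mtrace n (mpow n (?B \<omega>) (k - 1))) / N)"
      using Suc.prems
      by (subst Bochner_Integration.integral_diff) (auto intro!: tr_int integrable_mult_right tr_mean simp: tr_mean)
    also have "\<dots> \<le> expectation (\<lambda>\<omega>. mtrace n (mpow n (?B \<omega>) k))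
        - \<delta> k * (expectation (\<lambda>\<omega>. mtrace n (mpow n (?B \<omega>) k)) / N)"
    proof -
      have "mtrace n (mpow n (?B \<omega>) k) \<le> mtrace n (mpow n (?B \<omega>) (k - 1))" if \<omega>: "\<omega> \<in> space M" for \<omega>
      proof -
        have P: "psd n (?B \<omega>)" using psdB Suc.prems \<omega> by auto
        have up: "dot n v (act n (?B \<omega>) v) \<le> 1 * dot n v v" for v
          using eta psd_nonneg[OF S_psd(1)[of i \<omega>], of v] Suc.prems \<omega>
          unfolding Bm_def act_lin dot_lin_right dot_mone by simp
        have "0 \<le> mtrace n (mmul n (mone n) (\<lambda>a b. 1 * mpow n (?B \<omega>) (k - 1) a b + (-1) * mpow n (?B \<omega>) k a b))"
        proof (rule mtrace_mmul_nonneg[OF psd_mone])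
          fix v
          have "Suc (k - 1) = k" using k by simp
          then show "0 \<le> dot n v (act n (\<lambda>a b. 1 * mpow n (?B \<omega>) (k - 1) a b + (-1) * mpow n (?B \<omega>) k a b) v)"
            using mpow_quad_upper[OF P up, of v "k - 1"] unfolding act_lin dot_lin_right by simp
        qed
        then show ?thesis unfolding mmul_lin_right mtrace_lin
          by (simp add: mmul_mone_left symm_supp[OF symm_mpow[OF psd_symm[OF P]]])
      qed
      then have "expectation (\<lambda>\<omega>. mtrace n (mpow n (?B \<omega>) k)) \<le> expectation (\<lambda>\<omega>. mtrace n (mpow n (?B \<omega>) (k - 1)))"
        using Suc.prems by (intro integral_mono tr_int) auto
      then have "\<delta> k * (expectation (\<lambda>\<omega>. mtrace n (mpow n (?B \<omega>) k)) / N)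
          \<le> \<delta> k * (expectation (\<lambda>\<omega>. mtrace n (mpow n (?B \<omega>) (k - 1))) / N)"
        using d0 N by (intro mult_left_mono divide_right_mono) auto
      then show ?thesis by simp
    qed
    also have "\<dots> = (1 - \<delta> k / N) * expectation (\<lambda>\<omega>. mtrace n (mpow n (?B \<omega>) k))"
      by (simp add: algebra_simps)
    also have "\<dots> \<le> exp (- \<delta> k / N) * expectation (\<lambda>\<omega>. mtrace n (mpow n (?B \<omega>) k))"
    proof (rule mult_right_mono)
      show "1 - \<delta> k / N \<le> exp (- \<delta> k / N)" using exp_ge_add_one_self[of "- \<delta> k / N"] by simp
      have "0 \<le> mtrace n (mpow n (?B \<omega>) k)" if "\<omega> \<in> space M" for \<omega>
        using Suc.prems that by (intro mtrace_nonneg psd_mpow psdB) auto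
      then show "0 \<le> expectation (\<lambda>\<omega>. mtrace n (mpow n (?B \<omega>) k))" by (rule integral_nonneg_AE[OF AE_I2])
    qed
    also have "\<dots> \<le> exp (- \<delta> k / N) * (n * exp (- \<delta> k * (i / N)))"
      using Suc by (intro mult_left_mono) auto
    also have "\<dots> = n * exp (- \<delta> k * (Suc i / N))"
      by (simp add: exp_add[symmetric] add_divide_distrib algebra_simps)
    finally show ?case .
  qed
  define k0 where "k0 = max N (nat \<lceil>ln 2 / (2 * R)\<rceil>)"
  define Ev where "Ev k = {\<omega>\<in>space M. (1 - \<eta> k / 2) ^ k \<le> mtrace n (mpow n (Bm (\<eta> k) N \<omega>) k)}" for k
  have big: "N < k" "0 < 1 - \<eta> k / 2" "0 < real k" if "k0 < k" for k
  proof -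
    show "N < k" "0 < real k" using that by (auto simp: k0_def)
    have "ln 2 / (2 * R) < real k" using that unfolding k0_def by linarith
    then show "0 < 1 - \<eta> k / 2" using R \<open>0 < real k\<close> by (simp add: \<eta>_def field_simps)
  qed
  have trm[measurable]: "(\<lambda>\<omega>. mtrace n (mpow n (Bm (\<eta> k) N \<omega>) k)) \<in> borel_measurable M" for k
    using tr_int by blast
  have EvM: "Ev k \<in> events" for k unfolding Ev_def by measurable
  have psdBN: "psd n (Bm (\<eta> k) N \<omega>)" if k: "k0 < k" and \<omega>: "\<omega> \<in> space M" for k \<omega>
  proof -
    have "0 \<le> dot n v (act n (Bm (\<eta> k) N \<omega>) v)" for v
    proof -
      have "\<eta> k * dot n v (act n (S N \<omega>) v) \<le> \<eta> k * ((N * R) * dot n v v)"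
        using R big[OF k] ln2 by (intro mult_left_mono S_psd \<omega>) (auto simp: \<eta>_def)
      also have "\<dots> = (N * ln 2 / k) * dot n v v" using R by (simp add: \<eta>_def)
      also have "\<dots> \<le> 1 * dot n v v"
      proof (intro mult_right_mono dot_self_nonneg)
        have "real N * ln 2 \<le> real N * 1" using ln2 by (intro mult_left_mono) auto
        then show "N * ln 2 / k \<le> 1" using big[OF k] by (simp add: field_simps)
      qed
      finally show ?thesis unfolding Bm_def act_lin dot_lin_right dot_mone by simp
    qed
    moreover have "symm n (Bm (\<eta> k) N \<omega>)"
      unfolding Bm_def using \<omega> by (intro symm_lin symm_mone psd_symm[OF S_psd(1)]) auto
    ultimately show ?thesis by (simp add: psd_def)
  qed
  have Ev_prob: "prob (Ev k) \<le> n * (exp (- (\<delta> k)) / (1 + (- (ln 2 / (2 * R))) / k) ^ k)" if k: "k0 < k" for k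
  proof -
    have nn: "0 \<le> mtrace n (mpow n (Bm (\<eta> k) N \<omega>) k)" if "\<omega> \<in> space M" for \<omega>
      by (intro mtrace_nonneg psd_mpow psdBN[OF k that])
    have "prob (Ev k) \<le> expectation (\<lambda>\<omega>. mtrace n (mpow n (Bm (\<eta> k) N \<omega>) k)) / (1 - \<eta> k / 2) ^ k"
      unfolding Ev_def using nn big[OF k]
      by (intro integral_Markov_inequality_measure[where A = "{}"] tr_int) auto
    also have "\<dots> \<le> (n * exp (- \<delta> k)) / (1 - \<eta> k / 2) ^ k"
      using decay[of k N] big[OF k] N by (intro divide_right_mono) auto
    also have "1 - \<eta> k / 2 = 1 + (- (ln 2 / (2 * R))) / k" using R by (simp add: \<eta>_def)
    finally show ?thesis by simp
  qed
  \<comment> \<open>The intersection has probability at most the limit of the individual bounds, whereas leaving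
    a single \<open>Ev k\<close> already implies the lower bound on the quadratic form.\<close>
  define Bad where "Bad = (\<Inter>k\<in>{k0<..}. Ev k)"
  have "Bad \<in> events" unfolding Bad_def using EvM by (intro sets.countable_INT') auto
  moreover have "prob Bad \<le> n * exp (- ((1 - ln 2) / (2 * R)))"
  proof (rule LIMSEQ_le_const)
    show "(\<lambda>k. n * (exp (- (\<delta> k)) / (1 + (- (ln 2 / (2 * R))) / k) ^ k)) \<longlonglongrightarrow> n * exp (- ((1 - ln 2) / (2 * R)))"
      unfolding \<delta>_def lam_def by (intro tendsto_mult tendsto_const matrix_Chernoff_limit R)
    show "\<exists>K. \<forall>k\<ge>K. prob Bad \<le> n * (exp (- (\<delta> k)) / (1 + (- (ln 2 / (2 * R))) / k) ^ k)"
    proof (intro exI allI impI)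
      fix k assume k: "Suc k0 \<le> k"
      have "prob Bad \<le> prob (Ev k)" using k EvM unfolding Bad_def by (intro finite_measure_mono) auto
      also note Ev_prob[of k]
      finally show "prob Bad \<le> n * (exp (- (\<delta> k)) / (1 + (- (ln 2 / (2 * R))) / k) ^ k)" using k by simp
    qed
  qed
  moreover have "dot n v v / 2 \<le> dot n v (act n (S N \<omega>) v)" if nb: "\<omega> \<in> space M - Bad" for \<omega> v
  proof -
    obtain k where k: "k0 < k" and w: "\<omega> \<in> space M" "\<omega> \<notin> Ev k" using nb by (auto simp: Bad_def)
    let ?B = "Bm (\<eta> k) N \<omega>" let ?q = "dot n v (act n ?B v)" let ?d = "dot n v v"
    have P: "psd n ?B" by (rule psdBN[OF k w(1)])
    show ?thesis
    proof (cases "?d = 0")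
      case True
      then show ?thesis using psd_nonneg[OF S_psd(1)[of N \<omega>], of v] w by simp
    next
      case False
      then have d: "0 < ?d" using dot_self_nonneg[of n v] by simp
      have "?q ^ k * ?d \<le> ?d ^ k * dot n v (act n (mpow n ?B k) v)" by (rule quad_power_le[OF P])
      also have "\<dots> \<le> ?d ^ k * (?d * mtrace n (mpow n ?B k))"
        using d by (intro mult_left_mono quad_le_mtrace psd_mpow P) auto
      also have "\<dots> < ?d ^ k * (?d * (1 - \<eta> k / 2) ^ k)"
        using d w by (intro mult_strict_left_mono) (auto simp: Ev_def)
      finally have "?q ^ k < (?d * (1 - \<eta> k / 2)) ^ k" using d by (simp add: power_mult_distrib mult_ac)
      moreover have "0 \<le> ?d * (1 - \<eta> k / 2)"
        using d big(2)[OF k] by (intro mult_nonneg_nonneg) auto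
      ultimately have "?q < ?d * (1 - \<eta> k / 2)" by (rule power_less_imp_less_base)
      moreover have "?q = ?d - \<eta> k * dot n v (act n (S N \<omega>) v)"
        unfolding Bm_def act_lin dot_lin_right dot_mone by simp
      moreover have "?d * (1 - \<eta> k / 2) = ?d - \<eta> k * (?d / 2)" by (simp add: right_diff_distrib)
      ultimately have "\<eta> k * (?d / 2) < \<eta> k * dot n v (act n (S N \<omega>) v)" by linarith
      moreover have "0 < \<eta> k" using ln2 R(2) big(3)[OF k] by (simp add: \<eta>_def)
      ultimately show ?thesis using mult_less_cancel_left_pos by fastforce
    qed
  qed
  ultimately show ?thesis unfolding S_def by (intro bexI[of _ Bad]) auto
qed

section \<open>Averages of independent random measures\<close>

definition bounded_borel :: "('z::topological_space \<Rightarrow> real) \<Rightarrow> bool" where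
  "bounded_borel G \<longleftrightarrow> G \<in> borel_measurable borel \<and> (\<exists>B. \<forall>z. \<bar>G z\<bar> \<le> B)"

lemma bounded_borelI: "G \<in> borel_measurable borel \<Longrightarrow> (\<And>z. \<bar>G z\<bar> \<le> B) \<Longrightarrow> bounded_borel G"
  by (auto simp: bounded_borel_def)

lemma bounded_borel_measurable: "bounded_borel G \<Longrightarrow> G \<in> borel_measurable borel"
  by (simp add: bounded_borel_def)

lemma bounded_borel_bound: "bounded_borel G \<Longrightarrow> \<exists>B>0. \<forall>z. \<bar>G z\<bar> \<le> B"
proof -
  assume "bounded_borel G"
  then obtain B where "\<And>z. \<bar>G z\<bar> \<le> B" by (auto simp: bounded_borel_def)
  then have "\<forall>z. \<bar>G z\<bar> \<le> max B 1" by (auto simp: le_max_iff_disj)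
  then show ?thesis by (intro exI[of _ "max B 1"]) auto
qed

lemma bounded_borel_const: "bounded_borel (\<lambda>_. c)"
  by (auto simp: bounded_borel_def)

lemma bounded_borel_add: "bounded_borel G \<Longrightarrow> bounded_borel H \<Longrightarrow> bounded_borel (\<lambda>z. G z + H z)"
proof -
  assume G: "bounded_borel G" and H: "bounded_borel H"
  obtain A where A: "A > 0" "\<And>z. \<bar>G z\<bar> \<le> A" using bounded_borel_bound[OF G] by blast
  obtain B where B: "B > 0" "\<And>z. \<bar>H z\<bar> \<le> B" using bounded_borel_bound[OF H] by blast
  show ?thesis
  proof (rule bounded_borelI)
    show "(\<lambda>z. G z + H z) \<in> borel_measurable borel"
      using G H by (intro borel_measurable_add) (auto simp: bounded_borel_def)
    show "\<bar>G z + H z\<bar> \<le> A + B" for z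
      using A(2)[of z] B(2)[of z] by linarith
  qed
qed

lemma bounded_borel_mult: "bounded_borel G \<Longrightarrow> bounded_borel H \<Longrightarrow> bounded_borel (\<lambda>z. G z * H z)"
proof -
  assume G: "bounded_borel G" and H: "bounded_borel H"
  obtain A where A: "A > 0" "\<And>z. \<bar>G z\<bar> \<le> A" using bounded_borel_bound[OF G] by blast
  obtain B where B: "B > 0" "\<And>z. \<bar>H z\<bar> \<le> B" using bounded_borel_bound[OF H] by blast
  show ?thesis
  proof (rule bounded_borelI)
    show "(\<lambda>z. G z * H z) \<in> borel_measurable borel"
      using G H by (intro borel_measurable_times) (auto simp: bounded_borel_def)
    show "\<bar>G z * H z\<bar> \<le> A * B" for z
      unfolding abs_mult using A B by (intro mult_mono) (auto intro: less_imp_le)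
  qed
qed

lemma bounded_borel_cmult: "bounded_borel G \<Longrightarrow> bounded_borel (\<lambda>z. c * G z)"
  by (intro bounded_borel_mult bounded_borel_const)

lemma bounded_borel_diff: "bounded_borel G \<Longrightarrow> bounded_borel H \<Longrightarrow> bounded_borel (\<lambda>z. G z - H z)"
  using bounded_borel_add[of G "\<lambda>z. (-1) * H z"] bounded_borel_cmult[of H "-1"] by simp

lemma bounded_borel_power2: "bounded_borel G \<Longrightarrow> bounded_borel (\<lambda>z. (G z)\<^sup>2)"
  using bounded_borel_mult[of G G] by (simp add: power2_eq_square)

lemma bounded_borel_sum: "(\<And>i. i \<in> I \<Longrightarrow> bounded_borel (G i)) \<Longrightarrow> bounded_borel (\<lambda>z. \<Sum>i\<in>I. G i z)"
  by (induction I rule: infinite_finite_induct) (simp_all add: bounded_borel_const bounded_borel_add)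

lemma bounded_borel_comp:
  "bounded_borel G \<Longrightarrow> f \<in> borel_measurable borel \<Longrightarrow> bounded_borel (\<lambda>z. G (f z))"
  unfolding bounded_borel_def using measurable_compose[of f borel borel G borel] by blast

lemmas bounded_borel_intros = bounded_borel_const bounded_borel_add bounded_borel_diff
  bounded_borel_mult bounded_borel_power2 bounded_borel_sum

lemma bounded_borel_integrable:
  assumes "prob_space P" "bounded_borel G" "sets P = sets borel"
  shows "integrable P G"
proof -
  interpret prob_space P by fact
  obtain B where "\<And>z. \<bar>G z\<bar> \<le> B" using assms(2) by (auto simp: bounded_borel_def)
  then show ?thesis
    using assms(2,3) by (intro integrable_const_bound[where B = B])
      (auto simp: bounded_borel_def cong: measurable_cong_sets)
qed

text \<open>Transfers statements about nonnegative integrals to bounded functions of either sign.\<close>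

lemma integral_shift:
  fixes G :: "'z::topological_space \<Rightarrow> real"
  assumes "prob_space P" "sets P = sets borel" "bounded_borel G" "\<And>z. \<bar>G z\<bar> \<le> B"
  shows "(\<integral>z. G z \<partial>P) = enn2real (\<integral>\<^sup>+z. ennreal (G z + B) \<partial>P) - B"
    and "(\<integral>\<^sup>+z. ennreal (G z + B) \<partial>P) = ennreal ((\<integral>z. G z \<partial>P) + B)"
proof -
  interpret P: prob_space P by fact
  have int: "integrable P G" by (intro bounded_borel_integrable assms)
  have nn: "0 \<le> G z + B" for z using assms(4)[of z] by (simp add: abs_le_iff) 
  have "(\<integral>\<^sup>+z. ennreal (G z + B) \<partial>P) = ennreal (\<integral>z. G z + B \<partial>P)"
    using int nn by (intro nn_integral_eq_integral) auto
  also have "(\<integral>z. G z + B \<partial>P) = (\<integral>z. G z \<partial>P) + B" using int by (simp add: P.prob_space)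
  finally show *: "(\<integral>\<^sup>+z. ennreal (G z + B) \<partial>P) = ennreal ((\<integral>z. G z \<partial>P) + B)" .
  have "0 \<le> (\<integral>z. G z + B \<partial>P)" using nn by (intro integral_nonneg_AE) auto
  then have "0 \<le> (\<integral>z. G z \<partial>P) + B" using int by (simp add: P.prob_space)
  then show "(\<integral>z. G z \<partial>P) = enn2real (\<integral>\<^sup>+z. ennreal (G z + B) \<partial>P) - B" unfolding * by simp
qed

lemma (in prob_space) integral_power2_le:
  fixes f :: "'a \<Rightarrow> real"
  assumes "integrable M f" "integrable M (\<lambda>x. (f x)\<^sup>2)"
  shows "(\<integral>x. f x \<partial>M)\<^sup>2 \<le> (\<integral>x. (f x)\<^sup>2 \<partial>M)"
  using variance_eq[OF assms] variance_positive[of f] by linarith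

lemma (in prob_space) second_moment_sum_indep:
  fixes Y :: "'i \<Rightarrow> 'a \<Rightarrow> real"
  assumes "finite I" "indep_vars (\<lambda>_. borel) Y I"
    and "\<And>i. i \<in> I \<Longrightarrow> integrable M (Y i)" "\<And>i. i \<in> I \<Longrightarrow> integrable M (\<lambda>\<omega>. (Y i \<omega>)\<^sup>2)"
    and "\<And>i. i \<in> I \<Longrightarrow> expectation (Y i) = 0"
  shows "integrable M (\<lambda>\<omega>. (\<Sum>i\<in>I. Y i \<omega>)\<^sup>2) \<and>
    expectation (\<lambda>\<omega>. (\<Sum>i\<in>I. Y i \<omega>)\<^sup>2) = (\<Sum>i\<in>I. expectation (\<lambda>\<omega>. (Y i \<omega>)\<^sup>2))"
  using assms
proof (induction I rule: finite_induct)
  case (insert i I)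
  have IH: "integrable M (\<lambda>\<omega>. (\<Sum>i\<in>I. Y i \<omega>)\<^sup>2)"
    "expectation (\<lambda>\<omega>. (\<Sum>i\<in>I. Y i \<omega>)\<^sup>2) = (\<Sum>i\<in>I. expectation (\<lambda>\<omega>. (Y i \<omega>)\<^sup>2))"
    using insert.IH insert.prems indep_vars_subset[OF insert.prems(1), of I] by auto
  have iv: "indep_var borel (Y i) borel (\<lambda>\<omega>. \<Sum>i\<in>I. Y i \<omega>)"
    using insert by (intro indep_vars_sum) auto
  have S: "integrable M (\<lambda>\<omega>. \<Sum>i\<in>I. Y i \<omega>)" using insert by (intro Bochner_Integration.integrable_sum) auto
  have Yi: "integrable M (Y i)" "integrable M (\<lambda>\<omega>. (Y i \<omega>)\<^sup>2)" "expectation (Y i) = 0" using insert by auto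
  have cross: "integrable M (\<lambda>\<omega>. Y i \<omega> * (\<Sum>i\<in>I. Y i \<omega>))" "expectation (\<lambda>\<omega>. Y i \<omega> * (\<Sum>i\<in>I. Y i \<omega>)) = 0"
    using indep_var_integrable[OF iv Yi(1) S] indep_var_lebesgue_integral[OF iv Yi(1) S] Yi by auto
  have eq: "(\<Sum>i\<in>insert i I. Y i \<omega>)\<^sup>2 = (Y i \<omega>)\<^sup>2 + 2 * (Y i \<omega> * (\<Sum>i\<in>I. Y i \<omega>)) + (\<Sum>i\<in>I. Y i \<omega>)\<^sup>2" for \<omega>
    using insert by (simp add: power2_sum)
  show ?case unfolding eq using Yi cross IH insert by simp
qed simp

text \<open>Each copy of the process is replaced by the random measure \<open>\<mu> i\<close>, the law of a pair of its values at a random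
time. Independence is expressed through \<open>\<sigma>\<close>-algebras \<open>F i\<close> that make the integrals against \<open>\<mu> i\<close> measurable: time
integrals are not measurable functions on the full product space of paths, although they are measurable with
respect to the \<open>\<sigma>\<close>-algebra that a continuous process generates.\<close>

locale indep_random_measures = prob_space M for M :: "'a measure" +
  fixes N :: nat and F :: "nat \<Rightarrow> 'a measure"
    and \<mu> :: "nat \<Rightarrow> 'a \<Rightarrow> (real \<times> real) measure" and \<pi> :: "(real \<times> real) measure"
  assumes N: "0 < N"
    and \<mu>_prob: "\<And>i \<omega>. i \<in> {1..N} \<Longrightarrow> \<omega> \<in> space M \<Longrightarrow> prob_space (\<mu> i \<omega>)"
    and \<mu>_sets: "\<And>i \<omega>. i \<in> {1..N} \<Longrightarrow> \<omega> \<in> space M \<Longrightarrow> sets (\<mu> i \<omega>) = sets borel"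
    and \<pi>_prob: "prob_space \<pi>" and \<pi>_sets: "sets \<pi> = sets borel"
    and F_space: "\<And>i. i \<in> {1..N} \<Longrightarrow> space (F i) = space M"
    and F_indep: "indep_sets (\<lambda>i. sets (F i)) {1..N}"
    and nn_measurable: "\<And>i G. i \<in> {1..N} \<Longrightarrow> G \<in> borel_measurable borel \<Longrightarrow>
        (\<lambda>\<omega>. \<integral>\<^sup>+z. G z \<partial>\<mu> i \<omega>) \<in> borel_measurable (F i)"
    and nn_mean: "\<And>i G. i \<in> {1..N} \<Longrightarrow> G \<in> borel_measurable borel \<Longrightarrow>
        (\<integral>\<^sup>+\<omega>. \<integral>\<^sup>+z. G z \<partial>\<mu> i \<omega> \<partial>M) = (\<integral>\<^sup>+z. G z \<partial>\<pi>)"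
begin

definition Av :: "(real \<times> real \<Rightarrow> real) \<Rightarrow> 'a \<Rightarrow> real" where
  "Av G \<omega> = (1 / N) * (\<Sum>i\<in>{1..N}. \<integral>z. G z \<partial>\<mu> i \<omega>)"

lemma F_subset: "i \<in> {1..N} \<Longrightarrow> sets (F i) \<subseteq> events"
  using F_indep by (auto simp: indep_sets_def)

lemma F_measurable: "i \<in> {1..N} \<Longrightarrow> f \<in> measurable (F i) M' \<Longrightarrow> f \<in> measurable M M'"
  using F_subset[of i] F_space[of i] by (rule_tac measurable_from_subalg[of M "F i"]) (simp_all add: subalgebra_def)

lemma indep_vars_F:
  assumes "\<And>i. i \<in> {1..N} \<Longrightarrow> Y i \<in> measurable (F i) (M' i)"
  shows "indep_vars M' Y {1..N}"
  unfolding indep_vars_def2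
proof
  show "\<forall>i\<in>{1..N}. random_variable (M' i) (Y i)"
    using assms F_measurable by blast
  show "indep_sets (\<lambda>i. {Y i -` A \<inter> space M |A. A \<in> sets (M' i)}) {1..N}"
  proof (rule indep_sets_mono_sets[OF F_indep])
    fix i assume i: "i \<in> {1..N}"
    show "{Y i -` A \<inter> space M |A. A \<in> sets (M' i)} \<subseteq> sets (F i)"
      using measurable_sets[OF assms[OF i]] F_space[OF i] by auto
  qed
qed

lemma integrable_\<mu>: "bounded_borel G \<Longrightarrow> i \<in> {1..N} \<Longrightarrow> \<omega> \<in> space M \<Longrightarrow> integrable (\<mu> i \<omega>) G"
  by (intro bounded_borel_integrable \<mu>_prob \<mu>_sets)

lemma integrable_\<pi>: "bounded_borel G \<Longrightarrow> integrable \<pi> G"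
  by (intro bounded_borel_integrable \<pi>_prob \<pi>_sets)

lemma integral_\<mu>_bound:
  assumes "bounded_borel G" "\<And>z. \<bar>G z\<bar> \<le> B" "i \<in> {1..N}" "\<omega> \<in> space M"
  shows "\<bar>\<integral>z. G z \<partial>\<mu> i \<omega>\<bar> \<le> B"
proof -
  interpret m: prob_space "\<mu> i \<omega>" using assms by (intro \<mu>_prob)
  have "\<bar>\<integral>z. G z \<partial>\<mu> i \<omega>\<bar> \<le> (\<integral>z. \<bar>G z\<bar> \<partial>\<mu> i \<omega>)" by (rule integral_abs_bound)
  also have "\<dots> \<le> (\<integral>z. B \<partial>\<mu> i \<omega>)"
    using assms integrable_\<mu>[OF assms(1,3,4)] by (intro integral_mono) auto
  finally show ?thesis by (simp add: m.prob_space)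
qed

lemma integral_\<mu>_measurable:
  assumes "bounded_borel G" "i \<in> {1..N}"
  shows "(\<lambda>\<omega>. \<integral>z. G z \<partial>\<mu> i \<omega>) \<in> borel_measurable (F i)"
proof -
  obtain B where B: "\<And>z. \<bar>G z\<bar> \<le> B" using assms by (auto simp: bounded_borel_def)
  have [measurable]: "G \<in> borel_measurable borel" using assms by (simp add: bounded_borel_def)
  have "(\<lambda>\<omega>. \<integral>\<^sup>+z. ennreal (G z + B) \<partial>\<mu> i \<omega>) \<in> borel_measurable (F i)"
    using assms by (intro nn_measurable) auto
  then have "(\<lambda>\<omega>. enn2real (\<integral>\<^sup>+z. ennreal (G z + B) \<partial>\<mu> i \<omega>) - B) \<in> borel_measurable (F i)"
    by measurable
  moreover have "(\<integral>z. G z \<partial>\<mu> i \<omega>) = enn2real (\<integral>\<^sup>+z. ennreal (G z + B) \<partial>\<mu> i \<omega>) - B"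
    if "\<omega> \<in> space (F i)" for \<omega>
    using that F_space[OF assms(2)] by (intro integral_shift(1) \<mu>_prob \<mu>_sets assms B) auto
  ultimately show ?thesis by (subst measurable_cong) 
qed

lemma integral_\<mu>_integrable:
  assumes "bounded_borel G" "i \<in> {1..N}"
  shows "integrable M (\<lambda>\<omega>. \<integral>z. G z \<partial>\<mu> i \<omega>)" "integrable M (\<lambda>\<omega>. (\<integral>z. G z \<partial>\<mu> i \<omega>)\<^sup>2)"
proof -
  have [measurable]: "(\<lambda>\<omega>. \<integral>z. G z \<partial>\<mu> i \<omega>) \<in> borel_measurable M"
    by (rule F_measurable[OF assms(2) integral_\<mu>_measurable[OF assms]])
  obtain B where B: "B > 0" "\<And>z. \<bar>G z\<bar> \<le> B" using bounded_borel_bound[OF assms(1)] by auto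
  have b: "\<bar>\<integral>z. G z \<partial>\<mu> i \<omega>\<bar> \<le> B" if "\<omega> \<in> space M" for \<omega>
    by (rule integral_\<mu>_bound[OF assms(1) B(2) assms(2) that])
  then show "integrable M (\<lambda>\<omega>. \<integral>z. G z \<partial>\<mu> i \<omega>)" by (intro integrable_const_bound[where B = B]) auto
  have "\<bar>(\<integral>z. G z \<partial>\<mu> i \<omega>)\<^sup>2\<bar> \<le> B\<^sup>2" if "\<omega> \<in> space M" for \<omega>
    using power_mono[OF b[OF that] abs_ge_zero, of 2] by simp
  then show "integrable M (\<lambda>\<omega>. (\<integral>z. G z \<partial>\<mu> i \<omega>)\<^sup>2)" by (intro integrable_const_bound[where B = "B\<^sup>2"]) auto
qed

lemma integral_\<mu>_mean:
  assumes "bounded_borel G" "i \<in> {1..N}"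
  shows "expectation (\<lambda>\<omega>. \<integral>z. G z \<partial>\<mu> i \<omega>) = (\<integral>z. G z \<partial>\<pi>)"
proof -
  obtain B where B: "\<And>z. \<bar>G z\<bar> \<le> B" using assms by (auto simp: bounded_borel_def)
  have [measurable]: "G \<in> borel_measurable borel" using assms by (simp add: bounded_borel_def)
  have I: "integrable M (\<lambda>\<omega>. \<integral>z. G z \<partial>\<mu> i \<omega>)" by (intro integral_\<mu>_integrable assms)
  have nnz: "0 \<le> G z + B" for z using B[of z] by linarith
  have nn: "0 \<le> (\<integral>z. G z \<partial>\<mu> i \<omega>) + B" if "\<omega> \<in> space M" for \<omega>
    using integral_\<mu>_bound[OF assms(1) B assms(2) that] by (simp add: abs_le_iff)
  have "ennreal (expectation (\<lambda>\<omega>. \<integral>z. G z \<partial>\<mu> i \<omega>) + B) = ennreal (expectation (\<lambda>\<omega>. (\<integral>z. G z \<partial>\<mu> i \<omega>) + B))"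
    using I by (simp add: prob_space)
  also have "\<dots> = (\<integral>\<^sup>+\<omega>. ennreal ((\<integral>z. G z \<partial>\<mu> i \<omega>) + B) \<partial>M)"
    using I nn by (intro nn_integral_eq_integral[symmetric]) auto
  also have "\<dots> = (\<integral>\<^sup>+\<omega>. (\<integral>\<^sup>+z. ennreal (G z + B) \<partial>\<mu> i \<omega>) \<partial>M)"
    using assms B \<mu>_prob \<mu>_sets by (intro nn_integral_cong integral_shift(2)[symmetric]) auto
  also have "\<dots> = (\<integral>\<^sup>+z. ennreal (G z + B) \<partial>\<pi>)" using assms by (intro nn_mean) auto
  also have "\<dots> = ennreal ((\<integral>z. G z \<partial>\<pi>) + B)"
    by (intro integral_shift(2) \<pi>_prob \<pi>_sets assms B)
  finally have e: "ennreal (expectation (\<lambda>\<omega>. \<integral>z. G z \<partial>\<mu> i \<omega>) + B) = ennreal ((\<integral>z. G z \<partial>\<pi>) + B)" .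
  have "0 \<le> expectation (\<lambda>\<omega>. (\<integral>z. G z \<partial>\<mu> i \<omega>) + B)" using nn by (intro integral_nonneg_AE) auto
  then have 1: "0 \<le> expectation (\<lambda>\<omega>. \<integral>z. G z \<partial>\<mu> i \<omega>) + B" using I by (simp add: prob_space)
  interpret p: prob_space \<pi> by (rule \<pi>_prob)
  have "0 \<le> (\<integral>z. G z + B \<partial>\<pi>)" using nnz by (intro integral_nonneg_AE) auto
  then have 2: "0 \<le> (\<integral>z. G z \<partial>\<pi>) + B" using integrable_\<pi>[OF assms(1)] by (simp add: p.prob_space)
  show ?thesis using e 1 2 by simp
qed

lemma Av_add: "bounded_borel G \<Longrightarrow> bounded_borel H \<Longrightarrow> \<omega> \<in> space M \<Longrightarrow> Av (\<lambda>z. G z + H z) \<omega> = Av G \<omega> + Av H \<omega>"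
  by (simp add: Av_def integrable_\<mu> sum.distrib distrib_left)

lemma Av_cmult: "Av (\<lambda>z. c * G z) \<omega> = c * Av G \<omega>"
  by (simp add: Av_def sum_distrib_left[symmetric])

lemma Av_diff: "bounded_borel G \<Longrightarrow> bounded_borel H \<Longrightarrow> \<omega> \<in> space M \<Longrightarrow> Av (\<lambda>z. G z - H z) \<omega> = Av G \<omega> - Av H \<omega>"
  by (simp add: Av_def integrable_\<mu> sum_subtractf right_diff_distrib)

lemma Av_const: "\<omega> \<in> space M \<Longrightarrow> Av (\<lambda>z. c) \<omega> = c"
proof -
  assume w: "\<omega> \<in> space M"
  have "(\<integral>z. c \<partial>\<mu> i \<omega>) = c" if "i \<in> {1..N}" for i
    using prob_space.prob_space[OF \<mu>_prob[OF that w]] by simp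
  then have "(\<Sum>i\<in>{1..N}. \<integral>z. c \<partial>\<mu> i \<omega>) = (\<Sum>i\<in>{1..N}. c)" by (intro sum.cong) auto
  then show ?thesis using N by (simp add: Av_def)
qed

lemma Av_sum: "(\<And>i. i \<in> I \<Longrightarrow> bounded_borel (G i)) \<Longrightarrow> \<omega> \<in> space M \<Longrightarrow>
    Av (\<lambda>z. \<Sum>i\<in>I. G i z) \<omega> = (\<Sum>i\<in>I. Av (G i) \<omega>)"
proof (induction I rule: infinite_finite_induct)
  case (insert i I)
  then show ?case by (simp add: Av_add bounded_borel_sum)
qed (simp_all add: Av_const)

lemma Av_mono:
  assumes "bounded_borel G" "bounded_borel H" "\<omega> \<in> space M" "\<And>z. G z \<le> H z"
  shows "Av G \<omega> \<le> Av H \<omega>"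
  unfolding Av_def using assms by (intro mult_left_mono sum_mono integral_mono integrable_\<mu>) auto

lemma Av_nonneg: "\<omega> \<in> space M \<Longrightarrow> (\<And>z. 0 \<le> G z) \<Longrightarrow> 0 \<le> Av G \<omega>"
  unfolding Av_def by (intro mult_nonneg_nonneg sum_nonneg integral_nonneg_AE) auto

lemma Av_measurable: "bounded_borel G \<Longrightarrow> Av G \<in> borel_measurable M"
  unfolding Av_def using F_measurable[OF _ integral_\<mu>_measurable]
  by (intro borel_measurable_times borel_measurable_sum) auto

lemma Av_mean: "bounded_borel G \<Longrightarrow> integrable M (Av G) \<and> expectation (Av G) = (\<integral>z. G z \<partial>\<pi>)"
proof -
  assume G: "bounded_borel G"
  have I: "integrable M (\<lambda>\<omega>. \<Sum>i\<in>{1..N}. \<integral>z. G z \<partial>\<mu> i \<omega>)"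
    by (intro Bochner_Integration.integrable_sum integral_\<mu>_integrable G)
  have "expectation (\<lambda>\<omega>. \<Sum>i\<in>{1..N}. \<integral>z. G z \<partial>\<mu> i \<omega>) = (\<Sum>i\<in>{1..N}. expectation (\<lambda>\<omega>. \<integral>z. G z \<partial>\<mu> i \<omega>))"
    by (intro Bochner_Integration.integral_sum integral_\<mu>_integrable G)
  also have "\<dots> = (\<Sum>i\<in>{1..N}. \<integral>z. G z \<partial>\<pi>)" by (intro sum.cong refl integral_\<mu>_mean G)
  finally have "expectation (\<lambda>\<omega>. \<Sum>i\<in>{1..N}. \<integral>z. G z \<partial>\<mu> i \<omega>) = N * (\<integral>z. G z \<partial>\<pi>)" by simp
  then show ?thesis unfolding Av_def integral_mult_right_zero using I N
    by (intro conjI integrable_mult_right) simp_all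
qed

text \<open>Independence gives the factor \<open>1 / N\<close>; inside a copy the time average only costs Jensen's inequality.\<close>

lemma Av_variance:
  assumes G: "bounded_borel G" and z: "(\<integral>z. G z \<partial>\<pi>) = 0"
  shows "integrable M (\<lambda>\<omega>. (Av G \<omega>)\<^sup>2)" "expectation (\<lambda>\<omega>. (Av G \<omega>)\<^sup>2) \<le> (1 / N) * (\<integral>z. (G z)\<^sup>2 \<partial>\<pi>)"
proof -
  let ?Y = "\<lambda>i \<omega>. \<integral>z. G z \<partial>\<mu> i \<omega>"
  have iv: "indep_vars (\<lambda>_. borel) ?Y {1..N}" by (intro indep_vars_F integral_\<mu>_measurable G)
  have *: "integrable M (\<lambda>\<omega>. (\<Sum>i\<in>{1..N}. ?Y i \<omega>)\<^sup>2)"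
    "expectation (\<lambda>\<omega>. (\<Sum>i\<in>{1..N}. ?Y i \<omega>)\<^sup>2) = (\<Sum>i\<in>{1..N}. expectation (\<lambda>\<omega>. (?Y i \<omega>)\<^sup>2))"
    using second_moment_sum_indep[OF finite_atLeastAtMost iv] integral_\<mu>_integrable[OF G] integral_\<mu>_mean[OF G] z
    by auto
  have eq: "(Av G \<omega>)\<^sup>2 = (1 / N)\<^sup>2 * (\<Sum>i\<in>{1..N}. ?Y i \<omega>)\<^sup>2" for \<omega>
    unfolding Av_def by (rule power_mult_distrib)
  show "integrable M (\<lambda>\<omega>. (Av G \<omega>)\<^sup>2)" unfolding eq using *(1) by simp
  have "expectation (\<lambda>\<omega>. (Av G \<omega>)\<^sup>2) = (1 / N)\<^sup>2 * (\<Sum>i\<in>{1..N}. expectation (\<lambda>\<omega>. (?Y i \<omega>)\<^sup>2))"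
    unfolding eq using * by simp
  also have "\<dots> \<le> (1 / N)\<^sup>2 * (\<Sum>i\<in>{1..N}. (\<integral>z. (G z)\<^sup>2 \<partial>\<pi>))"
  proof (intro mult_left_mono sum_mono)
    fix i assume i: "i \<in> {1..N}"
    have G2: "bounded_borel (\<lambda>z. (G z)\<^sup>2)" by (rule bounded_borel_power2[OF G])
    have "expectation (\<lambda>\<omega>. (?Y i \<omega>)\<^sup>2) \<le> expectation (\<lambda>\<omega>. \<integral>z. (G z)\<^sup>2 \<partial>\<mu> i \<omega>)"
      using i by (intro integral_mono integral_\<mu>_integrable G G2 prob_space.integral_power2_le \<mu>_prob integrable_\<mu>) auto
    then show "expectation (\<lambda>\<omega>. (?Y i \<omega>)\<^sup>2) \<le> (\<integral>z. (G z)\<^sup>2 \<partial>\<pi>)"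
      using integral_\<mu>_mean[OF G2 i] by simp
  qed simp
  also have "\<dots> = (1 / N) * (\<integral>z. (G z)\<^sup>2 \<partial>\<pi>)" using N by (simp add: power2_eq_square)
  finally show "expectation (\<lambda>\<omega>. (Av G \<omega>)\<^sup>2) \<le> (1 / N) * (\<integral>z. (G z)\<^sup>2 \<partial>\<pi>)" .
qed

text \<open>The matrix Chernoff bound for the empirical Gram matrices of a basis that is orthonormal for the mean measure.
Each summand has quadratic form at most \<open>K / N\<close> by the Cauchy-Schwarz inequality.\<close>

lemma empirical_gram_lower_bound:
  fixes h :: "nat \<Rightarrow> real \<times> real \<Rightarrow> real"
  assumes h: "\<And>j. j < m \<Longrightarrow> bounded_borel (h j)"
    and on: "\<And>j l. j < m \<Longrightarrow> l < m \<Longrightarrow> (\<integral>z. h j z * h l z \<partial>\<pi>) = (if j = l then 1 else 0)"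
    and K: "\<And>z. (\<Sum>j<m. (h j z)\<^sup>2) \<le> K" "0 < K"
  shows "\<exists>Bad\<in>events. prob Bad \<le> m * exp (- ((1 - ln 2) * N / (2 * K))) \<and>
    (\<forall>\<omega>\<in>space M - Bad. \<forall>v. (\<Sum>j<m. (v j)\<^sup>2) / 2 \<le> Av (\<lambda>z. (\<Sum>j<m. v j * h j z)\<^sup>2) \<omega>)"
proof -
  define X where "X i \<omega> = (\<lambda>j l. if j < m \<and> l < m then (1 / N) * (\<integral>z. h j z * h l z \<partial>\<mu> i \<omega>) else 0)" for i \<omega>
  have hh: "bounded_borel (\<lambda>z. h j z * h l z)" if "j < m" "l < m" for j l
    by (intro bounded_borel_mult h that)
  have lin: "bounded_borel (\<lambda>z. (\<Sum>j<m. v j * h j z)\<^sup>2)" for v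
    by (intro bounded_borel_intros h) auto
  have quad: "dot m v (act m (X i \<omega>) v) = (1 / N) * (\<integral>z. (\<Sum>j<m. v j * h j z)\<^sup>2 \<partial>\<mu> i \<omega>)"
    if i: "i \<in> {1..N}" "\<omega> \<in> space M" for i \<omega> v
  proof -
    have "(\<integral>z. (\<Sum>j<m. v j * h j z)\<^sup>2 \<partial>\<mu> i \<omega>) = (\<integral>z. (\<Sum>j<m. \<Sum>l<m. (v j * v l) * (h j z * h l z)) \<partial>\<mu> i \<omega>)"
      by (simp add: power2_eq_square sum_product mult_ac)
    also have "\<dots> = (\<Sum>j<m. \<Sum>l<m. (v j * v l) * (\<integral>z. h j z * h l z \<partial>\<mu> i \<omega>))"
    proof -
      have I: "integrable (\<mu> i \<omega>) (\<lambda>z. (v j * v l) * (h j z * h l z))" if "j < m" "l < m" for j l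
        using integrable_\<mu>[OF hh[OF that] i] by simp
      show ?thesis
        using I by (subst Bochner_Integration.integral_sum) (auto intro!: sum.cong simp: Bochner_Integration.integral_sum)
    qed
    finally show ?thesis
      by (simp add: dot_def act_def X_def sum_distrib_left mult_ac)
  qed
  have psdX: "psd m (X i \<omega>)" if i: "i \<in> {1..N}" "\<omega> \<in> space M" for i \<omega>
  proof -
    have "symm m (X i \<omega>)" by (auto simp: symm_def X_def mult.commute)
    moreover have "0 \<le> dot m v (act m (X i \<omega>) v)" for v unfolding quad[OF i] by simp
    ultimately show ?thesis by (simp add: psd_def)
  qed
  have up: "dot m v (act m (X i \<omega>) v) \<le> (K / N) * dot m v v" if i: "i \<in> {1..N}" "\<omega> \<in> space M" for i \<omega> v
  proof -
    interpret m: prob_space "\<mu> i \<omega>" by (intro \<mu>_prob i)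
    have "(\<integral>z. (\<Sum>j<m. v j * h j z)\<^sup>2 \<partial>\<mu> i \<omega>) \<le> (\<integral>z. dot m v v * K \<partial>\<mu> i \<omega>)"
    proof (intro integral_mono integrable_\<mu> lin i bounded_borel_const)
      fix z
      have "(\<Sum>j<m. v j * h j z)\<^sup>2 \<le> dot m v v * (\<Sum>j<m. (h j z)\<^sup>2)"
        using dot_Cauchy_Schwarz[of m v "\<lambda>j. h j z"] by (simp add: dot_def power2_eq_square)
      also have "\<dots> \<le> dot m v v * K" by (intro mult_left_mono K dot_self_nonneg)
      finally show "(\<Sum>j<m. v j * h j z)\<^sup>2 \<le> dot m v v * K" .
    qed
    also have "\<dots> = dot m v v * K" by (simp add: m.prob_space)
    finally have "(1 / N) * (\<integral>z. (\<Sum>j<m. v j * h j z)\<^sup>2 \<partial>\<mu> i \<omega>) \<le> (1 / N) * (dot m v v * K)"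
      by (intro mult_left_mono) auto
    then show ?thesis unfolding quad[OF i] by (simp add: mult_ac)
  qed
  have iv: "indep_vars (\<lambda>_. PiM ({..<m} \<times> {..<m}) (\<lambda>_. borel))
      (\<lambda>i \<omega>. \<lambda>p\<in>{..<m} \<times> {..<m}. X i \<omega> (fst p) (snd p)) {1..N}"
  proof (intro indep_vars_F measurable_restrict)
    fix i p assume i: "i \<in> {1..N}" "p \<in> {..<m} \<times> {..<m}"
    then show "(\<lambda>\<omega>. X i \<omega> (fst p) (snd p)) \<in> borel_measurable (F i)"
      using integral_\<mu>_measurable[OF hh i(1), of "fst p" "snd p"] by (auto simp: X_def)
  qed
  have mean: "expectation (\<lambda>\<omega>. X i \<omega> j l) = (if j = l then 1 / N else 0)"
    if "i \<in> {1..N}" "j < m" "l < m" for i j l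
    using integral_\<mu>_mean[OF hh that(1), of j l] that on[of j l] by (simp add: X_def)
  have KN: "0 < K / N" using K N by simp
  have bd: "(1 - ln 2) * N / (2 * K) = (1 - ln 2) / (2 * (K / N))" using K N by simp
  obtain Bad where Bad: "Bad \<in> events" "prob Bad \<le> m * exp (- ((1 - ln 2) * N / (2 * K)))"
    and low: "\<And>\<omega> v. \<omega> \<in> space M - Bad \<Longrightarrow> dot m v v / 2 \<le> dot m v (act m (\<lambda>j l. \<Sum>i\<in>{1..N}. X i \<omega> j l) v)"
    using matrix_Chernoff_lower_tail[OF iv psdX up KN mean N] unfolding bd by blast
  have "(\<Sum>j<m. (v j)\<^sup>2) / 2 \<le> Av (\<lambda>z. (\<Sum>j<m. v j * h j z)\<^sup>2) \<omega>" if w: "\<omega> \<in> space M - Bad" for \<omega> v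
  proof -
    have "dot m v (act m (\<lambda>j l. \<Sum>i\<in>{1..N}. X i \<omega> j l) v) = (\<Sum>j<m. \<Sum>l<m. \<Sum>i\<in>{1..N}. v j * (X i \<omega> j l * v l))"
      by (simp add: dot_def act_def sum_distrib_left sum_distrib_right)
    also have "\<dots> = (\<Sum>j<m. \<Sum>i\<in>{1..N}. \<Sum>l<m. v j * (X i \<omega> j l * v l))"
      by (intro sum.cong refl sum.swap)
    also have "\<dots> = (\<Sum>i\<in>{1..N}. \<Sum>j<m. \<Sum>l<m. v j * (X i \<omega> j l * v l))"
      by (rule sum.swap)
    also have "\<dots> = (\<Sum>i\<in>{1..N}. dot m v (act m (X i \<omega>) v))"
      by (simp add: dot_def act_def sum_distrib_left)
    also have "\<dots> = Av (\<lambda>z. (\<Sum>j<m. v j * h j z)\<^sup>2) \<omega>"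
      unfolding Av_def sum_distrib_left using w by (intro sum.cong refl quad) auto
    finally show ?thesis using low[OF w, of v] by (simp add: dot_def power2_eq_square)
  qed
  then show ?thesis using Bad by blast
qed

text \<open>The excess risk of least squares is a supremum of \<open>2 <g, e> - <g, g>\<close> over candidates \<open>g\<close>, with empirical inner
products. On the good event the supremum is at most twice the squared empirical coefficients of the noise \<open>e\<close>,
whose variance yields \<open>2 m L / N\<close>; off it the supremum is at most the empirical energy of the noise, which is
bounded by \<open>D\<close>.\<close>

lemma stochastic_term_bound:
  fixes h :: "nat \<Rightarrow> real \<times> real \<Rightarrow> real" and e :: "nat \<Rightarrow> real \<times> real \<Rightarrow> real"
  assumes h: "\<And>j. j < m \<Longrightarrow> bounded_borel (h j)"
    and on: "\<And>j l. j < m \<Longrightarrow> l < m \<Longrightarrow> (\<integral>z. h j z * h l z \<partial>\<pi>) = (if j = l then 1 else 0)"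
    and K: "\<And>z. (\<Sum>j<m. (h j z)\<^sup>2) \<le> K" "0 < K"
    and e: "\<And>l. l \<in> Ls \<Longrightarrow> bounded_borel (e l)" and Ls: "finite Ls"
    and orth: "\<And>j l. j < m \<Longrightarrow> l \<in> Ls \<Longrightarrow> (\<integral>z. h j z * e l z \<partial>\<pi>) = 0"
    and L: "\<And>j. j < m \<Longrightarrow> (\<Sum>l\<in>Ls. \<integral>z. (h j z * e l z)\<^sup>2 \<partial>\<pi>) \<le> L"
    and D: "\<And>z. (\<Sum>l\<in>Ls. (e l z)\<^sup>2) \<le> D" "0 \<le> D"
  shows "\<exists>V. V \<in> borel_measurable M \<and> (\<forall>\<omega>. 0 \<le> V \<omega>) \<and>
    (\<integral>\<^sup>+\<omega>. ennreal (V \<omega>) \<partial>M) \<le> ennreal (2 * m * L / N + D * (m * exp (- ((1 - ln 2) * N / (2 * K))))) \<and>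
    (\<forall>\<omega>\<in>space M. \<forall>d. (\<Sum>l\<in>Ls. 2 * Av (\<lambda>z. (\<Sum>j<m. d l j * h j z) * e l z) \<omega>
        - Av (\<lambda>z. (\<Sum>j<m. d l j * h j z)\<^sup>2) \<omega>) \<le> V \<omega>)"
proof -
  obtain Bad where Bad: "Bad \<in> events" "prob Bad \<le> m * exp (- ((1 - ln 2) * N / (2 * K)))"
    and low: "\<And>\<omega> v. \<omega> \<in> space M - Bad \<Longrightarrow> (\<Sum>j<m. (v j)\<^sup>2) / 2 \<le> Av (\<lambda>z. (\<Sum>j<m. v j * h j z)\<^sup>2) \<omega>"
    using empirical_gram_lower_bound[OF h on K] by blast
  have he: "bounded_borel (\<lambda>z. h j z * e l z)" if "j < m" "l \<in> Ls" for j l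
    by (intro bounded_borel_mult h e that)
  have g: "bounded_borel (\<lambda>z. \<Sum>j<m. v j * h j z)" for v
    by (intro bounded_borel_intros h) auto
  define \<nu> where "\<nu> l j = Av (\<lambda>z. h j z * e l z)" for l j
  define V where "V \<omega> = D * indicator Bad \<omega> + 2 * (\<Sum>l\<in>Ls. \<Sum>j<m. (\<nu> l j \<omega>)\<^sup>2)" for \<omega>
  have \<nu>m[measurable]: "\<nu> l j \<in> borel_measurable M" if "j < m" "l \<in> Ls" for l j
    unfolding \<nu>_def by (intro Av_measurable he that)
  have V0: "0 \<le> V \<omega>" for \<omega> using D(2) by (auto simp: V_def intro!: add_nonneg_nonneg mult_nonneg_nonneg sum_nonneg)
  have \<nu>sq: "integrable M (\<lambda>\<omega>. (\<nu> l j \<omega>)\<^sup>2)"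
     "expectation (\<lambda>\<omega>. (\<nu> l j \<omega>)\<^sup>2) \<le> (1 / N) * (\<integral>z. (h j z * e l z)\<^sup>2 \<partial>\<pi>)" if "j < m" "l \<in> Ls" for l j
    unfolding \<nu>_def using Av_variance[OF he[OF that] orth[OF that]] by auto
  have indI: "integrable M (\<lambda>\<omega>. D * indicator Bad \<omega>)"
    using Bad(1) by (intro integrable_mult_right) (auto simp: emeasure_eq_measure)
  have sqI: "integrable M (\<lambda>\<omega>. \<Sum>l\<in>Ls. \<Sum>j<m. (\<nu> l j \<omega>)\<^sup>2)"
    by (intro Bochner_Integration.integrable_sum \<nu>sq) auto
  have VI: "integrable M V" unfolding V_def using indI sqI by auto
  have "expectation V = D * prob Bad + 2 * (\<Sum>l\<in>Ls. \<Sum>j<m. expectation (\<lambda>\<omega>. (\<nu> l j \<omega>)\<^sup>2))"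
  proof -
    have "expectation (\<lambda>\<omega>. \<Sum>l\<in>Ls. \<Sum>j<m. (\<nu> l j \<omega>)\<^sup>2) = (\<Sum>l\<in>Ls. expectation (\<lambda>\<omega>. \<Sum>j<m. (\<nu> l j \<omega>)\<^sup>2))"
      by (intro Bochner_Integration.integral_sum Bochner_Integration.integrable_sum \<nu>sq) auto
    also have "\<dots> = (\<Sum>l\<in>Ls. \<Sum>j<m. expectation (\<lambda>\<omega>. (\<nu> l j \<omega>)\<^sup>2))"
      by (intro sum.cong refl Bochner_Integration.integral_sum \<nu>sq) auto
    finally show ?thesis unfolding V_def using indI sqI Bad(1) by simp
  qed
  also have "\<dots> \<le> D * (m * exp (- ((1 - ln 2) * N / (2 * K)))) + 2 * (m * (L / N))"
  proof (intro add_mono mult_left_mono Bad D)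
    have "(\<Sum>l\<in>Ls. \<Sum>j<m. expectation (\<lambda>\<omega>. (\<nu> l j \<omega>)\<^sup>2))
        \<le> (\<Sum>l\<in>Ls. \<Sum>j<m. (1 / N) * (\<integral>z. (h j z * e l z)\<^sup>2 \<partial>\<pi>))"
      by (intro sum_mono \<nu>sq) auto
    also have "\<dots> = (\<Sum>j<m. (1 / N) * (\<Sum>l\<in>Ls. \<integral>z. (h j z * e l z)\<^sup>2 \<partial>\<pi>))"
      unfolding sum_distrib_left by (rule sum.swap)
    also have "\<dots> \<le> (\<Sum>j<m. (1 / N) * L)" by (intro sum_mono mult_left_mono L) auto
    finally show "(\<Sum>l\<in>Ls. \<Sum>j<m. expectation (\<lambda>\<omega>. (\<nu> l j \<omega>)\<^sup>2)) \<le> m * (L / N)" by simp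
  qed simp
  finally have EV: "expectation V \<le> 2 * m * L / N + D * (m * exp (- ((1 - ln 2) * N / (2 * K))))"
    by (simp add: algebra_simps)
  have nnV: "(\<integral>\<^sup>+\<omega>. ennreal (V \<omega>) \<partial>M) \<le> ennreal (2 * m * L / N + D * (m * exp (- ((1 - ln 2) * N / (2 * K)))))"
    using EV VI V0 by (subst nn_integral_eq_integral) (auto intro: ennreal_leI)
  have bound: "(\<Sum>l\<in>Ls. 2 * Av (\<lambda>z. (\<Sum>j<m. d l j * h j z) * e l z) \<omega> - Av (\<lambda>z. (\<Sum>j<m. d l j * h j z)\<^sup>2) \<omega>) \<le> V \<omega>"
    if w: "\<omega> \<in> space M" for \<omega> d
  proof (cases "\<omega> \<in> Bad")
    case True
    \<comment> \<open>Here nothing is known about the Gram matrix, but \<open>2 g e - g^2 \<le> e^2\<close> holds pointwise.\<close>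
    have "(\<Sum>l\<in>Ls. 2 * Av (\<lambda>z. (\<Sum>j<m. d l j * h j z) * e l z) \<omega> - Av (\<lambda>z. (\<Sum>j<m. d l j * h j z)\<^sup>2) \<omega>)
        \<le> (\<Sum>l\<in>Ls. Av (\<lambda>z. (e l z)\<^sup>2) \<omega>)"
    proof (rule sum_mono)
      fix l assume l: "l \<in> Ls"
      let ?g = "\<lambda>z. \<Sum>j<m. d l j * h j z"
      have ge: "bounded_borel (\<lambda>z. ?g z * e l z)" "bounded_borel (\<lambda>z. (?g z)\<^sup>2)" "bounded_borel (\<lambda>z. (e l z)\<^sup>2)"
        by (intro bounded_borel_mult bounded_borel_power2 g e l)+
      have "2 * Av (\<lambda>z. ?g z * e l z) \<omega> - Av (\<lambda>z. (?g z)\<^sup>2) \<omega> = Av (\<lambda>z. 2 * (?g z * e l z) - (?g z)\<^sup>2) \<omega>"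
        using ge w by (simp add: Av_diff Av_cmult bounded_borel_cmult)
      also have "\<dots> \<le> Av (\<lambda>z. (e l z)\<^sup>2) \<omega>"
      proof (rule Av_mono[OF bounded_borel_diff[OF bounded_borel_cmult[OF ge(1)] ge(2)] ge(3) w])
        fix z
        show "2 * (?g z * e l z) - (?g z)\<^sup>2 \<le> (e l z)\<^sup>2"
          using zero_le_power2[of "?g z - e l z"] unfolding power2_diff by linarith
      qed
      finally show "2 * Av (\<lambda>z. ?g z * e l z) \<omega> - Av (\<lambda>z. (?g z)\<^sup>2) \<omega> \<le> Av (\<lambda>z. (e l z)\<^sup>2) \<omega>" .
    qed
    also have "\<dots> = Av (\<lambda>z. \<Sum>l\<in>Ls. (e l z)\<^sup>2) \<omega>"
      by (intro Av_sum[symmetric] bounded_borel_power2 e w)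
    also have "\<dots> \<le> Av (\<lambda>z. D) \<omega>"
      by (intro Av_mono bounded_borel_sum bounded_borel_power2 e w D bounded_borel_const)
    also have "\<dots> = D" by (rule Av_const[OF w])
    also have "D \<le> V \<omega>" using True by (auto simp: V_def intro!: sum_nonneg)
    finally show ?thesis .
  next
    case False
    \<comment> \<open>The square term is at least half the squared norm of the coefficients, and
      \<open>2 u \<nu> - u^2 / 2 \<le> 2 \<nu>^2\<close> for each coefficient \<open>u\<close>.\<close>
    have "(\<Sum>l\<in>Ls. 2 * Av (\<lambda>z. (\<Sum>j<m. d l j * h j z) * e l z) \<omega> - Av (\<lambda>z. (\<Sum>j<m. d l j * h j z)\<^sup>2) \<omega>)
        \<le> (\<Sum>l\<in>Ls. \<Sum>j<m. 2 * (\<nu> l j \<omega>)\<^sup>2)"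
    proof (rule sum_mono)
      fix l assume l: "l \<in> Ls"
      have "Av (\<lambda>z. (\<Sum>j<m. d l j * h j z) * e l z) \<omega> = Av (\<lambda>z. \<Sum>j<m. d l j * (h j z * e l z)) \<omega>"
        by (simp add: sum_distrib_right mult.assoc)
      also have "\<dots> = (\<Sum>j<m. Av (\<lambda>z. d l j * (h j z * e l z)) \<omega>)"
        using he l w by (intro Av_sum bounded_borel_cmult) auto
      also have "\<dots> = (\<Sum>j<m. d l j * \<nu> l j \<omega>)" by (simp add: Av_cmult \<nu>_def)
      finally have "2 * Av (\<lambda>z. (\<Sum>j<m. d l j * h j z) * e l z) \<omega> - Av (\<lambda>z. (\<Sum>j<m. d l j * h j z)\<^sup>2) \<omega>
          \<le> 2 * (\<Sum>j<m. d l j * \<nu> l j \<omega>) - (\<Sum>j<m. (d l j)\<^sup>2) / 2"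
        using low[of \<omega> "d l"] w False by simp
      also have "\<dots> = (\<Sum>j<m. 2 * (d l j * \<nu> l j \<omega>) - (d l j)\<^sup>2 / 2)"
        by (simp add: sum_subtractf sum_distrib_left sum_divide_distrib)
      also have "\<dots> \<le> (\<Sum>j<m. 2 * (\<nu> l j \<omega>)\<^sup>2)"
      proof (rule sum_mono)
        fix j
        show "2 * (d l j * \<nu> l j \<omega>) - (d l j)\<^sup>2 / 2 \<le> 2 * (\<nu> l j \<omega>)\<^sup>2"
          using zero_le_power2[of "d l j - 2 * \<nu> l j \<omega>"] unfolding power2_diff power_mult_distrib by simp
      qed
      finally show "2 * Av (\<lambda>z. (\<Sum>j<m. d l j * h j z) * e l z) \<omega> - Av (\<lambda>z. (\<Sum>j<m. d l j * h j z)\<^sup>2) \<omega>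
          \<le> (\<Sum>j<m. 2 * (\<nu> l j \<omega>)\<^sup>2)" .
    qed
    also have "\<dots> = V \<omega>" using False by (simp add: V_def sum_distrib_left)
    finally show ?thesis .
  qed
  show ?thesis using VI V0 nnV bound by (intro exI[of _ V]) auto
qed

end

section \<open>Least squares regression on a whitened basis\<close>

text \<open>Fourier expansion of the quadratic risk: it is minimal at the coefficients \<open>\<integral>z. h j z * p z \<partial>P\<close>.\<close>

lemma integral_orthonormal_combination:
  fixes h :: "nat \<Rightarrow> 'z::topological_space \<Rightarrow> real"
  assumes P: "prob_space P" "sets P = sets borel"
    and h: "\<And>j. j < m \<Longrightarrow> bounded_borel (h j)"
    and on: "\<And>j l. j < m \<Longrightarrow> l < m \<Longrightarrow> (\<integral>z. h j z * h l z \<partial>P) = (if j = l then 1 else 0)"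
    and p: "bounded_borel p"
  shows "(\<integral>z. (\<Sum>j<m. e j * h j z) * p z \<partial>P) = (\<Sum>j<m. e j * (\<integral>z. h j z * p z \<partial>P))"
    and "(\<integral>z. (\<Sum>j<m. e j * h j z)\<^sup>2 \<partial>P) = (\<Sum>j<m. (e j)\<^sup>2)"
    and "(\<integral>z. ((\<Sum>j<m. e j * h j z) - p z)\<^sup>2 \<partial>P) =
      (\<Sum>j<m. (e j - (\<integral>z. h j z * p z \<partial>P))\<^sup>2) - (\<Sum>j<m. (\<integral>z. h j z * p z \<partial>P)\<^sup>2) + (\<integral>z. (p z)\<^sup>2 \<partial>P)"
proof -
  have int: "integrable P G" if "bounded_borel G" for G :: "'z \<Rightarrow> real"
    by (rule bounded_borel_integrable[OF P(1) that P(2)])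
  have lin: "(\<integral>z. (\<Sum>j<m. e j * h j z) * q z \<partial>P) = (\<Sum>j<m. e j * (\<integral>z. h j z * q z \<partial>P))"
    if q: "bounded_borel q" for q :: "'z \<Rightarrow> real"
  proof -
    have I: "integrable P (\<lambda>z. e j * (h j z * q z))" if "j < m" for j
      by (intro integrable_mult_right int bounded_borel_mult h q that)
    have "(\<integral>z. (\<Sum>j<m. e j * h j z) * q z \<partial>P) = (\<integral>z. (\<Sum>j<m. e j * (h j z * q z)) \<partial>P)"
      by (simp add: sum_distrib_right mult.assoc)
    also have "\<dots> = (\<Sum>j<m. \<integral>z. e j * (h j z * q z) \<partial>P)"
      by (rule Bochner_Integration.integral_sum) (use I in auto)
    finally show ?thesis by simp
  qed
  show c: "(\<integral>z. (\<Sum>j<m. e j * h j z) * p z \<partial>P) = (\<Sum>j<m. e j * (\<integral>z. h j z * p z \<partial>P))"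
    by (rule lin[OF p])
  have g: "bounded_borel (\<lambda>z. \<Sum>j<m. e j * h j z)" by (intro bounded_borel_sum bounded_borel_cmult h) auto
  have "(\<integral>z. h j z * (\<Sum>k<m. e k * h k z) \<partial>P) = e j" if j: "j < m" for j
  proof -
    have "(\<integral>z. h j z * (\<Sum>k<m. e k * h k z) \<partial>P) = (\<Sum>k<m. e k * (\<integral>z. h k z * h j z \<partial>P))"
      using lin[OF h[OF j]] by (simp add: mult.commute)
    also have "\<dots> = (\<Sum>k<m. if k = j then e j else 0)" using on j by (intro sum.cong) auto
    finally show ?thesis using j by simp
  qed
  then show sq: "(\<integral>z. (\<Sum>j<m. e j * h j z)\<^sup>2 \<partial>P) = (\<Sum>j<m. (e j)\<^sup>2)"
    using lin[OF g] by (simp add: power2_eq_square)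
  have "(\<integral>z. ((\<Sum>j<m. e j * h j z) - p z)\<^sup>2 \<partial>P)
      = (\<integral>z. (\<Sum>j<m. e j * h j z)\<^sup>2 - 2 * ((\<Sum>j<m. e j * h j z) * p z) + (p z)\<^sup>2 \<partial>P)"
    by (intro Bochner_Integration.integral_cong refl) (simp add: power2_diff algebra_simps)
  also have "\<dots> = (\<integral>z. (\<Sum>j<m. e j * h j z)\<^sup>2 \<partial>P) - 2 * (\<integral>z. (\<Sum>j<m. e j * h j z) * p z \<partial>P) + (\<integral>z. (p z)\<^sup>2 \<partial>P)"
    using int[OF bounded_borel_power2[OF g]] int[OF bounded_borel_mult[OF g p]] int[OF bounded_borel_power2[OF p]]
    by simp
  also have "\<dots> = (\<Sum>j<m. (e j - (\<integral>z. h j z * p z \<partial>P))\<^sup>2) - (\<Sum>j<m. (\<integral>z. h j z * p z \<partial>P)\<^sup>2) + (\<integral>z. (p z)\<^sup>2 \<partial>P)"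
    unfolding sq c by (simp add: power2_diff sum.distrib sum_subtractf sum_distrib_left mult_ac)
  finally show "(\<integral>z. ((\<Sum>j<m. e j * h j z) - p z)\<^sup>2 \<partial>P) =
      (\<Sum>j<m. (e j - (\<integral>z. h j z * p z \<partial>P))\<^sup>2) - (\<Sum>j<m. (\<integral>z. h j z * p z \<partial>P)\<^sup>2) + (\<integral>z. (p z)\<^sup>2 \<partial>P)" .
qed

lemma Gram_Schmidt:
  fixes \<phi> :: "nat \<Rightarrow> 'z::topological_space \<Rightarrow> real"
  assumes P: "prob_space P" "sets P = sets borel"
    and \<phi>: "\<And>j. j < m \<Longrightarrow> bounded_borel (\<phi> j)"
    and pos: "\<And>d. \<exists>j<m. d j \<noteq> 0 \<Longrightarrow> 0 < (\<integral>z. (\<Sum>j<m. d j * \<phi> j z)\<^sup>2 \<partial>P)"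
  shows "\<exists>h. (\<forall>j<m. bounded_borel (h j)) \<and> (\<forall>j<m. \<exists>g. \<forall>z. h j z = (\<Sum>k<m. g k * \<phi> k z)) \<and>
    (\<forall>j<m. \<forall>l<m. (\<integral>z. h j z * h l z \<partial>P) = (if j = l then 1 else 0)) \<and>
    (\<forall>d. \<exists>e. \<forall>z. (\<Sum>j<m. d j * \<phi> j z) = (\<Sum>j<m. e j * h j z))"
  using \<phi> pos
proof (induction m)
  case (Suc m)
  have "\<exists>h. (\<forall>j<m. bounded_borel (h j)) \<and> (\<forall>j<m. \<exists>g. \<forall>z. h j z = (\<Sum>k<m. g k * \<phi> k z)) \<and>
    (\<forall>j<m. \<forall>l<m. (\<integral>z. h j z * h l z \<partial>P) = (if j = l then 1 else 0)) \<and>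
    (\<forall>d. \<exists>e. \<forall>z. (\<Sum>j<m. d j * \<phi> j z) = (\<Sum>j<m. e j * h j z))"
  proof (rule Suc.IH)
    show "bounded_borel (\<phi> j)" if "j < m" for j using Suc.prems(1) that by simp
    fix d :: "nat \<Rightarrow> real" assume "\<exists>j<m. d j \<noteq> 0"
    then have "\<exists>j<Suc m. (if j = m then 0 else d j) \<noteq> 0" by (metis less_Suc_eq less_irrefl)
    from Suc.prems(2)[OF this] show "0 < (\<integral>z. (\<Sum>j<m. d j * \<phi> j z)\<^sup>2 \<partial>P)" by simp
  qed
  then obtain h where h: "\<And>j. j < m \<Longrightarrow> bounded_borel (h j)"
    and hg: "\<And>j. j < m \<Longrightarrow> \<exists>g. \<forall>z. h j z = (\<Sum>k<m. g k * \<phi> k z)"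
    and on: "\<And>j l. j < m \<Longrightarrow> l < m \<Longrightarrow> (\<integral>z. h j z * h l z \<partial>P) = (if j = l then 1 else 0)"
    and sp: "\<And>d. \<exists>e. \<forall>z. (\<Sum>j<m. d j * \<phi> j z) = (\<Sum>j<m. e j * h j z)"
    by blast
  obtain G where G: "\<And>j z. j < m \<Longrightarrow> h j z = (\<Sum>k<m. G j k * \<phi> k z)" using hg by metis
  have int: "integrable P G" if "bounded_borel G" for G :: "'z \<Rightarrow> real"
    by (rule bounded_borel_integrable[OF P(1) that P(2)])
  define c where "c j = (\<integral>z. h j z * \<phi> m z \<partial>P)" for j
  define r where "r z = \<phi> m z - (\<Sum>j<m. c j * h j z)" for z
  have \<phi>m: "bounded_borel (\<phi> m)" using Suc.prems by simp
  have comb: "bounded_borel (\<lambda>z. \<Sum>j<m. e j * h j z)" for e by (intro bounded_borel_sum bounded_borel_cmult h) auto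
  have r: "bounded_borel r" unfolding r_def by (intro bounded_borel_diff \<phi>m comb)
  define gr where "gr k = (if k = m then 1 else - (\<Sum>j<m. c j * G j k))" for k
  have rg: "r z = (\<Sum>k<Suc m. gr k * \<phi> k z)" for z
  proof -
    have "(\<Sum>j<m. c j * h j z) = (\<Sum>j<m. \<Sum>k<m. c j * G j k * \<phi> k z)"
      by (simp add: G sum_distrib_left mult.assoc)
    also have "\<dots> = (\<Sum>k<m. \<Sum>j<m. c j * G j k * \<phi> k z)" by (rule sum.swap)
    finally show ?thesis by (simp add: r_def gr_def sum_negf sum_distrib_right)
  qed
  define n where "n = (\<integral>z. (r z)\<^sup>2 \<partial>P)"
  have n: "0 < n"
  proof -
    have "gr m \<noteq> 0" by (simp add: gr_def)
    then have "\<exists>k<Suc m. gr k \<noteq> 0" by blast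
    from Suc.prems(2)[OF this] show ?thesis by (simp only: n_def rg)
  qed
  have orth: "(\<integral>z. h j z * r z \<partial>P) = 0" if j: "j < m" for j
  proof -
    have "(\<integral>z. h j z * r z \<partial>P) = (\<integral>z. h j z * \<phi> m z - (\<Sum>k<m. c k * h k z) * h j z \<partial>P)"
      by (intro Bochner_Integration.integral_cong refl) (simp add: r_def algebra_simps)
    also have "\<dots> = c j - (\<Sum>k<m. c k * (\<integral>z. h k z * h j z \<partial>P))"
      using int[OF bounded_borel_mult[OF h[OF j] \<phi>m]] int[OF bounded_borel_mult[OF comb h[OF j]], of c]
        integral_orthonormal_combination(1)[OF P h on h[OF j], where e = c]
      by (simp add: c_def)
    also have "(\<Sum>k<m. c k * (\<integral>z. h k z * h j z \<partial>P)) = (\<Sum>k<m. if k = j then c j else 0)"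
      using on j by (intro sum.cong) auto
    finally show ?thesis using j by simp
  qed
  define h' where "h' j z = (if j = m then r z / sqrt n else h j z)" for j z
  have h'm: "h' m z = (1 / sqrt n) * r z" for z by (simp add: h'_def)
  have h'j: "h' j = h j" if "j < m" for j using that by (auto simp: h'_def)
  have 1: "bounded_borel (h' j)" if "j < Suc m" for j
  proof (cases "j = m")
    case True
    have "bounded_borel (\<lambda>z. (1 / sqrt n) * r z)" by (intro bounded_borel_cmult r)
    then show ?thesis unfolding True using h'm by (simp add: fun_eq_iff cong: if_cong) (metis (no_types) h'm ext)
  next
    case False
    then show ?thesis using that h h'j by auto
  qed
  have 2: "\<exists>g. \<forall>z. h' j z = (\<Sum>k<Suc m. g k * \<phi> k z)" if "j < Suc m" for j
  proof (cases "j = m")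
    case True
    show ?thesis unfolding True
      by (intro exI[of _ "\<lambda>k. (1 / sqrt n) * gr k"] allI)
         (simp only: h'm rg sum_distrib_left mult.assoc)
  next
    case False
    then have "h' j z = (\<Sum>k<Suc m. (if k = m then 0 else G j k) * \<phi> k z)" for z
      using that G[of j z] by (simp add: h'j)
    then show ?thesis by (intro exI[of _ "\<lambda>k. if k = m then 0 else G j k"] allI)
  qed
  have 3: "(\<integral>z. h' j z * h' l z \<partial>P) = (if j = l then 1 else 0)" if "j < Suc m" "l < Suc m" for j l
  proof -
    consider "j < m" "l < m" | "j = m" "l < m" | "j < m" "l = m" | "j = m" "l = m" using \<open>j < Suc m\<close> \<open>l < Suc m\<close> by linarith
    then show ?thesis
    proof cases
      case 1
      then show ?thesis using on by (simp add: h'j)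
    next
      case 2
      have "(\<integral>z. h' j z * h' l z \<partial>P) = (\<integral>z. (1 / sqrt n) * (h l z * r z) \<partial>P)"
        using 2 by (intro Bochner_Integration.integral_cong refl) (simp add: h'm h'j)
      then show ?thesis using orth 2 by simp
    next
      case 3
      have "(\<integral>z. h' j z * h' l z \<partial>P) = (\<integral>z. (1 / sqrt n) * (h j z * r z) \<partial>P)"
        using 3 by (intro Bochner_Integration.integral_cong refl) (simp add: h'm h'j)
      then show ?thesis using orth 3 by simp
    next
      case 4
      have "(\<integral>z. h' j z * h' l z \<partial>P) = (\<integral>z. (1 / n) * (r z)\<^sup>2 \<partial>P)"
        using 4 n by (intro Bochner_Integration.integral_cong refl) (simp add: h'm power2_eq_square)
      then show ?thesis using 4 n by (simp add: n_def)
    qed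
  qed
  have 4: "\<exists>e. \<forall>z. (\<Sum>j<Suc m. d j * \<phi> j z) = (\<Sum>j<Suc m. e j * h' j z)" for d
  proof -
    obtain e where e: "\<And>z. (\<Sum>j<m. d j * \<phi> j z) = (\<Sum>j<m. e j * h j z)" using sp by blast
    define e' where "e' j = (if j = m then d m * sqrt n else e j + d m * c j)" for j
    have "(\<Sum>j<Suc m. d j * \<phi> j z) = (\<Sum>j<Suc m. e' j * h' j z)" for z
    proof -
      have "(\<Sum>j<m. e' j * h' j z) = (\<Sum>j<m. e j * h j z) + d m * (\<Sum>j<m. c j * h j z)"
        by (simp add: e'_def h'j algebra_simps sum.distrib sum_distrib_left)
      moreover have "e' m * h' m z = d m * r z" using n by (simp add: e'_def h'm)
      ultimately show ?thesis by (simp add: e r_def algebra_simps)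
    qed
    then show ?thesis by blast
  qed
  show ?case using 1 2 3 4 by (intro exI[of _ h'] conjI) auto
qed simp

text \<open>If \<open>\<kappa>\<close> bounds the inverse Gram matrix, a function of norm one has coefficients of squared norm at most \<open>\<kappa>\<close>,
hence values of square at most \<open>L * \<kappa>\<close>. Thus \<open>L * \<kappa>\<close> bounds the sum of squares of any orthonormal basis of
the span.\<close>

lemma whitened_basis:
  fixes \<phi> :: "nat \<Rightarrow> 'z::topological_space \<Rightarrow> real"
  assumes P: "prob_space P" "sets P = sets borel"
    and \<phi>: "\<And>j. j < m \<Longrightarrow> bounded_borel (\<phi> j)"
    and \<kappa>: "\<And>d. (\<Sum>j<m. (d j)\<^sup>2) \<le> \<kappa> * (\<integral>z. (\<Sum>j<m. d j * \<phi> j z)\<^sup>2 \<partial>P)"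
    and L: "\<And>z. (\<Sum>j<m. (\<phi> j z)\<^sup>2) \<le> L"
    and K: "L * \<kappa> \<le> K" "0 < K"
  obtains h where "\<And>j. j < m \<Longrightarrow> bounded_borel (h j)"
    "\<And>j. j < m \<Longrightarrow> \<exists>g. \<forall>z. h j z = (\<Sum>k<m. g k * \<phi> k z)"
    "\<And>j l. j < m \<Longrightarrow> l < m \<Longrightarrow> (\<integral>z. h j z * h l z \<partial>P) = (if j = l then 1 else 0)"
    "\<And>d. \<exists>e. \<forall>z. (\<Sum>j<m. d j * \<phi> j z) = (\<Sum>j<m. e j * h j z)"
    "\<And>z. (\<Sum>j<m. (h j z)\<^sup>2) \<le> K"
proof -
  have pos: "0 < (\<integral>z. (\<Sum>j<m. d j * \<phi> j z)\<^sup>2 \<partial>P)" if "\<exists>j<m. d j \<noteq> 0" for d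
  proof -
    have "0 < (\<Sum>j<m. (d j)\<^sup>2)" using that by (auto intro!: sum_pos2)
    then have "(\<integral>z. (\<Sum>j<m. d j * \<phi> j z)\<^sup>2 \<partial>P) \<noteq> 0" using \<kappa>[of d] by auto
    moreover have "0 \<le> (\<integral>z. (\<Sum>j<m. d j * \<phi> j z)\<^sup>2 \<partial>P)" by simp
    ultimately show ?thesis by linarith
  qed
  obtain h where h: "\<And>j. j < m \<Longrightarrow> bounded_borel (h j)"
    "\<And>j. j < m \<Longrightarrow> \<exists>g. \<forall>z. h j z = (\<Sum>k<m. g k * \<phi> k z)"
    "\<And>j l. j < m \<Longrightarrow> l < m \<Longrightarrow> (\<integral>z. h j z * h l z \<partial>P) = (if j = l then 1 else 0)"
    "\<And>d. \<exists>e. \<forall>z. (\<Sum>j<m. d j * \<phi> j z) = (\<Sum>j<m. e j * h j z)"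
    using Gram_Schmidt[OF P \<phi> pos] by blast
  obtain G where G: "\<And>j z. j < m \<Longrightarrow> h j z = (\<Sum>k<m. G j k * \<phi> k z)" using h(2) by metis
  have "(\<Sum>j<m. (h j x)\<^sup>2) \<le> K" for x
  proof -
    define s where "s = (\<Sum>j<m. (h j x)\<^sup>2)"
    \<comment> \<open>Evaluate at \<open>x\<close> the function \<open>\<Sum>j. h j x * h j\<close>, whose value there and whose squared norm are both \<open>s\<close>.\<close>
    define d where "d k = (\<Sum>j<m. h j x * G j k)" for k
    have dh: "(\<Sum>k<m. d k * \<phi> k z) = (\<Sum>j<m. h j x * h j z)" for z
    proof -
      have "(\<Sum>k<m. d k * \<phi> k z) = (\<Sum>k<m. \<Sum>j<m. h j x * G j k * \<phi> k z)"
        by (simp add: d_def sum_distrib_right)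
      also have "\<dots> = (\<Sum>j<m. \<Sum>k<m. h j x * G j k * \<phi> k z)" by (rule sum.swap)
      finally show ?thesis by (simp add: G sum_distrib_left mult.assoc)
    qed
    have "s\<^sup>2 = (dot m d (\<lambda>k. \<phi> k x))\<^sup>2" using dh[of x] by (simp add: s_def dot_def power2_eq_square)
    also have "\<dots> \<le> dot m d d * (\<Sum>k<m. (\<phi> k x)\<^sup>2)"
      using dot_Cauchy_Schwarz[of m d "\<lambda>k. \<phi> k x"] by (simp add: dot_def power2_eq_square)
    also have "\<dots> \<le> dot m d d * L" by (intro mult_left_mono L dot_self_nonneg)
    also have "\<dots> \<le> (\<kappa> * s) * L"
    proof (rule mult_right_mono)
      show "dot m d d \<le> \<kappa> * s"
      proof -
        have "(\<integral>z. (\<Sum>j<m. h j x * h j z)\<^sup>2 \<partial>P) = s"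
          unfolding s_def
          by (rule integral_orthonormal_combination(2)[OF P _ _ bounded_borel_const[of 0]]) (use h in auto)
        then show ?thesis using \<kappa>[of d] unfolding dh by (simp add: dot_def power2_eq_square)
      qed
      show "0 \<le> L" using L[of x] sum_nonneg[of "{..<m}" "\<lambda>j. (\<phi> j x)\<^sup>2"] by simp
    qed
    also have "\<dots> \<le> K * s"
    proof -
      have "0 \<le> s" by (simp add: s_def sum_nonneg)
      then show ?thesis using mult_right_mono[OF K(1), of s] by (simp add: mult_ac)
    qed
    finally have "s * s \<le> K * s" by (simp add: power2_eq_square)
    moreover have "0 \<le> s" by (simp add: s_def sum_nonneg)
    ultimately have "s \<le> K" using K(2) by (cases "s = 0") auto
    then show ?thesis by (simp add: s_def)
  qed
  then show ?thesis using h that by blast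
qed

context indep_random_measures
begin

text \<open>Simultaneous regression of the bounded responses \<open>\<psi> l\<close> on the span of the \<open>\<phi> j\<close>, with regression functions
\<open>p l\<close>. By the normal equations the squared empirical error of the estimator exceeds that of the best
approximation by \<open>2 <g, e> - <g, g>\<close>, where \<open>g\<close> is the difference of the two and \<open>e l = \<psi> l - p l\<close> is the noise.
The noise is orthogonal to all functions of the first coordinate that vanish off \<open>I\<close>, which also shows that the
conditional variances sum to at most \<open>L\<close>.\<close>

theorem regression_oracle:
  fixes \<phi> \<psi> p :: "nat \<Rightarrow> real \<Rightarrow> real"
  assumes \<phi>: "\<And>j. j < m \<Longrightarrow> bounded_borel (\<phi> j)" "\<And>j x. j < m \<Longrightarrow> x \<notin> I \<Longrightarrow> \<phi> j x = 0"
    and \<kappa>: "\<And>d. (\<Sum>j<m. (d j)\<^sup>2) \<le> \<kappa> * (\<integral>z. (\<Sum>j<m. d j * \<phi> j (fst z))\<^sup>2 \<partial>\<pi>)"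
    and L\<phi>: "\<And>x. (\<Sum>j<m. (\<phi> j x)\<^sup>2) \<le> L\<phi>" and K: "L\<phi> * \<kappa> \<le> K" "0 < K"
    and \<psi>: "\<And>l. l < n \<Longrightarrow> bounded_borel (\<psi> l)" and p: "\<And>l. l < n \<Longrightarrow> bounded_borel (p l)"
    and L\<psi>: "\<And>y. (\<Sum>l<n. (\<psi> l y)\<^sup>2) \<le> L" and Lp: "\<And>x. (\<Sum>l<n. (p l x)\<^sup>2) \<le> L"
    and cond: "\<And>l g. l < n \<Longrightarrow> bounded_borel g \<Longrightarrow> (\<And>x. x \<notin> I \<Longrightarrow> g x = 0) \<Longrightarrow>
      (\<integral>z. g (fst z) * (\<psi> l (snd z) - p l (fst z)) \<partial>\<pi>) = 0"
  obtains b V where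
    "\<And>b'. (\<Sum>l<n. \<integral>z. ((\<Sum>j<m. b l j * \<phi> j (fst z)) - p l (fst z))\<^sup>2 \<partial>\<pi>)
        \<le> (\<Sum>l<n. \<integral>z. ((\<Sum>j<m. b' l j * \<phi> j (fst z)) - p l (fst z))\<^sup>2 \<partial>\<pi>)"
    "V \<in> borel_measurable M" "\<And>\<omega>. 0 \<le> V \<omega>"
    "(\<integral>\<^sup>+\<omega>. ennreal (V \<omega>) \<partial>M) \<le> ennreal (2 * m * L / N + 4 * L * (m * exp (- ((1 - ln 2) * N / (2 * K)))))"
    "\<And>\<omega> a. \<omega> \<in> space M \<Longrightarrow>
       (\<And>j l. j < m \<Longrightarrow> l < n \<Longrightarrow> Av (\<lambda>z. \<phi> j (fst z) * (\<Sum>k<m. a l k * \<phi> k (fst z))) \<omega>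
            = Av (\<lambda>z. \<phi> j (fst z) * \<psi> l (snd z)) \<omega>) \<Longrightarrow>
       (\<Sum>l<n. Av (\<lambda>z. ((\<Sum>j<m. a l j * \<phi> j (fst z)) - p l (fst z))\<^sup>2) \<omega>)
       \<le> (\<Sum>l<n. Av (\<lambda>z. ((\<Sum>j<m. b l j * \<phi> j (fst z)) - p l (fst z))\<^sup>2) \<omega>) + V \<omega>"
proof -
  have fst_m: "(fst :: real \<times> real \<Rightarrow> real) \<in> borel_measurable borel"
    and snd_m: "(snd :: real \<times> real \<Rightarrow> real) \<in> borel_measurable borel"
    by (intro borel_measurable_continuous_onI continuous_on_fst continuous_on_snd continuous_on_id)+
  have f1: "bounded_borel (\<lambda>z :: real \<times> real. g (fst z))" if "bounded_borel g" for g :: "real \<Rightarrow> real"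
    by (rule bounded_borel_comp[OF that fst_m])
  have f2: "bounded_borel (\<lambda>z :: real \<times> real. g (snd z))" if "bounded_borel g" for g :: "real \<Rightarrow> real"
    by (rule bounded_borel_comp[OF that snd_m])
  let ?\<phi> = "\<lambda>j (z :: real \<times> real). \<phi> j (fst z)"
  obtain h where h: "\<And>j. j < m \<Longrightarrow> bounded_borel (h j)"
    and hg: "\<And>j. j < m \<Longrightarrow> \<exists>g. \<forall>z. h j z = (\<Sum>k<m. g k * ?\<phi> k z)"
    and on: "\<And>j l. j < m \<Longrightarrow> l < m \<Longrightarrow> (\<integral>z. h j z * h l z \<partial>\<pi>) = (if j = l then 1 else 0)"
    and sp: "\<And>d. \<exists>e. \<forall>z. (\<Sum>j<m. d j * ?\<phi> j z) = (\<Sum>j<m. e j * h j z)"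
    and hK: "\<And>z. (\<Sum>j<m. (h j z)\<^sup>2) \<le> K"
    by (rule whitened_basis[OF \<pi>_prob \<pi>_sets, of m ?\<phi> \<kappa> L\<phi> K]) (use \<phi>(1) f1 \<kappa> L\<phi> K in auto)
  obtain G where G: "\<And>j z. j < m \<Longrightarrow> h j z = (\<Sum>k<m. G j k * ?\<phi> k z)" using hg by metis
  obtain E where E: "\<And>d z. (\<Sum>j<m. d j * ?\<phi> j z) = (\<Sum>j<m. E d j * h j z)" using sp by metis
  have G_fst: "\<exists>g. bounded_borel g \<and> (\<forall>x. x \<notin> I \<longrightarrow> g x = 0) \<and> (\<forall>z. h j z = g (fst z))" if "j < m" for j
    using G[OF that] \<phi>(2)
    by (intro exI[of _ "\<lambda>x. \<Sum>k<m. G j k * \<phi> k x"] conjI bounded_borel_sum bounded_borel_cmult \<phi>(1)) auto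
  define e where "e l z = \<psi> l (snd z) - p l (fst z)" for l and z :: "real \<times> real"
  have e: "bounded_borel (e l)" if "l < n" for l
    unfolding e_def by (intro bounded_borel_diff f1 f2 \<psi> p that)
  have orth: "(\<integral>z. h j z * e l z \<partial>\<pi>) = 0" if jm: "j < m" and ln: "l < n" for j l
  proof -
    obtain g where g: "bounded_borel g" "\<And>z. h j z = g (fst z)" "\<And>x. x \<notin> I \<Longrightarrow> g x = 0" using G_fst[OF jm] by blast
    show ?thesis unfolding e_def g(2) by (rule cond[OF ln g(1) g(3)])
  qed
  have L0: "0 \<le> L" using L\<psi>[of 0] sum_nonneg[of "{..<n}" "\<lambda>l. (\<psi> l 0)\<^sup>2"] by simp
  have L: "(\<Sum>l<n. \<integral>z. (h j z * e l z)\<^sup>2 \<partial>\<pi>) \<le> L" if j: "j < m" for j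
  proof -
    obtain g where g: "bounded_borel g" "\<And>z. h j z = g (fst z)" "\<And>x. x \<notin> I \<Longrightarrow> g x = 0" using G_fst[OF j] by blast
    have h2: "bounded_borel (\<lambda>z. (h j z)\<^sup>2)" by (intro bounded_borel_power2 h j)
    have A: "bounded_borel (\<lambda>z. (h j z)\<^sup>2 * ((\<psi> l (snd z))\<^sup>2 - (p l (fst z))\<^sup>2))" if "l < n" for l
      by (intro bounded_borel_mult bounded_borel_diff bounded_borel_power2 h f1 f2 p \<psi> j that)
    have "(\<integral>z. (h j z * e l z)\<^sup>2 \<partial>\<pi>) = (\<integral>z. (h j z)\<^sup>2 * ((\<psi> l (snd z))\<^sup>2 - (p l (fst z))\<^sup>2) \<partial>\<pi>)"
      if l: "l < n" for l
    proof -
      have B: "bounded_borel (\<lambda>x. (g x)\<^sup>2 * p l x)" by (intro bounded_borel_mult bounded_borel_power2 g p l)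
      have B': "bounded_borel (\<lambda>z. (g (fst z))\<^sup>2 * p l (fst z) * (\<psi> l (snd z) - p l (fst z)))"
        using f1[OF B] by (intro bounded_borel_mult bounded_borel_diff bounded_borel_power2 f1 f2 g p \<psi> l)
      have "(\<integral>z. (h j z * e l z)\<^sup>2 \<partial>\<pi>) = (\<integral>z. (h j z)\<^sup>2 * ((\<psi> l (snd z))\<^sup>2 - (p l (fst z))\<^sup>2)
          - 2 * ((g (fst z))\<^sup>2 * p l (fst z) * (\<psi> l (snd z) - p l (fst z))) \<partial>\<pi>)"
        by (intro Bochner_Integration.integral_cong refl) (simp add: e_def g power2_eq_square algebra_simps)
      also have "\<dots> = (\<integral>z. (h j z)\<^sup>2 * ((\<psi> l (snd z))\<^sup>2 - (p l (fst z))\<^sup>2) \<partial>\<pi>)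
          - 2 * (\<integral>z. (g (fst z))\<^sup>2 * p l (fst z) * (\<psi> l (snd z) - p l (fst z)) \<partial>\<pi>)"
        using integrable_\<pi>[OF A[OF l]] integrable_\<pi>[OF B'] by simp
      also have "(\<integral>z. (g (fst z))\<^sup>2 * p l (fst z) * (\<psi> l (snd z) - p l (fst z)) \<partial>\<pi>) = 0"
        using cond[OF l B] g(3) by simp
      finally show ?thesis by simp
    qed
    then have "(\<Sum>l<n. \<integral>z. (h j z * e l z)\<^sup>2 \<partial>\<pi>)
        = (\<Sum>l<n. \<integral>z. (h j z)\<^sup>2 * ((\<psi> l (snd z))\<^sup>2 - (p l (fst z))\<^sup>2) \<partial>\<pi>)"
      by (intro sum.cong) auto
    also have "\<dots> = (\<integral>z. (\<Sum>l<n. (h j z)\<^sup>2 * ((\<psi> l (snd z))\<^sup>2 - (p l (fst z))\<^sup>2)) \<partial>\<pi>)"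
      by (intro Bochner_Integration.integral_sum[symmetric] integrable_\<pi> A) auto
    also have "\<dots> \<le> (\<integral>z. (h j z)\<^sup>2 * L \<partial>\<pi>)"
    proof (intro integral_mono integrable_\<pi> bounded_borel_sum A bounded_borel_mult h2 bounded_borel_const)
      fix z :: "real \<times> real"
      have "(\<Sum>l<n. (\<psi> l (snd z))\<^sup>2 - (p l (fst z))\<^sup>2) \<le> L"
        using L\<psi>[of "snd z"] sum_nonneg[of "{..<n}" "\<lambda>l. (p l (fst z))\<^sup>2"] by (simp add: sum_subtractf)
      then show "(\<Sum>l<n. (h j z)\<^sup>2 * ((\<psi> l (snd z))\<^sup>2 - (p l (fst z))\<^sup>2)) \<le> (h j z)\<^sup>2 * L"
        unfolding sum_distrib_left[symmetric] by (intro mult_left_mono) auto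
    qed auto
    also have "\<dots> = L" using on[OF j j] by (simp add: power2_eq_square)
    finally show ?thesis .
  qed
  have D: "(\<Sum>l<n. (e l z)\<^sup>2) \<le> 4 * L" for z
  proof -
    have "(\<Sum>l<n. (e l z)\<^sup>2) \<le> (\<Sum>l<n. 2 * (\<psi> l (snd z))\<^sup>2 + 2 * (p l (fst z))\<^sup>2)"
    proof (rule sum_mono)
      fix l show "(e l z)\<^sup>2 \<le> 2 * (\<psi> l (snd z))\<^sup>2 + 2 * (p l (fst z))\<^sup>2"
        using zero_le_power2[of "\<psi> l (snd z) + p l (fst z)"]
        unfolding e_def power2_diff power2_sum by linarith
    qed
    also have "\<dots> = 2 * (\<Sum>l<n. (\<psi> l (snd z))\<^sup>2) + 2 * (\<Sum>l<n. (p l (fst z))\<^sup>2)"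
      by (simp add: sum.distrib sum_distrib_left)
    finally show ?thesis using L\<psi>[of "snd z"] Lp[of "fst z"] by linarith
  qed
  obtain V where V: "V \<in> borel_measurable M" "\<And>\<omega>. 0 \<le> V \<omega>"
    "(\<integral>\<^sup>+\<omega>. ennreal (V \<omega>) \<partial>M) \<le> ennreal (2 * real m * L / N + 4 * L * (m * exp (- ((1 - ln 2) * N / (2 * K)))))"
    and Vd: "\<And>\<omega> d. \<omega> \<in> space M \<Longrightarrow> (\<Sum>l<n. 2 * Av (\<lambda>z. (\<Sum>j<m. d l j * h j z) * e l z) \<omega>
        - Av (\<lambda>z. (\<Sum>j<m. d l j * h j z)\<^sup>2) \<omega>) \<le> V \<omega>"
    using stochastic_term_bound[of m h K "{..<n}" e L "4 * L", OF h on hK K(2)] e orth L D L0 by auto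
  define c where "c l j = (\<integral>z. h j z * p l (fst z) \<partial>\<pi>)" for l j
  define b where "b l k = (\<Sum>j<m. c l j * G j k)" for l k
  have bh: "(\<Sum>k<m. b l k * ?\<phi> k z) = (\<Sum>j<m. c l j * h j z)" for l z
  proof -
    have "(\<Sum>k<m. b l k * ?\<phi> k z) = (\<Sum>k<m. \<Sum>j<m. c l j * G j k * ?\<phi> k z)"
      by (simp add: b_def sum_distrib_right)
    also have "\<dots> = (\<Sum>j<m. \<Sum>k<m. c l j * G j k * ?\<phi> k z)" by (rule sum.swap)
    finally show ?thesis by (simp add: G sum_distrib_left mult.assoc)
  qed
  have opt: "(\<Sum>l<n. \<integral>z. ((\<Sum>j<m. b l j * ?\<phi> j z) - p l (fst z))\<^sup>2 \<partial>\<pi>)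
        \<le> (\<Sum>l<n. \<integral>z. ((\<Sum>j<m. b' l j * ?\<phi> j z) - p l (fst z))\<^sup>2 \<partial>\<pi>)" for b'
  proof (rule sum_mono)
    fix l assume "l \<in> {..<n}"
    then have pl: "bounded_borel (\<lambda>z :: real \<times> real. p l (fst z))" by (intro f1 p) auto
    have F: "(\<integral>z. ((\<Sum>j<m. v j * h j z) - p l (fst z))\<^sup>2 \<partial>\<pi>)
        = (\<Sum>j<m. (v j - c l j)\<^sup>2) - (\<Sum>j<m. (c l j)\<^sup>2) + (\<integral>z. (p l (fst z))\<^sup>2 \<partial>\<pi>)" for v
      unfolding c_def by (rule integral_orthonormal_combination(3)[OF \<pi>_prob \<pi>_sets h on pl])
    show "(\<integral>z. ((\<Sum>j<m. b l j * ?\<phi> j z) - p l (fst z))\<^sup>2 \<partial>\<pi>)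
        \<le> (\<integral>z. ((\<Sum>j<m. b' l j * ?\<phi> j z) - p l (fst z))\<^sup>2 \<partial>\<pi>)"
      unfolding bh E[of "b' l"] F[of "c l"] F[of "E (b' l)"] by (simp add: sum_nonneg)
  qed
  have main: "(\<Sum>l<n. Av (\<lambda>z. ((\<Sum>j<m. a l j * ?\<phi> j z) - p l (fst z))\<^sup>2) \<omega>)
       \<le> (\<Sum>l<n. Av (\<lambda>z. ((\<Sum>j<m. b l j * ?\<phi> j z) - p l (fst z))\<^sup>2) \<omega>) + V \<omega>"
    if w: "\<omega> \<in> space M" and ne: "\<And>j l. j < m \<Longrightarrow> l < n \<Longrightarrow> Av (\<lambda>z. ?\<phi> j z * (\<Sum>k<m. a l k * ?\<phi> k z)) \<omega>
            = Av (\<lambda>z. ?\<phi> j z * \<psi> l (snd z)) \<omega>" for \<omega> a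
  proof -
    define dd where "dd l j = a l j - b l j" for l j
    define d where "d l = E (dd l)" for l
    have "(\<Sum>l<n. Av (\<lambda>z. ((\<Sum>j<m. a l j * ?\<phi> j z) - p l (fst z))\<^sup>2) \<omega>
         - Av (\<lambda>z. ((\<Sum>j<m. b l j * ?\<phi> j z) - p l (fst z))\<^sup>2) \<omega>)
       = (\<Sum>l<n. 2 * Av (\<lambda>z. (\<Sum>j<m. d l j * h j z) * e l z) \<omega> - Av (\<lambda>z. (\<Sum>j<m. d l j * h j z)\<^sup>2) \<omega>)"
    proof (rule sum.cong[OF refl])
      fix l assume "l \<in> {..<n}" then have l: "l < n" by simp
      let ?r = "\<lambda>z. \<Sum>j<m. a l j * ?\<phi> j z" and ?t = "\<lambda>z. \<Sum>j<m. b l j * ?\<phi> j z"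
        and ?g = "\<lambda>z. \<Sum>j<m. d l j * h j z" and ?p = "\<lambda>z :: real \<times> real. p l (fst z)"
      have gdd: "?g z = (\<Sum>j<m. dd l j * ?\<phi> j z)" for z by (simp add: d_def E)
      have grt: "?g z = ?r z - ?t z" for z unfolding gdd by (simp add: dd_def left_diff_distrib sum_subtractf)
      have bb: "bounded_borel (\<lambda>z. \<Sum>j<m. v j * ?\<phi> j z)" for v
        by (intro bounded_borel_sum bounded_borel_cmult f1 \<phi>(1)) auto
      have bg: "bounded_borel ?g" unfolding gdd by (rule bb)
      have bp: "bounded_borel ?p" by (intro f1 p l)
      have b\<psi>: "bounded_borel (\<lambda>z :: real \<times> real. \<psi> l (snd z))" by (intro f2 \<psi> l)
      have zero: "Av (\<lambda>z. ?g z * (?r z - \<psi> l (snd z))) \<omega> = 0"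
      proof -
        have "Av (\<lambda>z. ?g z * (?r z - \<psi> l (snd z))) \<omega>
            = Av (\<lambda>z. \<Sum>j<m. dd l j * (?\<phi> j z * ?r z - ?\<phi> j z * \<psi> l (snd z))) \<omega>"
          unfolding gdd by (simp add: sum_distrib_right right_diff_distrib mult.assoc sum_subtractf)
        also have "\<dots> = (\<Sum>j<m. Av (\<lambda>z. dd l j * (?\<phi> j z * ?r z - ?\<phi> j z * \<psi> l (snd z))) \<omega>)"
          using w by (intro Av_sum bounded_borel_cmult bounded_borel_diff bounded_borel_mult f1 \<phi>(1) bb b\<psi>) auto
        also have "\<dots> = 0"
        proof (intro sum.neutral ballI)
          fix j assume "j \<in> {..<m}" then have j: "j < m" by simp
          have B3: "bounded_borel (\<lambda>z. ?\<phi> j z * ?r z)" by (rule bounded_borel_mult[OF f1[OF \<phi>(1)[OF j]] bb])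
          have B4: "bounded_borel (\<lambda>z. ?\<phi> j z * \<psi> l (snd z))" by (rule bounded_borel_mult[OF f1[OF \<phi>(1)[OF j]] b\<psi>])
          show "Av (\<lambda>z. dd l j * (?\<phi> j z * ?r z - ?\<phi> j z * \<psi> l (snd z))) \<omega> = 0"
            unfolding Av_cmult Av_diff[OF B3 B4 w] using ne[OF j l] by simp
        qed
        finally show ?thesis .
      qed
      have B1: "bounded_borel (\<lambda>z. (?r z - ?p z)\<^sup>2)" "bounded_borel (\<lambda>z. (?t z - ?p z)\<^sup>2)"
        by (intro bounded_borel_power2 bounded_borel_diff bb bp)+
      have B2: "bounded_borel (\<lambda>z. ?g z * e l z)" "bounded_borel (\<lambda>z. (?g z)\<^sup>2)" "bounded_borel (\<lambda>z. ?g z * (?r z - \<psi> l (snd z)))"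
        by (intro bounded_borel_mult bounded_borel_power2 bounded_borel_diff bg e l bb b\<psi>)+
      have "Av (\<lambda>z. (?r z - ?p z)\<^sup>2) \<omega> - Av (\<lambda>z. (?t z - ?p z)\<^sup>2) \<omega> = Av (\<lambda>z. (?r z - ?p z)\<^sup>2 - (?t z - ?p z)\<^sup>2) \<omega>"
        by (rule Av_diff[symmetric]) (intro B1 w)+
      also have "\<dots> = Av (\<lambda>z. (2 * (?g z * e l z) - (?g z)\<^sup>2) + 2 * (?g z * (?r z - \<psi> l (snd z)))) \<omega>"
      proof -
        have "(?r z - ?p z)\<^sup>2 - (?t z - ?p z)\<^sup>2 = (2 * (?g z * e l z) - (?g z)\<^sup>2) + 2 * (?g z * (?r z - \<psi> l (snd z)))" for z
          unfolding grt e_def by (simp add: power2_eq_square algebra_simps)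
        then show ?thesis by presburger
      qed
      also have "\<dots> = 2 * Av (\<lambda>z. ?g z * e l z) \<omega> - Av (\<lambda>z. (?g z)\<^sup>2) \<omega> + 2 * Av (\<lambda>z. ?g z * (?r z - \<psi> l (snd z))) \<omega>"
        using B2 w by (simp add: Av_add Av_diff Av_cmult bounded_borel_diff bounded_borel_cmult)
      finally show "Av (\<lambda>z. (?r z - ?p z)\<^sup>2) \<omega> - Av (\<lambda>z. (?t z - ?p z)\<^sup>2) \<omega>
          = 2 * Av (\<lambda>z. ?g z * e l z) \<omega> - Av (\<lambda>z. (?g z)\<^sup>2) \<omega>"
        unfolding zero by simp
    qed
    also have "\<dots> \<le> V \<omega>" by (rule Vd[OF w])
    finally show ?thesis by (simp add: sum_subtractf)
  qed
  show ?thesis using that[OF opt V main] by blast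
qed

end

section \<open>The operator norm of an inverse matrix\<close>

lemma act_norm_bound: "dot n (act n D w) (act n D w) \<le> (\<Sum>i<n. \<Sum>k<n. (D i k)\<^sup>2) * dot n w w"
proof -
  have "dot n (act n D w) (act n D w) = (\<Sum>i<n. (dot n (D i) w)\<^sup>2)"
    by (simp add: dot_def act_def power2_eq_square)
  also have "\<dots> \<le> (\<Sum>i<n. dot n (D i) (D i) * dot n w w)" by (intro sum_mono dot_Cauchy_Schwarz)
  also have "\<dots> = (\<Sum>i<n. \<Sum>k<n. (D i k)\<^sup>2) * dot n w w"
    by (simp add: sum_distrib_right dot_def power2_eq_square)
  finally show ?thesis .
qed

lemma mult_mat_vec_index:
  assumes "A \<in> carrier_mat n n" "v \<in> carrier_vec n" "i < n"
  shows "(A *\<^sub>v v) $ i = (\<Sum>j<n. A $$ (i, j) * v $ j)"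
  using assms by (auto simp: scalar_prod_def atLeast0LessThan intro!: sum.cong)

text \<open>For a semidefinite form, \<open>|c v|^2 \<le> trace c * (v^T c v)\<close>, and an inverse controls \<open>v\<close> by \<open>c v\<close>.\<close>

lemma psd_singular_or_coercive:
  fixes C :: "real mat"
  assumes C: "C \<in> carrier_mat n n" and psd: "psd n c" and c: "\<And>i j. i < n \<Longrightarrow> j < n \<Longrightarrow> c i j = C $$ (i, j)"
    and nz: "det C \<noteq> 0"
  shows "\<exists>\<epsilon>>0. \<forall>v. \<epsilon> * dot n v v \<le> dot n v (act n c v)"
proof -
  obtain D where D: "D \<in> carrier_mat n n" "D * C = 1\<^sub>m n"
    using det_non_zero_imp_unit[OF C nz] by (auto simp: Units_def ring_mat_def)
  define dd where "dd i j = D $$ (i, j)" for i j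
  define C1 where "C1 = (\<Sum>i<n. \<Sum>k<n. (dd i k)\<^sup>2)"
  define R where "R = mtrace n c"
  have C10: "0 \<le> C1" unfolding C1_def by (intro sum_nonneg) auto
  have R0: "0 \<le> R" unfolding R_def by (rule mtrace_nonneg[OF psd])
  have inv: "act n dd (act n c v) i = v i" if i: "i < n" for v i
  proof -
    have "act n dd (act n c v) i = (\<Sum>k<n. \<Sum>j<n. D $$ (i, k) * C $$ (k, j) * v j)"
      using c by (simp add: act_def dd_def sum_distrib_left mult.assoc)
    also have "\<dots> = (\<Sum>j<n. \<Sum>k<n. D $$ (i, k) * C $$ (k, j) * v j)" by (rule sum.swap)
    also have "\<dots> = (\<Sum>j<n. (D * C) $$ (i, j) * v j)"
      using C D(1) i by (intro sum.cong refl) (simp add: scalar_prod_def atLeast0LessThan sum_distrib_right)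
    also have "\<dots> = (\<Sum>j<n. if j = i then v i else 0)" unfolding D(2) using i by (intro sum.cong) auto
    finally show ?thesis using i by simp
  qed
  have key: "dot n v v \<le> C1 * R * dot n v (act n c v)" for v
  proof -
    have "dot n v v = dot n (act n dd (act n c v)) (act n dd (act n c v))"
      unfolding dot_def using inv by (intro sum.cong) auto
    also have "\<dots> \<le> C1 * dot n (act n c v) (act n c v)" unfolding C1_def by (rule act_norm_bound)
    also have "dot n (act n c v) (act n c v) \<le> R * dot n v (act n c v)"
    proof -
      have up: "dot n w (act n c w) \<le> R * dot n w w" for w
        using quad_le_mtrace[OF psd, of w] by (simp add: R_def mult.commute)
      show ?thesis
        using mpow_quad_upper[OF psd up, of v "Suc 0"]
        by (simp add: act_mmul act_dot_symm[OF psd_symm[OF psd]] dot_mone)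
    qed
    finally show ?thesis using C10 by (simp add: mult_left_mono mult.assoc)
  qed
  show ?thesis
  proof (intro exI[of _ "1 / (C1 * R + 1)"] conjI allI)
    show "0 < 1 / (C1 * R + 1)" using C10 R0 by (simp add: add_nonneg_pos)
    fix v
    have "dot n v v \<le> (C1 * R + 1) * dot n v (act n c v)"
      using key[of v] psd_nonneg[OF psd, of v] by (simp add: algebra_simps)
    then show "1 / (C1 * R + 1) * dot n v v \<le> dot n v (act n c v)"
      using pos_divide_le_eq[of "C1 * R + 1" "dot n v v" "dot n v (act n c v)"] C10 R0
      by (simp add: add_nonneg_pos mult.commute)
  qed
qed

lemma inv_mat_inverse:
  fixes A :: "real mat"
  assumes A: "A \<in> carrier_mat n n" and inv: "invertible_mat A"
  shows "inv_mat A \<in> carrier_mat n n" "A * inv_mat A = 1\<^sub>m n" "inv_mat A * A = 1\<^sub>m n"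
proof -
  obtain B where B: "A * B = 1\<^sub>m n" "B * A = 1\<^sub>m (dim_row B)"
    using inv A by (auto simp: invertible_mat_def inverts_mat_def)
  have "dim_col (A * B) = n" "dim_col (B * A) = dim_row B" using B by auto
  then have Bc: "B \<in> carrier_mat n n" using A by (intro carrier_matI) auto
  then have "A \<in> Units (ring_mat TYPE(real) n ())"
    using A B by (auto simp: Units_def ring_mat_def)
  then obtain B' where "mat_inverse A = Some B'" using mat_inverse(1)[OF A] by fastforce
  then show "inv_mat A \<in> carrier_mat n n" "A * inv_mat A = 1\<^sub>m n" "inv_mat A * A = 1\<^sub>m n"
    using mat_inverse(2)[OF A] by (auto simp: inv_mat_def)
qed

text \<open>If \<open>lam\<close> is the least eigenvalue of the matrix, then \<open>1 / lam^2\<close> is in the spectrum of \<open>B * B^T\<close> for its inverse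
\<open>B\<close>, so the operator norm of \<open>B\<close>, defined through that spectrum, is at least \<open>1 / lam\<close>.\<close>

lemma quadratic_form_ge_op_norm_inverse:
  fixes A :: "real mat"
  assumes A: "A \<in> carrier_mat n n" and n: "0 < n" and inv: "invertible_mat A"
    and sym: "\<And>i j. i < n \<Longrightarrow> j < n \<Longrightarrow> A $$ (i, j) = A $$ (j, i)"
    and psd0: "\<And>v. 0 \<le> (\<Sum>i<n. \<Sum>j<n. v i * A $$ (i, j) * v j)"
  shows "(\<Sum>i<n. (d i)\<^sup>2) \<le> op_norm (inv_mat A) * (\<Sum>i<n. \<Sum>j<n. d i * A $$ (i, j) * d j)"
proof -
  define a where "a i j = (if i < n \<and> j < n then A $$ (i, j) else 0)" for i j
  have quad: "dot n v (act n a v) = (\<Sum>i<n. \<Sum>j<n. v i * A $$ (i, j) * v j)" for v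
    by (simp add: dot_def act_def a_def sum_distrib_left mult.assoc)
  have psda: "psd n a" unfolding psd_def symm_def quad using sym psd0 by (auto simp: a_def)
  \<comment> \<open>The infimum of the form on the unit sphere is an eigenvalue: otherwise \<open>A - lam\<close> would be
    positive semidefinite and nonsingular, hence coercive, and the infimum could be raised.\<close>
  define Q where "Q = {dot n v (act n a v) | v. dot n v v = 1}"
  define lam where "lam = Inf Q"
  have e0: "dot n (\<lambda>i. if i = 0 then 1 else 0) (\<lambda>i. if i = 0 then 1 else 0) = 1"
    using n by (simp add: dot_def if_distrib[of "\<lambda>x. x * _"] cong: if_cong)
  have Qne: "Q \<noteq> {}" using e0 unfolding Q_def by blast
  have Qb: "bdd_below Q" unfolding Q_def using psd_nonneg[OF psda] by (intro bdd_belowI[of _ 0]) auto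
  have lam_le: "lam * dot n v v \<le> dot n v (act n a v)" for v
  proof (cases "dot n v v = 0")
    case True
    then show ?thesis using psd_nonneg[OF psda, of v] by simp
  next
    case False
    then have p: "0 < dot n v v" using dot_self_nonneg[of n v] by simp
    define s where "s = 1 / sqrt (dot n v v)"
    have ss: "s * s * dot n v v = 1" using p by (simp add: s_def)
    let ?w = "\<lambda>i. s * v i"
    have w1: "dot n ?w ?w = s * s * dot n v v" by (simp add: dot_def sum_distrib_left mult_ac)
    have w2: "dot n ?w (act n a ?w) = s * s * dot n v (act n a v)"
      by (simp add: dot_def act_def sum_distrib_left mult_ac)
    have "lam \<le> s * s * dot n v (act n a v)"
      unfolding lam_def using w1 w2 ss by (intro cInf_lower Qb) (auto simp: Q_def intro!: exI[of _ ?w])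
    then have "lam * dot n v v \<le> s * s * dot n v (act n a v) * dot n v v"
      using p by (intro mult_right_mono) auto
    also have "\<dots> = (s * s * dot n v v) * dot n v (act n a v)" by simp
    finally show ?thesis unfolding ss by simp
  qed
  define C where "C = A - lam \<cdot>\<^sub>m 1\<^sub>m n"
  define c where "c = (\<lambda>i j. 1 * a i j + (- lam) * mone n i j)"
  have C: "C \<in> carrier_mat n n" using A unfolding C_def by (intro minus_carrier_mat) auto
  have cC: "c i j = C $$ (i, j)" if "i < n" "j < n" for i j
    using that A by (auto simp: c_def C_def a_def mone_def)
  have psdc: "psd n c"
  proof -
    have "symm n c" unfolding c_def by (intro symm_lin symm_mone psd_symm psda)
    moreover have "0 \<le> dot n v (act n c v)" for v
      unfolding c_def act_lin dot_lin_right dot_mone using lam_le[of v] by simp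
    ultimately show ?thesis by (simp add: psd_def)
  qed
  have "det C = 0"
  proof (rule ccontr)
    assume "det C \<noteq> 0"
    from psd_singular_or_coercive[OF C psdc cC this]
    obtain \<epsilon> where \<epsilon>: "\<epsilon> > 0" "\<And>v. \<epsilon> * dot n v v \<le> dot n v (act n c v)" by blast
    have "lam + \<epsilon> \<le> lam"
      unfolding lam_def[symmetric]
    proof (subst (2) lam_def, rule cInf_greatest[OF Qne])
      fix x assume "x \<in> Q"
      then obtain v where v: "x = dot n v (act n a v)" "dot n v v = 1" by (auto simp: Q_def)
      then show "lam + \<epsilon> \<le> x"
        using \<epsilon>(2)[of v] unfolding c_def act_lin dot_lin_right dot_mone by simp
    qed
    then show False using \<epsilon>(1) by simp
  qed
  then obtain v where v: "v \<in> carrier_vec n" "v \<noteq> 0\<^sub>v n" "C *\<^sub>v v = 0\<^sub>v n"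
    using det_0_iff_vec_prod_zero[OF C] by blast
  have Av: "A *\<^sub>v v = lam \<cdot>\<^sub>v v"
  proof (rule eq_vecI)
    fix i assume "i < dim_vec (lam \<cdot>\<^sub>v v)"
    then have i: "i < n" using v by simp
    have "0 = (\<Sum>j<n. C $$ (i, j) * v $ j)" using mult_mat_vec_index[OF C v(1) i] v(3) i by simp
    also have "\<dots> = (\<Sum>j<n. A $$ (i, j) * v $ j - (if j = i then lam * v $ i else 0))"
      using A i by (intro sum.cong refl) (auto simp: C_def algebra_simps)
    also have "\<dots> = (\<Sum>j<n. A $$ (i, j) * v $ j) - lam * v $ i" using i by (simp add: sum_subtractf)
    finally show "(A *\<^sub>v v) $ i = (lam \<cdot>\<^sub>v v) $ i"
      using mult_mat_vec_index[OF A v(1) i] i v by simp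
  qed (use A v in simp)
  define B where "B = inv_mat A"
  note B = inv_mat_inverse[OF A inv, folded B_def]
  have At: "transpose_mat A = A" using A sym by (intro eq_matI) auto
  have Bt: "transpose_mat B = B"
  proof -
    have tc: "transpose_mat B \<in> carrier_mat n n" using B by simp
    have "transpose_mat B * A = 1\<^sub>m n"
      using arg_cong[OF B(2), of transpose_mat] transpose_mult[OF A B(1)] At by simp
    then have "transpose_mat B * (A * B) = 1\<^sub>m n * B"
      using assoc_mult_mat[OF tc A B(1)] by simp
    then show ?thesis using B tc by simp
  qed
  have BAv: "v = lam \<cdot>\<^sub>v (B *\<^sub>v v)"
  proof -
    have "v = (B * A) *\<^sub>v v" using B v by simp
    also have "\<dots> = B *\<^sub>v (lam \<cdot>\<^sub>v v)" using assoc_mult_mat_vec[OF B(1) A v(1)] Av by simp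
    also have "\<dots> = lam \<cdot>\<^sub>v (B *\<^sub>v v)" using B v by (simp add: mult_mat_vec)
    finally show ?thesis .
  qed
  have lam0: "lam \<noteq> 0"
  proof
    assume l: "lam = 0"
    have Bvc: "B *\<^sub>v v \<in> carrier_vec n" using B(1) v(1) by simp
    have "v = 0\<^sub>v n"
    proof (rule eq_vecI)
      fix i assume i: "i < dim_vec (0\<^sub>v n :: real vec)"
      have "v $ i = (lam \<cdot>\<^sub>v (B *\<^sub>v v)) $ i" by (rule arg_cong[OF BAv, of "\<lambda>u. u $ i"])
      also have "\<dots> = 0" using l i carrier_vecD[OF Bvc] by simp
      finally show "v $ i = 0\<^sub>v n $ i" using i by simp
    qed (use v in simp)
    then show False using v by simp
  qed
  have lam_pos: "0 < lam"
  proof -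
    have "0 \<le> lam" unfolding lam_def
      using psd_nonneg[OF psda] by (intro cInf_greatest[OF Qne]) (auto simp: Q_def)
    then show ?thesis using lam0 by simp
  qed
  have Bv: "B *\<^sub>v v = (1 / lam) \<cdot>\<^sub>v v"
  proof -
    have "(1 / lam) \<cdot>\<^sub>v v = (1 / lam) \<cdot>\<^sub>v (lam \<cdot>\<^sub>v (B *\<^sub>v v))" by (rule arg_cong[OF BAv])
    also have "\<dots> = B *\<^sub>v v" using lam0 by (simp add: smult_smult_assoc)
    finally show ?thesis by simp
  qed
  have ev: "1 / lam\<^sup>2 \<in> spectrum (B * transpose_mat B)"
  proof -
    have "(B * B) *\<^sub>v v = B *\<^sub>v ((1 / lam) \<cdot>\<^sub>v v)" using B v Bv by simp
    also have "\<dots> = (1 / lam) \<cdot>\<^sub>v ((1 / lam) \<cdot>\<^sub>v v)" using B v Bv by (simp add: mult_mat_vec)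
    also have "\<dots> = (1 / lam\<^sup>2) \<cdot>\<^sub>v v" by (simp add: smult_smult_assoc power2_eq_square)
    finally have "eigenvector (B * transpose_mat B) v (1 / lam\<^sup>2)"
      using B v unfolding Bt by (simp add: eigenvector_def)
    then show ?thesis by (auto simp: spectrum_def eigenvalue_def)
  qed
  have fin: "finite (spectrum (B * transpose_mat B))"
    using B by (intro card_finite_spectrum(1)[of _ n]) simp
  have "1 / lam \<le> op_norm B"
  proof -
    have "1 / lam = sqrt (1 / lam\<^sup>2)" using lam_pos by (simp add: real_sqrt_divide)
    also have "\<dots> \<le> sqrt (Max (spectrum (B * transpose_mat B)))" using fin ev by simp
    finally show ?thesis by (simp add: op_norm_def)
  qed
  then have "dot n d d \<le> op_norm B * dot n d (act n a d)"
  proof -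
    have "dot n d d \<le> (1 / lam) * dot n d (act n a d)" using lam_le[of d] lam_pos by (simp add: field_simps)
    also have "\<dots> \<le> op_norm B * dot n d (act n a d)"
      using \<open>1 / lam \<le> op_norm B\<close> psd_nonneg[OF psda] by (intro mult_right_mono) auto
    finally show ?thesis .
  qed
  then show ?thesis unfolding quad B_def by (simp add: dot_def power2_eq_square)
qed

section \<open>Continuous processes and conditional densities\<close>

text \<open>A path on \<open>[0, S]\<close> composed with \<open>clip S\<close> is continuous on the whole line.\<close>

definition clip :: "real \<Rightarrow> real \<Rightarrow> real" where
  "clip S s = max 0 (min S s)"

lemma clip_in: "0 \<le> S \<Longrightarrow> clip S s \<in> {0..S}"
  by (auto simp: clip_def)

lemma clip_id: "s \<in> {0..S} \<Longrightarrow> clip S s = s"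
  by (auto simp: clip_def)

lemma continuous_clip: "continuous_on A (clip S)"
  unfolding clip_def by (intro continuous_intros)

text \<open>A continuous process is the pointwise limit of its values at times rounded down to multiples of \<open>1 / (k + 1)\<close>.\<close>

lemma continuous_process_jointly_measurable:
  fixes X :: "real \<Rightarrow> 'a \<Rightarrow> real"
  assumes S: "0 \<le> S" and X: "\<And>u. u \<in> {0..S} \<Longrightarrow> X u \<in> borel_measurable G"
    and cont: "\<And>\<omega>. \<omega> \<in> space G \<Longrightarrow> continuous_on {0..S} (\<lambda>u. X u \<omega>)"
  shows "(\<lambda>(s, \<omega>). X (clip S s) \<omega>) \<in> borel_measurable (borel \<Otimes>\<^sub>M G)"
proof (rule borel_measurable_LIMSEQ_real)
  fix k :: nat
  have "(\<lambda>z. (\<lambda>i z. X (clip S (real_of_int i / real (Suc k))) (snd z)) (\<lfloor>real (Suc k) * fst z\<rfloor>) z)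
      \<in> borel_measurable (borel \<Otimes>\<^sub>M G)"
  proof (rule measurable_compose_countable[where f = "\<lambda>i z. X (clip S (real_of_int i / real (Suc k))) (snd z)"
        and g = "\<lambda>z. \<lfloor>real (Suc k) * fst z\<rfloor>"])
    show "(\<lambda>z. X (clip S (real_of_int i / real (Suc k))) (snd z)) \<in> borel_measurable (borel \<Otimes>\<^sub>M G)" for i
      by (rule measurable_compose[OF measurable_snd X[OF clip_in[OF S]]])
    show "(\<lambda>z. \<lfloor>real (Suc k) * fst z\<rfloor>) \<in> measurable (borel \<Otimes>\<^sub>M G) (count_space UNIV)"
      by measurable
  qed
  then show "(\<lambda>z. X (clip S (real_of_int \<lfloor>real (Suc k) * fst z\<rfloor> / real (Suc k))) (snd z))
      \<in> borel_measurable (borel \<Otimes>\<^sub>M G)" .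
next
  fix z :: "real \<times> 'a" assume "z \<in> space (borel \<Otimes>\<^sub>M G)"
  then have w: "snd z \<in> space G" by (auto simp: space_pair_measure)
  let ?s = "fst z"
  have "(\<lambda>k. real_of_int \<lfloor>real (Suc k) * ?s\<rfloor> / real (Suc k)) \<longlonglongrightarrow> ?s"
  proof (rule LIMSEQ_I)
    fix e :: real assume e: "0 < e"
    obtain k0 where k0: "1 / e < real k0" using reals_Archimedean2 by blast
    show "\<exists>no. \<forall>k\<ge>no. norm (real_of_int \<lfloor>real (Suc k) * ?s\<rfloor> / real (Suc k) - ?s) < e"
    proof (intro exI allI impI)
      fix k assume "k0 \<le> k"
      then have k: "1 / e < real (Suc k)" using k0 by linarith
      then have 1: "1 / real (Suc k) < e" using e by (simp add: field_simps)
      have "\<bar>real_of_int \<lfloor>real (Suc k) * ?s\<rfloor> - real (Suc k) * ?s\<bar> \<le> 1"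
        by linarith
      then have "\<bar>real_of_int \<lfloor>real (Suc k) * ?s\<rfloor> - real (Suc k) * ?s\<bar> / real (Suc k) \<le> 1 / real (Suc k)"
        by (intro divide_right_mono) auto
      moreover have "\<bar>real_of_int \<lfloor>real (Suc k) * ?s\<rfloor> - real (Suc k) * ?s\<bar> / real (Suc k)
          = \<bar>real_of_int \<lfloor>real (Suc k) * ?s\<rfloor> / real (Suc k) - ?s\<bar>"
      proof -
        have "real_of_int \<lfloor>real (Suc k) * ?s\<rfloor> / real (Suc k) - ?s
            = (real_of_int \<lfloor>real (Suc k) * ?s\<rfloor> - real (Suc k) * ?s) / real (Suc k)"
          by (simp add: diff_divide_distrib)
        then show ?thesis by (simp only: abs_divide abs_of_nat)
      qed
      ultimately show "norm (real_of_int \<lfloor>real (Suc k) * ?s\<rfloor> / real (Suc k) - ?s) < e"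
        using 1 unfolding real_norm_def by linarith
    qed
  qed
  then have "(\<lambda>k. clip S (real_of_int \<lfloor>real (Suc k) * ?s\<rfloor> / real (Suc k))) \<longlonglongrightarrow> clip S ?s"
    by (rule continuous_on_tendsto_compose[OF continuous_clip[of UNIV]]) auto
  then have "(\<lambda>k. X (clip S (real_of_int \<lfloor>real (Suc k) * ?s\<rfloor> / real (Suc k))) (snd z)) \<longlonglongrightarrow> X (clip S ?s) (snd z)"
    by (rule continuous_on_tendsto_compose[OF cont[OF w]]) (use clip_in[OF S] in auto)
  then show "(\<lambda>k. X (clip S (real_of_int \<lfloor>real (Suc k) * fst z\<rfloor> / real (Suc k))) (snd z))
      \<longlonglongrightarrow> (case z of (s, \<omega>) \<Rightarrow> X (clip S s) \<omega>)"
    by (simp add: case_prod_unfold)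
qed

text \<open>Rectangles determine the joint law of \<open>(U, V)\<close>.\<close>

lemma nn_integral_conditional_density:
  fixes U V :: "'a \<Rightarrow> real" and r :: "real \<Rightarrow> real \<Rightarrow> real"
  assumes M: "prob_space M" and U[measurable]: "U \<in> borel_measurable M" and V[measurable]: "V \<in> borel_measurable M"
    and r[measurable]: "(\<lambda>(x, y). r x y) \<in> borel_measurable borel"
    and rect: "\<And>A B. A \<in> sets borel \<Longrightarrow> B \<in> sets borel \<Longrightarrow> emeasure M {\<omega>\<in>space M. U \<omega> \<in> A \<and> V \<omega> \<in> B} =
      (\<integral>\<^sup>+\<omega>. indicator A (U \<omega>) * (\<integral>\<^sup>+y\<in>B. ennreal (r (U \<omega>) y) \<partial>lborel) \<partial>M)"
    and H[measurable]: "H \<in> borel_measurable borel"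
  shows "(\<integral>\<^sup>+\<omega>. H (U \<omega>, V \<omega>) \<partial>M) = (\<integral>\<^sup>+\<omega>. (\<integral>\<^sup>+y. H (U \<omega>, y) * ennreal (r (U \<omega>) y) \<partial>lborel) \<partial>M)"
proof -
  interpret prob_space M by (rule M)
  have rp[measurable]: "(\<lambda>(x, y). ennreal (r x y)) \<in> borel_measurable (borel \<Otimes>\<^sub>M lborel)"
  proof -
    have "(\<lambda>z. ennreal (case z of (x, y) \<Rightarrow> r x y)) \<in> borel_measurable (borel :: (real \<times> real) measure)" by measurable
    then show ?thesis by (simp add: borel_prod[symmetric] case_prod_unfold cong: measurable_cong_sets)
  qed
  have Hp[measurable]: "H \<in> borel_measurable (borel \<Otimes>\<^sub>M lborel)" "H \<in> borel_measurable (borel \<Otimes>\<^sub>M borel)"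
    using H by (simp_all add: borel_prod[symmetric] cong: measurable_cong_sets)
  define m1 where "m1 = distr M (borel \<Otimes>\<^sub>M borel) (\<lambda>\<omega>. (U \<omega>, V \<omega>))"
  define Q where "Q = distr M borel U"
  define m2 where "m2 = density (Q \<Otimes>\<^sub>M lborel) (\<lambda>(x, y). ennreal (r x y))"
  have sQ: "sets (Q \<Otimes>\<^sub>M lborel) = sets (borel \<Otimes>\<^sub>M lborel)"
    by (intro sets_pair_measure_cong) (auto simp: Q_def)
  have mQ[measurable]: "f \<in> borel_measurable (Q \<Otimes>\<^sub>M lborel) \<longleftrightarrow> f \<in> borel_measurable (borel \<Otimes>\<^sub>M lborel)" for f :: "real \<times> real \<Rightarrow> ennreal"
    by (rule arg_cong[where f = "\<lambda>A. f \<in> A"], rule measurable_cong_sets[OF sQ refl])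
  have int2: "(\<integral>\<^sup>+z. G z \<partial>m2) = (\<integral>\<^sup>+\<omega>. (\<integral>\<^sup>+y. G (U \<omega>, y) * ennreal (r (U \<omega>) y) \<partial>lborel) \<partial>M)"
    if G[measurable]: "G \<in> borel_measurable (borel \<Otimes>\<^sub>M lborel)" for G
  proof -
    have "(\<integral>\<^sup>+z. G z \<partial>m2) = (\<integral>\<^sup>+z. (case z of (x, y) \<Rightarrow> ennreal (r x y)) * G z \<partial>(Q \<Otimes>\<^sub>M lborel))"
      unfolding m2_def by (rule nn_integral_density) (simp_all add: mQ)
    also have "\<dots> = (\<integral>\<^sup>+x. \<integral>\<^sup>+y. ennreal (r x y) * G (x, y) \<partial>lborel \<partial>Q)"
      by (subst lborel.nn_integral_fst[symmetric]) (simp_all add: mQ)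
    also have "\<dots> = (\<integral>\<^sup>+\<omega>. (\<integral>\<^sup>+y. ennreal (r (U \<omega>) y) * G (U \<omega>, y) \<partial>lborel) \<partial>M)"
      unfolding Q_def by (subst nn_integral_distr) measurable
    finally show ?thesis by (simp add: mult.commute)
  qed
  have "m1 = m2"
  proof (rule measure_eqI_generator_eq[where E = "{a \<times> b | a b. a \<in> sets borel \<and> b \<in> sets borel}"
        and \<Omega> = UNIV and A = "\<lambda>_. UNIV"])
    show "Int_stable {a \<times> b | a b. a \<in> sets (borel :: real measure) \<and> b \<in> sets (borel :: real measure)}"
      by (rule Int_stable_pair_measure_generator)
    show "sets m1 = sigma_sets UNIV {a \<times> b | a b. a \<in> sets borel \<and> b \<in> sets borel}"
      unfolding m1_def sets_distr sets_pair_measure by simp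
    show "sets m2 = sigma_sets UNIV {a \<times> b | a b. a \<in> sets borel \<and> b \<in> sets borel}"
    proof -
      have "sets m2 = sets (borel \<Otimes>\<^sub>M lborel)" unfolding m2_def sets_density by (rule sQ)
      also have "\<dots> = sets ((borel :: real measure) \<Otimes>\<^sub>M (borel :: real measure))"
        by (intro sets_pair_measure_cong) auto
      finally show ?thesis unfolding sets_pair_measure by simp
    qed
    fix D assume "D \<in> {a \<times> b | a b. a \<in> sets (borel :: real measure) \<and> b \<in> sets (borel :: real measure)}"
    then obtain A B where D: "D = A \<times> B" and A[measurable]: "A \<in> sets borel" and B[measurable]: "B \<in> sets borel" by auto
    have "emeasure m1 D = emeasure M {\<omega>\<in>space M. U \<omega> \<in> A \<and> V \<omega> \<in> B}"
      unfolding m1_def D by (subst emeasure_distr) (auto intro!: arg_cong[where f = "emeasure M"])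
    also have "\<dots> = (\<integral>\<^sup>+\<omega>. indicator A (U \<omega>) * (\<integral>\<^sup>+y\<in>B. ennreal (r (U \<omega>) y) \<partial>lborel) \<partial>M)"
      by (rule rect[OF A B])
    also have "\<dots> = (\<integral>\<^sup>+\<omega>. (\<integral>\<^sup>+y. indicator D (U \<omega>, y) * ennreal (r (U \<omega>) y) \<partial>lborel) \<partial>M)"
      by (intro nn_integral_cong) (auto simp: D indicator_def mult.commute intro!: nn_integral_cong split: if_splits)
    also have "\<dots> = (\<integral>\<^sup>+z. indicator D z \<partial>m2)"
      by (rule int2[symmetric]) (auto simp: D intro!: borel_measurable_indicator pair_measureI)
    also have "\<dots> = emeasure m2 D"
    proof (rule nn_integral_indicator)
      show "D \<in> sets m2" unfolding m2_def sets_density sQ D by (intro pair_measureI) auto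
    qed
    finally show "emeasure m1 D = emeasure m2 D" .
  next
    show "emeasure m1 UNIV \<noteq> \<infinity>"
    proof -
      have "prob_space m1" unfolding m1_def by (rule prob_space_distr) measurable
      moreover have "space m1 = UNIV" by (simp add: m1_def space_pair_measure)
      ultimately show ?thesis using prob_space.emeasure_space_1[of m1] by simp
    qed
  qed (auto intro!: exI[of _ UNIV])
  then have "(\<integral>\<^sup>+z. H z \<partial>m1) = (\<integral>\<^sup>+z. H z \<partial>m2)" by simp
  also have "(\<integral>\<^sup>+z. H z \<partial>m1) = (\<integral>\<^sup>+\<omega>. H (U \<omega>, V \<omega>) \<partial>M)"
    unfolding m1_def by (subst nn_integral_distr) measurable
  finally show ?thesis using int2[OF Hp(1)] by simp
qed

lemma strong_solution_regular:
  assumes "strong_solution M S b \<sigma> x0 W X"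
  shows "prob_space M" "\<And>t. t \<in> {0..S} \<Longrightarrow> X t \<in> borel_measurable M"
    "\<And>\<omega>. \<omega> \<in> space M \<Longrightarrow> continuous_on {0..S} (\<lambda>t. X t \<omega>)"
proof -
  have bm: "brownian_motion M S W" using assms by (simp add: strong_solution_def)
  then show "prob_space M" by (simp add: brownian_motion_def)
  show "continuous_on {0..S} (\<lambda>t. X t \<omega>)" if "\<omega> \<in> space M" for \<omega>
    using assms that by (simp add: strong_solution_def)
  fix t assume t: "t \<in> {0..S}"
  have "natural_events M W t \<union> null_sets M \<subseteq> sets M"
    using bm t by (auto simp: natural_events_def brownian_motion_def intro!: measurable_sets)
  then have sub: "natural_events M W t \<union> null_sets M \<subseteq> sets M" .
  then have "natural_events M W t \<union> null_sets M \<subseteq> Pow (space M)" using sets.space_closed[of M] by blast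
  then have "sets (augmented_filtration M W t) = sigma_sets (space M) (natural_events M W t \<union> null_sets M)"
    "space (augmented_filtration M W t) = space M"
    unfolding augmented_filtration_def by (simp_all add: sets_measure_of space_measure_of)
  then have "subalgebra M (augmented_filtration M W t)"
    unfolding subalgebra_def using sets.sigma_sets_subset[OF sub] by simp
  moreover have "X t \<in> borel_measurable (augmented_filtration M W t)"
    using assms t by (simp add: strong_solution_def)
  ultimately show "X t \<in> borel_measurable M" by (rule measurable_from_subalg)
qed

text \<open>At time \<open>0\<close> all partition points of an elementary process coincide, so its integral is zero, and so is the
Ito integral.\<close>

lemma strong_solution_initial:
  assumes sol: "strong_solution M S b \<sigma> x0 W X" and S: "0 \<le> S"
  shows "AE \<omega> in M. X 0 \<omega> = x0"
proof -
  have "has_ito_integral M W (\<lambda>s \<omega>. \<sigma> (X s \<omega>)) 0 (\<lambda>\<omega>. X 0 \<omega> - x0 - (LBINT s:{0..0}. b (X s \<omega>)))"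
  proof -
    have "\<forall>t\<in>{0..S}. has_ito_integral M W (\<lambda>s \<omega>. \<sigma> (X s \<omega>)) t
        (\<lambda>\<omega>. X t \<omega> - x0 - (LBINT s:{0..t}. b (X s \<omega>)))"
      using sol by (simp add: strong_solution_def)
    from bspec[OF this, of 0] show ?thesis using S by simp
  qed
  moreover have "(LBINT s:{0..0::real}. b (X s \<omega>)) = 0" for \<omega>
    unfolding set_lebesgue_integral_def
    by (rule integral_eq_zero_AE, rule AE_mp[OF AE_lborel_singleton[of "0::real"]]) (auto simp: indicator_def)
  ultimately have "has_ito_integral M W (\<lambda>s \<omega>. \<sigma> (X s \<omega>)) 0 (\<lambda>\<omega>. X 0 \<omega> - x0)" by simp
  then obtain n u \<xi> where Z: "(\<lambda>\<omega>. X 0 \<omega> - x0) \<in> borel_measurable M"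
    and el: "\<And>k. elementary_process (augmented_filtration M W) 0 (n k) (u k) (\<xi> k)"
    and lim: "(\<lambda>k. \<integral>\<^sup>+\<omega>. ennreal ((elementary_integral W (n k) (u k) (\<xi> k) \<omega> - (X 0 \<omega> - x0))\<^sup>2) \<partial>M) \<longlonglongrightarrow> 0"
    unfolding has_ito_integral_def by blast
  have u0: "u k j = 0" if "j \<le> n k" for k j
  proof -
    have up: "u k i \<le> u k (i + d)" if "i + d \<le> n k" for i d
      using that
    proof (induction d)
      case (Suc d)
      have "u k (i + d) \<le> u k (Suc (i + d))" using el[of k] Suc.prems by (simp add: elementary_process_def)
      then show ?case using Suc by simp
    qed simp
    have "u k 0 \<le> u k j" "u k j \<le> u k (n k)" using up[of 0 j] up[of j "n k - j"] that by auto
    then show ?thesis using el[of k] by (simp add: elementary_process_def)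
  qed
  have "elementary_integral W (n k) (u k) (\<xi> k) \<omega> = 0" for k \<omega>
    unfolding elementary_integral_def using u0 by (intro sum.neutral) auto
  then have "(\<integral>\<^sup>+\<omega>. ennreal ((X 0 \<omega> - x0)\<^sup>2) \<partial>M) = 0"
    using lim LIMSEQ_unique[OF tendsto_const] by (simp add: power2_commute)
  then have "AE \<omega> in M. ennreal ((X 0 \<omega> - x0)\<^sup>2) = 0"
    using Z by (subst (asm) nn_integral_0_iff_AE) auto
  then show ?thesis by (rule AE_mp) (auto simp: ennreal_eq_0_iff)
qed

section \<open>Occupation measures\<close>

definition time_unif :: "real \<Rightarrow> real measure" where
  "time_unif T = uniform_measure lborel {0..T}"

lemma sets_time_unif[measurable_cong]: "sets (time_unif T) = sets borel"
  by (simp add: time_unif_def)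

lemma prob_space_time_unif: "0 < T \<Longrightarrow> prob_space (time_unif T)"
  unfolding time_unif_def by (intro prob_space_uniform_measure) auto

lemma nn_integral_time_unif:
  assumes "0 < T" "f \<in> borel_measurable borel"
  shows "(\<integral>\<^sup>+s. f s \<partial>time_unif T) = ennreal (1 / T) * (\<integral>\<^sup>+s\<in>{0..T}. f s \<partial>lborel)"
proof -
  have "(\<integral>\<^sup>+s. f s \<partial>time_unif T) = (\<integral>\<^sup>+s\<in>{0..T}. f s \<partial>lborel) / ennreal T"
    unfolding time_unif_def using assms by (subst nn_integral_uniform_measure) auto
  then show ?thesis using assms(1)
    by (simp add: divide_ennreal_def inverse_ennreal mult.commute inverse_eq_divide)
qed

lemma integral_time_unif:
  fixes f :: "real \<Rightarrow> real"
  assumes "0 < T" "f \<in> borel_measurable borel"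
  shows "(\<integral>s. f s \<partial>time_unif T) = (1 / T) * (LBINT s:{0..T}. f s)"
proof -
  have "time_unif T = density lborel (\<lambda>s. ennreal (indicator {0..T} s / T))"
    unfolding time_unif_def uniform_measure_def using assms(1)
    by (intro arg_cong[where f = "density lborel"] ext) (auto simp: indicator_def divide_ennreal[symmetric] ennreal_1)
  then have "(\<integral>s. f s \<partial>time_unif T) = (\<integral>s. (indicator {0..T} s / T) *\<^sub>R f s \<partial>lborel)"
    using assms by (simp add: integral_density)
  also have "\<dots> = (\<integral>s. (1 / T) * (indicator {0..T} s *\<^sub>R f s) \<partial>lborel)" by simp
  finally show ?thesis by (simp only: integral_mult_right_zero set_lebesgue_integral_def)
qed

text \<open>The law of \<open>(X s, X (s + t))\<close> for a fixed outcome and a uniformly distributed time \<open>s \<in> [0, T]\<close>.\<close>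

definition occ :: "(real \<Rightarrow> 'a \<Rightarrow> real) \<Rightarrow> real \<Rightarrow> real \<Rightarrow> 'a \<Rightarrow> (real \<times> real) measure" where
  "occ X T t \<omega> = distr (time_unif T) borel (\<lambda>s. (X (clip (2 * T) s) \<omega>, X (clip (2 * T) (s + t)) \<omega>))"

text \<open>The same law with the outcome drawn at random as well.\<close>

definition mean_occ :: "'a measure \<Rightarrow> (real \<Rightarrow> 'a \<Rightarrow> real) \<Rightarrow> real \<Rightarrow> real \<Rightarrow> (real \<times> real) measure" where
  "mean_occ M X T t = distr (time_unif T \<Otimes>\<^sub>M M) borel
     (\<lambda>z. (X (clip (2 * T) (fst z)) (snd z), X (clip (2 * T) (fst z + t)) (snd z)))"

lemma clipped_path_measurable:
  assumes "0 < T" "continuous_on {0..2 * T} (\<lambda>u. X u \<omega>)"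
  shows "(\<lambda>s. X (clip (2 * T) s) \<omega>) \<in> borel_measurable borel"
proof (rule borel_measurable_continuous_onI)
  show "continuous_on UNIV (\<lambda>s. X (clip (2 * T) s) \<omega>)"
    by (rule continuous_on_compose2[OF assms(2) continuous_clip]) (use assms(1) clip_in in auto)
qed

lemma occ_basic:
  assumes T: "0 < T" and cont: "continuous_on {0..2 * T} (\<lambda>u. X u \<omega>)"
  shows "prob_space (occ X T t \<omega>)" "sets (occ X T t \<omega>) = sets borel"
    "H \<in> borel_measurable borel \<Longrightarrow> (\<integral>\<^sup>+z. H z \<partial>occ X T t \<omega>)
        = (\<integral>\<^sup>+s. H (X (clip (2 * T) s) \<omega>, X (clip (2 * T) (s + t)) \<omega>) \<partial>time_unif T)"
    "G \<in> borel_measurable borel \<Longrightarrow> (\<integral>z. G z \<partial>occ X T t \<omega>)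
        = (\<integral>s. (G (X (clip (2 * T) s) \<omega>, X (clip (2 * T) (s + t)) \<omega>) :: real) \<partial>time_unif T)"
proof -
  have m1[measurable]: "(\<lambda>s. X (clip (2 * T) s) \<omega>) \<in> borel_measurable borel"
    by (rule clipped_path_measurable[where X = X, OF T cont])
  have m2[measurable]: "(\<lambda>s. X (clip (2 * T) (s + t)) \<omega>) \<in> borel_measurable borel"
    by (rule measurable_compose[OF _ m1]) measurable
  have m: "(\<lambda>s. (X (clip (2 * T) s) \<omega>, X (clip (2 * T) (s + t)) \<omega>)) \<in> measurable (time_unif T) borel"
    unfolding borel_prod[symmetric] by measurable
  show "prob_space (occ X T t \<omega>)" unfolding occ_def by (rule prob_space.prob_space_distr[OF prob_space_time_unif[OF T] m])
  show "sets (occ X T t \<omega>) = sets borel" by (simp add: occ_def)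
  show "H \<in> borel_measurable borel \<Longrightarrow> (\<integral>\<^sup>+z. H z \<partial>occ X T t \<omega>)
        = (\<integral>\<^sup>+s. H (X (clip (2 * T) s) \<omega>, X (clip (2 * T) (s + t)) \<omega>) \<partial>time_unif T)"
    unfolding occ_def by (rule nn_integral_distr[OF m]) simp
  show "G \<in> borel_measurable borel \<Longrightarrow> (\<integral>z. G z \<partial>occ X T t \<omega>)
        = (\<integral>s. (G (X (clip (2 * T) s) \<omega>, X (clip (2 * T) (s + t)) \<omega>) :: real) \<partial>time_unif T)"
    unfolding occ_def by (rule integral_distr[OF m]) simp
qed

lemma pair_process_measurable:
  fixes X :: "real \<Rightarrow> 'a \<Rightarrow> real"
  assumes T: "0 < T" and X: "\<And>u. u \<in> {0..2 * T} \<Longrightarrow> X u \<in> borel_measurable G"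
    and cont: "\<And>\<omega>. \<omega> \<in> space G \<Longrightarrow> continuous_on {0..2 * T} (\<lambda>u. X u \<omega>)"
  shows "(\<lambda>z. (X (clip (2 * T) (fst z)) (snd z), X (clip (2 * T) (fst z + t)) (snd z)))
      \<in> measurable (time_unif T \<Otimes>\<^sub>M G) borel"
proof -
  have J: "(\<lambda>(s, \<omega>). X (clip (2 * T) s) \<omega>) \<in> borel_measurable (borel \<Otimes>\<^sub>M G)"
    by (rule continuous_process_jointly_measurable) (use T X cont in auto)
  have e: "measurable (time_unif T \<Otimes>\<^sub>M G) N = measurable (borel \<Otimes>\<^sub>M G) N" for N :: "'b measure"
    by (rule measurable_cong_sets[OF sets_pair_measure_cong[OF sets_time_unif refl] refl])
  have 1: "(\<lambda>z. X (clip (2 * T) (fst z)) (snd z)) \<in> borel_measurable (borel \<Otimes>\<^sub>M G)"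
    using J by (simp add: case_prod_unfold)
  have "(\<lambda>z :: real \<times> 'a. (fst z + t, snd z)) \<in> measurable (borel \<Otimes>\<^sub>M G) (borel \<Otimes>\<^sub>M G)" by measurable
  from measurable_compose[OF this J]
  have 2: "(\<lambda>z. X (clip (2 * T) (fst z + t)) (snd z)) \<in> borel_measurable (borel \<Otimes>\<^sub>M G)"
    by (simp add: case_prod_unfold)
  show ?thesis unfolding measurable_cong_sets[OF sets_pair_measure_cong[OF sets_time_unif refl] refl] borel_prod[symmetric]
    using 1 2 by (rule measurable_Pair)
qed

lemma occ_nn_measurable:
  fixes X :: "real \<Rightarrow> 'a \<Rightarrow> real"
  assumes T: "0 < T" and X: "\<And>u. u \<in> {0..2 * T} \<Longrightarrow> X u \<in> borel_measurable G"
    and cont: "\<And>\<omega>. \<omega> \<in> space G \<Longrightarrow> continuous_on {0..2 * T} (\<lambda>u. X u \<omega>)"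
    and H: "H \<in> borel_measurable borel"
  shows "(\<lambda>\<omega>. \<integral>\<^sup>+z. H z \<partial>occ X T t \<omega>) \<in> borel_measurable G"
proof -
  interpret U: prob_space "time_unif T" by (rule prob_space_time_unif[OF T])
  have "(\<lambda>p. (snd p, fst p)) \<in> measurable (G \<Otimes>\<^sub>M time_unif T) (time_unif T \<Otimes>\<^sub>M G)" by measurable
  from measurable_compose[OF measurable_compose[OF this pair_process_measurable[OF T X cont]] H]
  have "(\<lambda>p. H (X (clip (2 * T) (snd p)) (fst p), X (clip (2 * T) (snd p + t)) (fst p))) \<in> borel_measurable (G \<Otimes>\<^sub>M time_unif T)"
    by simp
  then have "(\<lambda>\<omega>. \<integral>\<^sup>+s. H (X (clip (2 * T) s) \<omega>, X (clip (2 * T) (s + t)) \<omega>) \<partial>time_unif T) \<in> borel_measurable G"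
    using U.borel_measurable_nn_integral_fst by fastforce
  then show ?thesis
    by (subst measurable_cong[OF occ_basic(3)[where X = X, OF T cont H]]) auto
qed

lemma mean_occ_basic:
  assumes T: "0 < T" and M: "prob_space M" and X: "\<And>u. u \<in> {0..2 * T} \<Longrightarrow> X u \<in> borel_measurable M"
    and cont: "\<And>\<omega>. \<omega> \<in> space M \<Longrightarrow> continuous_on {0..2 * T} (\<lambda>u. X u \<omega>)"
  shows "prob_space (mean_occ M X T t)" "sets (mean_occ M X T t) = sets borel"
    "H \<in> borel_measurable borel \<Longrightarrow> (\<integral>\<^sup>+z. H z \<partial>mean_occ M X T t)
        = (\<integral>\<^sup>+s. (\<integral>\<^sup>+\<omega>. H (X (clip (2 * T) s) \<omega>, X (clip (2 * T) (s + t)) \<omega>) \<partial>M) \<partial>time_unif T)"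
proof -
  interpret U: prob_space "time_unif T" by (rule prob_space_time_unif[OF T])
  interpret M: prob_space M by (rule M)
  interpret P: pair_prob_space "time_unif T" M ..
  note m = pair_process_measurable[where X = X and t = t, OF T X cont]
  show "prob_space (mean_occ M X T t)" unfolding mean_occ_def by (rule P.prob_space_distr[OF m])
  show "sets (mean_occ M X T t) = sets borel" by (simp add: mean_occ_def)
  assume H: "H \<in> borel_measurable borel"
  have "(\<integral>\<^sup>+z. H z \<partial>mean_occ M X T t) = (\<integral>\<^sup>+z. H (X (clip (2 * T) (fst z)) (snd z), X (clip (2 * T) (fst z + t)) (snd z)) \<partial>(time_unif T \<Otimes>\<^sub>M M))"
    unfolding mean_occ_def using H by (subst nn_integral_distr[OF m]) simp_all
  also have "\<dots> = (\<integral>\<^sup>+s. (\<integral>\<^sup>+\<omega>. H (X (clip (2 * T) s) \<omega>, X (clip (2 * T) (s + t)) \<omega>) \<partial>M) \<partial>time_unif T)"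
    using M.nn_integral_fst[OF measurable_compose[OF m H]] by simp
  finally show "(\<integral>\<^sup>+z. H z \<partial>mean_occ M X T t)
        = (\<integral>\<^sup>+s. (\<integral>\<^sup>+\<omega>. H (X (clip (2 * T) s) \<omega>, X (clip (2 * T) (s + t)) \<omega>) \<partial>M) \<partial>time_unif T)" .
qed

lemma path_measurable:
  assumes "\<And>u. u \<in> {0..S} \<Longrightarrow> X u \<in> borel_measurable M"
  shows "path S X \<in> measurable M (path_space S)"
  unfolding path_def using assms by (intro measurable_restrict) auto

lemma nn_integral_pair_same_law:
  assumes X: "\<And>u. u \<in> {0..S} \<Longrightarrow> X u \<in> borel_measurable M" and X': "\<And>u. u \<in> {0..S} \<Longrightarrow> X' u \<in> borel_measurable M'"
    and law: "distr M (path_space S) (path S X) = distr M' (path_space S) (path S X')"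
    and uv: "u \<in> {0..S}" "v \<in> {0..S}" and H: "H \<in> borel_measurable borel"
  shows "(\<integral>\<^sup>+\<omega>. H (X u \<omega>, X v \<omega>) \<partial>M) = (\<integral>\<^sup>+\<omega>. H (X' u \<omega>, X' v \<omega>) \<partial>M')"
proof -
  have ev: "(\<lambda>w. (w u, w v)) \<in> measurable (path_space S) borel"
    unfolding borel_prod[symmetric] using uv by (intro measurable_Pair measurable_component_singleton)
  have e: "(\<integral>\<^sup>+w. H (w u, w v) \<partial>distr P (path_space S) (path S Y)) = (\<integral>\<^sup>+\<omega>. H (Y u \<omega>, Y v \<omega>) \<partial>P)"
    if "\<And>u. u \<in> {0..S} \<Longrightarrow> Y u \<in> borel_measurable P" for P :: "'c measure" and Y
    using measurable_compose[OF ev H] uv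
    by (subst nn_integral_distr[OF path_measurable[OF that]]) (auto simp: path_def)
  show ?thesis using e[of X M, OF X] e[of X' M', OF X'] law by simp
qed

text \<open>The \<open>\<sigma>\<close>-algebra of a copy is the one generated by its path. The mean of an occupation measure involves only
the laws of pairs of values, which agree with those of the reference process.\<close>

lemma independent_copies_random_measures:
  assumes T: "0 < T" and N: "0 < N" and sol: "strong_solution M0 (2 * T) b \<sigma> x0 W X"
    and copies: "independent_copies M0 X (2 * T) b \<sigma> x0 N M Ws Xs"
  shows "indep_random_measures M N (\<lambda>i. vimage_algebra (space M) (path (2 * T) (Xs i)) (path_space (2 * T)))
     (\<lambda>i. occ (Xs i) T t) (mean_occ M0 X T t)"
proof -
  interpret M: prob_space M using copies by (simp add: independent_copies_def)
  note reg0 = strong_solution_regular[OF sol]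
  have soli: "strong_solution M (2 * T) b \<sigma> x0 (Ws i) (Xs i)" if "i \<in> {1..N}" for i
    using copies that by (simp add: independent_copies_def)
  note reg = strong_solution_regular[OF soli]
  interpret U: prob_space "time_unif T" by (rule prob_space_time_unif[OF T])
  let ?S = "2 * T"
  let ?F = "\<lambda>i. vimage_algebra (space M) (path ?S (Xs i)) (path_space ?S)"
  have pm: "path ?S (Xs i) \<in> measurable M (path_space ?S)" if "i \<in> {1..N}" for i
    by (rule path_measurable[OF reg(2)[OF that]])
  have pf: "path ?S (Xs i) \<in> space M \<rightarrow> space (path_space ?S)" if "i \<in> {1..N}" for i
    using measurable_space[OF pm[OF that]] by auto
  have XF: "Xs i u \<in> borel_measurable (?F i)" if i: "i \<in> {1..N}" and u: "u \<in> {0..?S}" for i u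
  proof -
    have "(\<lambda>\<omega>. path ?S (Xs i) \<omega> u) \<in> borel_measurable (?F i)"
      by (rule measurable_compose[OF measurable_vimage_algebra1[OF pf[OF i]] measurable_component_singleton[OF u]])
    then show ?thesis using u by (simp add: path_def)
  qed
  show ?thesis
  proof (intro indep_random_measures.intro indep_random_measures_axioms.intro M.prob_space_axioms N)
    show "prob_space (mean_occ M0 X T t)" "sets (mean_occ M0 X T t) = sets borel"
      by (rule mean_occ_basic[OF T reg0]; simp)+
  next
    fix i assume i: "i \<in> {1..N}"
    show "space (?F i) = space M" by simp
    fix \<omega> assume w: "\<omega> \<in> space M"
    show "prob_space (occ (Xs i) T t \<omega>)" "sets (occ (Xs i) T t \<omega>) = sets borel"
      by (rule occ_basic[where X = "Xs i" and \<omega> = \<omega>, OF T reg(3)[OF i w]])+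
  next
    have "M.indep_sets (\<lambda>i. {path ?S (Xs i) -` A \<inter> space M | A. A \<in> sets (path_space ?S)}) {1..N}"
      using copies by (simp add: independent_copies_def M.indep_vars_def2)
    then show "M.indep_sets (\<lambda>i. sets (?F i)) {1..N}"
      by (rule M.indep_sets_mono_sets) (use sets_vimage_algebra2[OF pf] in auto)
  next
    fix i and H :: "real \<times> real \<Rightarrow> ennreal" assume i: "i \<in> {1..N}" and H: "H \<in> borel_measurable borel"
    show "(\<lambda>\<omega>. \<integral>\<^sup>+z. H z \<partial>occ (Xs i) T t \<omega>) \<in> borel_measurable (?F i)"
      by (rule occ_nn_measurable[OF T XF[OF i] _ H]) (use reg(3)[OF i] in auto)
    have "(\<integral>\<^sup>+\<omega>. \<integral>\<^sup>+z. H z \<partial>occ (Xs i) T t \<omega> \<partial>M)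
        = (\<integral>\<^sup>+\<omega>. (\<integral>\<^sup>+s. H (Xs i (clip ?S s) \<omega>, Xs i (clip ?S (s + t)) \<omega>) \<partial>time_unif T) \<partial>M)"
      by (intro nn_integral_cong occ_basic(3)[where X = "Xs i", OF T reg(3)[OF i] H])
    also have "\<dots> = (\<integral>\<^sup>+s. (\<integral>\<^sup>+\<omega>. H (Xs i (clip ?S s) \<omega>, Xs i (clip ?S (s + t)) \<omega>) \<partial>M) \<partial>time_unif T)"
    proof -
      interpret P: pair_sigma_finite "time_unif T" M ..
      show ?thesis
        using P.Fubini[OF measurable_compose[OF pair_process_measurable[where X = "Xs i" and t = t, OF T reg(2)[OF i] reg(3)[OF i]] H]]
        by simp
    qed
    also have "\<dots> = (\<integral>\<^sup>+s. (\<integral>\<^sup>+\<omega>. H (X (clip ?S s) \<omega>, X (clip ?S (s + t)) \<omega>) \<partial>M0) \<partial>time_unif T)"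
    proof (intro nn_integral_cong)
      fix s
      show "(\<integral>\<^sup>+\<omega>. H (Xs i (clip ?S s) \<omega>, Xs i (clip ?S (s + t)) \<omega>) \<partial>M) = (\<integral>\<^sup>+\<omega>. H (X (clip ?S s) \<omega>, X (clip ?S (s + t)) \<omega>) \<partial>M0)"
      proof (rule nn_integral_pair_same_law[OF reg(2)[OF i] reg0(2)])
        show "distr M (path_space ?S) (path ?S (Xs i)) = distr M0 (path_space ?S) (path ?S X)"
          using copies i by (simp add: independent_copies_def)
      qed (use clip_in[of ?S] T H in auto)
    qed
    also have "\<dots> = (\<integral>\<^sup>+z. H z \<partial>mean_occ M0 X T t)"
      by (rule mean_occ_basic(3)[OF T reg0 H, symmetric])
    finally show "(\<integral>\<^sup>+\<omega>. \<integral>\<^sup>+z. H z \<partial>occ (Xs i) T t \<omega> \<partial>M) = (\<integral>\<^sup>+z. H z \<partial>mean_occ M0 X T t)" .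
  qed
qed

section \<open>The mean occupation measure and the transition density\<close>

text \<open>The conditional law of \<open>X (s + t)\<close> given \<open>X s = x\<close>, for \<open>r = p t\<close>.\<close>

definition kern :: "(real \<Rightarrow> real \<Rightarrow> real) \<Rightarrow> real \<Rightarrow> real measure" where
  "kern r x = density lborel (\<lambda>y. ennreal (r x y))"

lemma kern_basic:
  assumes r: "(\<lambda>(x, y). r x y) \<in> borel_measurable borel" and nn: "\<And>y. 0 \<le> r x y"
    and one: "(\<integral>\<^sup>+y. ennreal (r x y) \<partial>lborel) = 1"
  shows "prob_space (kern r x)" "sets (kern r x) = sets borel"
    "H \<in> borel_measurable borel \<Longrightarrow> (\<integral>\<^sup>+y. H y \<partial>kern r x) = (\<integral>\<^sup>+y. H y * ennreal (r x y) \<partial>lborel)"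
    "\<psi> \<in> borel_measurable borel \<Longrightarrow> (\<integral>y. \<psi> y \<partial>kern r x) = (\<integral>y. r x y * (\<psi> y :: real) \<partial>lborel)"
    "r x \<in> borel_measurable borel"
proof -
  have "(\<lambda>y. (x, y)) \<in> measurable borel (borel :: (real \<times> real) measure)"
    by (intro borel_measurable_continuous_onI continuous_intros)
  from measurable_compose[OF this r] show m[measurable]: "r x \<in> borel_measurable borel" by simp
  show "sets (kern r x) = sets borel" by (simp add: kern_def)
  show "prob_space (kern r x)"
    unfolding kern_def by (rule prob_spaceI) (simp add: emeasure_density one)
  show "H \<in> borel_measurable borel \<Longrightarrow> (\<integral>\<^sup>+y. H y \<partial>kern r x) = (\<integral>\<^sup>+y. H y * ennreal (r x y) \<partial>lborel)"
    unfolding kern_def by (subst nn_integral_density) (auto simp: mult.commute)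
  show "\<psi> \<in> borel_measurable borel \<Longrightarrow> (\<integral>y. \<psi> y \<partial>kern r x) = (\<integral>y. r x y * (\<psi> y :: real) \<partial>lborel)"
    unfolding kern_def using nn by (subst integral_density) auto
qed

lemma kern_integral_bounded_borel:
  assumes r: "(\<lambda>(x, y). r x y) \<in> borel_measurable borel" and nn: "\<And>x y. 0 \<le> r x y"
    and one: "\<And>x. (\<integral>\<^sup>+y. ennreal (r x y) \<partial>lborel) = 1" and \<psi>: "bounded_borel \<psi>"
  shows "bounded_borel (\<lambda>x. \<integral>y. \<psi> y \<partial>kern r x)"
proof -
  note k = kern_basic[OF r nn one]
  obtain B where B: "\<And>y. \<bar>\<psi> y\<bar> \<le> B" using \<psi> by (auto simp: bounded_borel_def)
  have \<psi>m[measurable]: "\<psi> \<in> borel_measurable borel" using \<psi> by (simp add: bounded_borel_def)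
  show ?thesis
  proof (rule bounded_borelI)
    have [measurable]: "(\<lambda>z. r (fst z) (snd z)) \<in> borel_measurable (borel \<Otimes>\<^sub>M lborel)"
      using r by (simp add: borel_prod[symmetric] case_prod_unfold cong: measurable_cong_sets)
    have "(\<lambda>x. \<integral>y. r x y * \<psi> y \<partial>lborel) \<in> borel_measurable borel"
      by (rule lborel.borel_measurable_lebesgue_integral) (simp add: case_prod_unfold)
    then show "(\<lambda>x. \<integral>y. \<psi> y \<partial>kern r x) \<in> borel_measurable borel" by (simp add: k(4))
    fix x
    interpret K: prob_space "kern r x" by (rule k(1))
    have int: "integrable (kern r x) \<psi>" by (rule bounded_borel_integrable[OF k(1) \<psi> k(2)])
    have "\<bar>\<integral>y. \<psi> y \<partial>kern r x\<bar> \<le> (\<integral>y. \<bar>\<psi> y\<bar> \<partial>kern r x)" by (rule integral_abs_bound)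
    also have "\<dots> \<le> (\<integral>y. B \<partial>kern r x)" using int B by (intro integral_mono) auto
    finally show "\<bar>\<integral>y. \<psi> y \<partial>kern r x\<bar> \<le> B" by (simp add: K.prob_space)
  qed
qed

lemma kern_sum_squares_le:
  assumes r: "(\<lambda>(x, y). r x y) \<in> borel_measurable borel" and nn: "\<And>x y. 0 \<le> r x y"
    and one: "\<And>x. (\<integral>\<^sup>+y. ennreal (r x y) \<partial>lborel) = 1" and \<psi>: "\<And>l. l < n \<Longrightarrow> bounded_borel (\<psi> l)"
    and L: "\<And>y. (\<Sum>l<n. (\<psi> l y)\<^sup>2) \<le> L"
  shows "(\<Sum>l<n. (\<integral>y. \<psi> l y \<partial>kern r x)\<^sup>2) \<le> L"
proof -
  note k = kern_basic[OF r nn one]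
  interpret K: prob_space "kern r x" by (rule k(1))
  have int: "integrable (kern r x) G" if "bounded_borel G" for G :: "real \<Rightarrow> real"
    by (rule bounded_borel_integrable[OF k(1) that k(2)])
  have "(\<Sum>l<n. (\<integral>y. \<psi> l y \<partial>kern r x)\<^sup>2) \<le> (\<Sum>l<n. \<integral>y. (\<psi> l y)\<^sup>2 \<partial>kern r x)"
    by (intro sum_mono K.integral_power2_le int bounded_borel_power2 \<psi>) auto
  also have "\<dots> = (\<integral>y. (\<Sum>l<n. (\<psi> l y)\<^sup>2) \<partial>kern r x)"
    by (intro Bochner_Integration.integral_sum[symmetric] int bounded_borel_power2 \<psi>) auto
  also have "\<dots> \<le> (\<integral>y. L \<partial>kern r x)"
    by (intro integral_mono int bounded_borel_sum bounded_borel_power2 \<psi> bounded_borel_const L) auto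
  finally show ?thesis by (simp add: K.prob_space)
qed

lemma transition_density_slice:
  assumes td: "transition_density M X T p" and t: "t \<in> {0<..T}"
  shows "(\<lambda>(x, y). p t x y) \<in> borel_measurable borel" "\<And>x y. 0 \<le> p t x y"
    "\<And>x. (\<integral>\<^sup>+y. ennreal (p t x y) \<partial>lborel) = 1"
    "(\<lambda>(s, x). indicator {0<..T} s * p s x0 x) \<in> borel_measurable borel"
proof -
  have m: "(\<lambda>(t, x, y). indicator {0<..T} t * p t x y) \<in> borel_measurable borel"
    using td by (simp add: transition_density_def)
  have "(\<lambda>z. (t, z)) \<in> measurable (borel :: (real \<times> real) measure) (borel :: (real \<times> real \<times> real) measure)"
    by (intro borel_measurable_continuous_onI continuous_intros)
  from measurable_compose[OF this m] show "(\<lambda>(x, y). p t x y) \<in> borel_measurable borel"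
    using t by (simp add: case_prod_unfold)
  have "(\<lambda>z. (fst z, x0, snd z)) \<in> measurable (borel :: (real \<times> real) measure) (borel :: (real \<times> real \<times> real) measure)"
    by (intro borel_measurable_continuous_onI continuous_intros)
  from measurable_compose[OF this m] show "(\<lambda>(s, x). indicator {0<..T} s * p s x0 x) \<in> borel_measurable borel"
    by (simp add: case_prod_unfold)
  show "\<And>x y. 0 \<le> p t x y" "\<And>x. (\<integral>\<^sup>+y. ennreal (p t x y) \<partial>lborel) = 1"
    using td t by (auto simp: transition_density_def)
qed

lemma transition_nn_integral:
  assumes td: "transition_density M X T p" and t: "t \<in> {0<..T}" and s: "0 \<le> s" "s + t \<le> 2 * T"
    and M: "prob_space M" and X: "\<And>u. u \<in> {0..2 * T} \<Longrightarrow> X u \<in> borel_measurable M"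
    and H: "H \<in> borel_measurable borel"
  shows "(\<integral>\<^sup>+\<omega>. H (X s \<omega>, X (s + t) \<omega>) \<partial>M) = (\<integral>\<^sup>+\<omega>. (\<integral>\<^sup>+y. H (X s \<omega>, y) * ennreal (p t (X s \<omega>) y) \<partial>lborel) \<partial>M)"
proof (rule nn_integral_conditional_density[OF M _ _ transition_density_slice(1)[OF td t] _ H])
  show "X s \<in> borel_measurable M" "X (s + t) \<in> borel_measurable M" using s t by (auto intro!: X)
  show "emeasure M {\<omega>\<in>space M. X s \<omega> \<in> A \<and> X (s + t) \<omega> \<in> B} =
      (\<integral>\<^sup>+\<omega>. indicator A (X s \<omega>) * (\<integral>\<^sup>+y\<in>B. ennreal (p t (X s \<omega>) y) \<partial>lborel) \<partial>M)"
    if "A \<in> sets borel" "B \<in> sets borel" for A B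
    using td t s that by (auto simp: transition_density_def)
qed

lemma AE_time_unif:
  assumes "0 < T" "\<And>s. 0 < s \<Longrightarrow> s \<le> T \<Longrightarrow> P s"
  shows "AE s in time_unif T. P s"
  unfolding time_unif_def
  by (rule AE_uniform_measureI, simp, rule AE_mp[OF AE_lborel_singleton[of 0]]) (use assms in auto)

lemma mean_density_nonneg:
  assumes td: "transition_density M X T p" and T: "0 < T"
  shows "0 \<le> mean_density p x0 T x"
  unfolding mean_density_def set_lebesgue_integral_def
  using T transition_density_slice(2)[OF td]
  by (intro mult_nonneg_nonneg integral_nonneg_AE) (auto simp: indicator_def)

lemma mean_density_measurable:
  assumes td: "transition_density M X T p" and T: "0 < T"
  shows "mean_density p x0 T \<in> borel_measurable borel"
proof -
  have m: "(\<lambda>(s, x). indicator {0<..T} s * p s x0 x) \<in> borel_measurable borel"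
    by (rule transition_density_slice(4)[OF td, of T]) (use T in simp)
  have "(\<lambda>z :: real \<times> real. (snd z, fst z)) \<in> measurable borel borel"
    by (intro borel_measurable_continuous_onI continuous_intros)
  from measurable_compose[OF this m]
  have [measurable]: "(\<lambda>z. indicator {0<..T} (snd z) * p (snd z) x0 (fst z)) \<in> borel_measurable (borel \<Otimes>\<^sub>M lborel)"
    by (simp add: borel_prod[symmetric] case_prod_unfold cong: measurable_cong_sets)
  have "(\<lambda>x. \<integral>s. indicator {0<..T} s * p s x0 x \<partial>lborel) \<in> borel_measurable borel"
    by (rule lborel.borel_measurable_lebesgue_integral) (simp add: case_prod_unfold)
  then show ?thesis unfolding mean_density_def set_lebesgue_integral_def by simp
qed

text \<open>At every time \<open>s \<in> (0, T]\<close> the law of \<open>X s\<close> has the density \<open>p s x0\<close>, because \<open>X 0 = x0\<close> almost surely. The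
densities are averaged over \<open>s\<close>; where their integral diverges, on a null set, the Bochner integral in
\<open>mean_density\<close> is zero by convention.\<close>

lemma mean_occ_first_marginal:
  assumes sol: "strong_solution M (2 * T) b \<sigma> x0 W X" and td: "transition_density M X T p" and T: "0 < T"
    and g: "g \<in> borel_measurable borel"
  shows "(\<integral>\<^sup>+z. g (fst z) \<partial>mean_occ M X T t) = (\<integral>\<^sup>+x. g x * ennreal (mean_density p x0 T x) \<partial>lborel)"
proof -
  note reg = strong_solution_regular[OF sol]
  interpret M: prob_space M by (rule reg(1))
  have fst_m: "(fst :: real \<times> real \<Rightarrow> real) \<in> borel_measurable borel"
    and snd_m: "(snd :: real \<times> real \<Rightarrow> real) \<in> borel_measurable borel"
    by (intro borel_measurable_continuous_onI continuous_on_fst continuous_on_snd continuous_on_id)+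
  have gf: "(\<lambda>z :: real \<times> real. g (fst z)) \<in> borel_measurable borel" by (rule measurable_compose[OF fst_m g])
  have gs: "(\<lambda>z :: real \<times> real. g (snd z)) \<in> borel_measurable borel" by (rule measurable_compose[OF snd_m g])
  have m: "(\<lambda>(s, x). indicator {0<..T} s * p s x0 x) \<in> borel_measurable borel"
    by (rule transition_density_slice(4)[OF td, of T]) (use T in simp)
  define q where "q s x = indicator {0<..T} s * p s x0 x" for s x
  have qm[measurable]: "(\<lambda>z. q (fst z) (snd z)) \<in> borel_measurable (lborel \<Otimes>\<^sub>M lborel)"
    using m by (simp add: borel_prod[symmetric] case_prod_unfold q_def cong: measurable_cong_sets)
  have qm'[measurable]: "(\<lambda>z. q (snd z) (fst z)) \<in> borel_measurable (lborel \<Otimes>\<^sub>M lborel)"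
  proof -
    have "(\<lambda>z :: real \<times> real. (snd z, fst z)) \<in> measurable (lborel \<Otimes>\<^sub>M lborel) (lborel \<Otimes>\<^sub>M lborel)" by measurable
    from measurable_compose[OF this qm] show ?thesis by simp
  qed
  have q0: "0 \<le> q s x" for s x
    using transition_density_slice(2)[OF td, of s x0 x] by (simp add: q_def indicator_def)
  note g[measurable]
  have law: "(\<integral>\<^sup>+\<omega>. g (X s \<omega>) \<partial>M) = (\<integral>\<^sup>+x. g x * ennreal (q s x) \<partial>lborel)" if s: "0 < s" "s \<le> T" for s
  proof -
    have "(\<integral>\<^sup>+\<omega>. g (X s \<omega>) \<partial>M) = (\<integral>\<^sup>+\<omega>. (\<integral>\<^sup>+y. g y * ennreal (p s (X 0 \<omega>) y) \<partial>lborel) \<partial>M)"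
      using transition_nn_integral[OF td _ _ _ reg(1,2) gs, of s 0] s T by simp
    also have "\<dots> = (\<integral>\<^sup>+\<omega>. (\<integral>\<^sup>+y. g y * ennreal (q s y) \<partial>lborel) \<partial>M)"
      by (rule nn_integral_cong_AE, rule AE_mp[OF strong_solution_initial[OF sol]]) (use s T in \<open>auto simp: q_def\<close>)
    also have "\<dots> = (\<integral>\<^sup>+x. g x * ennreal (q s x) \<partial>lborel)" by (simp add: M.emeasure_space_1)
    finally show ?thesis .
  qed
  define D where "D x = (\<integral>\<^sup>+s. ennreal (q s x) \<partial>lborel)" for x
  have swap: "(\<integral>\<^sup>+s. (\<integral>\<^sup>+x. G x * ennreal (q s x) \<partial>lborel) \<partial>lborel) = (\<integral>\<^sup>+x. G x * D x \<partial>lborel)"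
    if [measurable]: "G \<in> borel_measurable borel" for G
  proof -
    have "(\<integral>\<^sup>+s. (\<integral>\<^sup>+x. G x * ennreal (q s x) \<partial>lborel) \<partial>lborel) = (\<integral>\<^sup>+x. (\<integral>\<^sup>+s. G x * ennreal (q s x) \<partial>lborel) \<partial>lborel)"
      by (rule lborel_pair.Fubini') (simp add: case_prod_unfold)
    also have "\<dots> = (\<integral>\<^sup>+x. G x * D x \<partial>lborel)"
      unfolding D_def
    proof (intro nn_integral_cong nn_integral_cmult)
      fix x :: real
      have "(\<lambda>s. (s, x)) \<in> measurable lborel (lborel \<Otimes>\<^sub>M lborel)" by measurable
      from measurable_compose[OF this qm] show "(\<lambda>s. ennreal (q s x)) \<in> borel_measurable lborel" by simp
    qed
    finally show ?thesis .
  qed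
  have Dm[measurable]: "D \<in> borel_measurable borel"
  proof -
    have "(\<lambda>x. \<integral>\<^sup>+s. ennreal (q s x) \<partial>lborel) \<in> borel_measurable lborel"
      by (rule lborel.borel_measurable_nn_integral) (simp add: case_prod_unfold)
    then show ?thesis by (simp add: D_def[abs_def])
  qed
  have "(\<integral>\<^sup>+x. 1 * D x \<partial>lborel) = (\<integral>\<^sup>+s. (\<integral>\<^sup>+x. 1 * ennreal (q s x) \<partial>lborel) \<partial>lborel)"
    by (rule swap[symmetric]) simp
  also have "\<dots> = (\<integral>\<^sup>+s. indicator {0<..T} s \<partial>lborel)"
  proof (intro nn_integral_cong)
    fix s
    show "(\<integral>\<^sup>+x. 1 * ennreal (q s x) \<partial>lborel) = indicator {0<..T} s"
      using transition_density_slice(3)[OF td, of s x0] by (auto simp: q_def indicator_def)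
  qed
  also have "\<dots> = ennreal T" using T by simp
  finally have "(\<integral>\<^sup>+x. D x \<partial>lborel) \<noteq> \<infinity>" by simp
  then have Dfin: "AE x in lborel. D x \<noteq> \<infinity>" by (intro nn_integral_PInf_AE) auto
  have f: "ennreal (mean_density p x0 T x) = ennreal (1 / T) * D x" if "D x \<noteq> \<infinity>" for x
  proof -
    have "(\<lambda>s. (s, x)) \<in> measurable lborel (lborel \<Otimes>\<^sub>M lborel)" by measurable
    from measurable_compose[OF this qm] have qx: "(\<lambda>s. q s x) \<in> borel_measurable lborel" by simp
    have "(LBINT s:{0<..T}. p s x0 x) = (\<integral>s. q s x \<partial>lborel)"
      by (simp add: set_lebesgue_integral_def q_def)
    also have "\<dots> = enn2real (D x)" unfolding D_def using qx q0 by (intro integral_eq_nn_integral) auto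
    finally have "mean_density p x0 T x = (1 / T) * enn2real (D x)" by (simp add: mean_density_def)
    then show ?thesis using that T by (simp add: ennreal_mult' ennreal_enn2real_if del: times_divide_eq_left)
  qed
  have "(\<integral>\<^sup>+z. g (fst z) \<partial>mean_occ M X T t) = (\<integral>\<^sup>+s. (\<integral>\<^sup>+\<omega>. g (X (clip (2 * T) s) \<omega>) \<partial>M) \<partial>time_unif T)"
    using mean_occ_basic(3)[where X = X and t = t, OF T reg gf] by simp
  also have "\<dots> = (\<integral>\<^sup>+s. (\<integral>\<^sup>+x. g x * ennreal (q s x) \<partial>lborel) \<partial>time_unif T)"
    by (intro nn_integral_cong_AE AE_time_unif T) (use law T in \<open>simp add: clip_id\<close>)
  also have "\<dots> = ennreal (1 / T) * (\<integral>\<^sup>+s\<in>{0..T}. (\<integral>\<^sup>+x. g x * ennreal (q s x) \<partial>lborel) \<partial>lborel)"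
  proof (rule nn_integral_time_unif[OF T])
    have "(\<lambda>s. \<integral>\<^sup>+x. g x * ennreal (q s x) \<partial>lborel) \<in> borel_measurable lborel"
      by (rule lborel.borel_measurable_nn_integral) (simp add: case_prod_unfold)
    then show "(\<lambda>s. \<integral>\<^sup>+x. g x * ennreal (q s x) \<partial>lborel) \<in> borel_measurable borel" by simp
  qed
  also have "(\<integral>\<^sup>+s\<in>{0..T}. (\<integral>\<^sup>+x. g x * ennreal (q s x) \<partial>lborel) \<partial>lborel) = (\<integral>\<^sup>+s. (\<integral>\<^sup>+x. g x * ennreal (q s x) \<partial>lborel) \<partial>lborel)"
    by (intro nn_integral_cong) (auto simp: q_def indicator_def)
  also have "\<dots> = (\<integral>\<^sup>+x. g x * D x \<partial>lborel)" by (rule swap[OF g])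
  also have "ennreal (1 / T) * \<dots> = (\<integral>\<^sup>+x. ennreal (1 / T) * (g x * D x) \<partial>lborel)"
    by (rule nn_integral_cmult[symmetric]) simp
  also have "\<dots> = (\<integral>\<^sup>+x. g x * ennreal (mean_density p x0 T x) \<partial>lborel)"
    by (rule nn_integral_cong_AE, rule AE_mp[OF Dfin]) (auto simp: f mult_ac)
  finally show ?thesis .
qed

lemma mean_occ_disintegration:
  assumes sol: "strong_solution M (2 * T) b \<sigma> x0 W X" and td: "transition_density M X T p" and T: "0 < T"
    and t: "t \<in> {0<..T}" and H: "H \<in> borel_measurable borel"
  shows "(\<integral>\<^sup>+z. H z \<partial>mean_occ M X T t)
    = (\<integral>\<^sup>+z. (\<integral>\<^sup>+y. H (fst z, y) * ennreal (p t (fst z) y) \<partial>lborel) \<partial>mean_occ M X T t)"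
proof -
  note reg = strong_solution_regular[OF sol]
  have pm[measurable]: "(\<lambda>z. p t (fst z) (snd z)) \<in> borel_measurable (borel \<Otimes>\<^sub>M lborel)"
    using transition_density_slice(1)[OF td t] by (simp add: borel_prod[symmetric] case_prod_unfold cong: measurable_cong_sets)
  have Hm[measurable]: "H \<in> borel_measurable (borel \<Otimes>\<^sub>M lborel)"
    using H by (simp add: borel_prod[symmetric] cong: measurable_cong_sets)
  have "(\<lambda>x. \<integral>\<^sup>+y. H (x, y) * ennreal (p t x y) \<partial>lborel) \<in> borel_measurable borel"
    by (rule lborel.borel_measurable_nn_integral) (simp add: case_prod_unfold)
  moreover have "(fst :: real \<times> real \<Rightarrow> real) \<in> borel_measurable borel"
    by (intro borel_measurable_continuous_onI continuous_on_fst continuous_on_id)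
  ultimately have H': "(\<lambda>z :: real \<times> real. \<integral>\<^sup>+y. H (fst z, y) * ennreal (p t (fst z) y) \<partial>lborel) \<in> borel_measurable borel"
    by (rule measurable_compose[rotated])
  have "(\<integral>\<^sup>+z. H z \<partial>mean_occ M X T t)
      = (\<integral>\<^sup>+s. (\<integral>\<^sup>+\<omega>. H (X (clip (2 * T) s) \<omega>, X (clip (2 * T) (s + t)) \<omega>) \<partial>M) \<partial>time_unif T)"
    by (rule mean_occ_basic(3)[where X = X and t = t, OF T reg H])
  also have "\<dots> = (\<integral>\<^sup>+s. (\<integral>\<^sup>+\<omega>. (\<integral>\<^sup>+y. H (X (clip (2 * T) s) \<omega>, y) * ennreal (p t (X (clip (2 * T) s) \<omega>) y) \<partial>lborel) \<partial>M) \<partial>time_unif T)"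
  proof (rule nn_integral_cong_AE, rule AE_time_unif[OF T])
    fix s assume s: "0 < s" "s \<le> T"
    then have "clip (2 * T) s = s" "clip (2 * T) (s + t) = s + t" using t by (auto intro!: clip_id)
    then show "(\<integral>\<^sup>+\<omega>. H (X (clip (2 * T) s) \<omega>, X (clip (2 * T) (s + t)) \<omega>) \<partial>M)
        = (\<integral>\<^sup>+\<omega>. (\<integral>\<^sup>+y. H (X (clip (2 * T) s) \<omega>, y) * ennreal (p t (X (clip (2 * T) s) \<omega>) y) \<partial>lborel) \<partial>M)"
      using transition_nn_integral[OF td t _ _ reg(1,2) H, of s] s t by simp
  qed
  also have "\<dots> = (\<integral>\<^sup>+z. (\<integral>\<^sup>+y. H (fst z, y) * ennreal (p t (fst z) y) \<partial>lborel) \<partial>mean_occ M X T t)"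
    using mean_occ_basic(3)[where X = X and t = t, OF T reg H'] by simp
  finally show ?thesis .
qed

text \<open>The kernel does not depend on the time \<open>s\<close>, so it survives the averaging over \<open>s\<close>.\<close>

lemma mean_occ_conditional_mean:
  assumes sol: "strong_solution M (2 * T) b \<sigma> x0 W X" and td: "transition_density M X T p" and T: "0 < T"
    and t: "t \<in> {0<..T}" and g: "bounded_borel g" and \<psi>: "bounded_borel \<psi>"
  shows "(\<integral>z. g (fst z) * \<psi> (snd z) \<partial>mean_occ M X T t) = (\<integral>z. g (fst z) * (\<integral>y. \<psi> y \<partial>kern (p t) (fst z)) \<partial>mean_occ M X T t)"
proof -
  note reg = strong_solution_regular[OF sol]
  note sl = transition_density_slice[OF td t]
  note k = kern_basic[OF sl(1,2,3)]
  let ?\<pi> = "mean_occ M X T t" and ?P = "\<lambda>x. \<integral>y. \<psi> y \<partial>kern (p t) x"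
  have P: "prob_space ?\<pi>" "sets ?\<pi> = sets borel" by (rule mean_occ_basic[where X = X, OF T reg]; simp)+
  interpret P: prob_space ?\<pi> by (rule P(1))
  have fst_m: "(fst :: real \<times> real \<Rightarrow> real) \<in> borel_measurable borel"
    and snd_m: "(snd :: real \<times> real \<Rightarrow> real) \<in> borel_measurable borel"
    by (intro borel_measurable_continuous_onI continuous_on_fst continuous_on_snd continuous_on_id)+
  obtain A where A: "A > 0" "\<And>x. \<bar>g x\<bar> \<le> A" using bounded_borel_bound[OF g] by blast
  obtain C where C: "C > 0" "\<And>x. \<bar>\<psi> x\<bar> \<le> C" using bounded_borel_bound[OF \<psi>] by blast
  have Pb: "bounded_borel ?P" by (rule kern_integral_bounded_borel[OF sl(1,2,3) \<psi>])
  define B where "B = A * C"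
  have G: "bounded_borel (\<lambda>z :: real \<times> real. g (fst z) * \<psi> (snd z))"
    by (intro bounded_borel_mult bounded_borel_comp[OF g fst_m] bounded_borel_comp[OF \<psi> snd_m])
  have G': "bounded_borel (\<lambda>z :: real \<times> real. g (fst z) * ?P (fst z))"
    by (intro bounded_borel_mult bounded_borel_comp[OF g fst_m] bounded_borel_comp[OF Pb fst_m])
  have GB: "\<bar>g x * \<psi> y\<bar> \<le> B" for x y
    unfolding B_def abs_mult using A C by (intro mult_mono) (auto intro: less_imp_le)
  have b\<psi>: "bounded_borel (\<lambda>y. g x * \<psi> y)" for x by (intro bounded_borel_cmult \<psi>)
  have inner: "(\<integral>y. g x * \<psi> y \<partial>kern (p t) x) = g x * ?P x" for x by simp
  have PB: "\<bar>g x * ?P x\<bar> \<le> B" for x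
  proof -
    interpret K: prob_space "kern (p t) x" by (rule k(1))
    have int: "integrable (kern (p t) x) (\<lambda>y. g x * \<psi> y)" by (rule bounded_borel_integrable[OF k(1) b\<psi> k(2)])
    have "\<bar>\<integral>y. g x * \<psi> y \<partial>kern (p t) x\<bar> \<le> (\<integral>y. \<bar>g x * \<psi> y\<bar> \<partial>kern (p t) x)" by (rule integral_abs_bound)
    also have "\<dots> \<le> (\<integral>y. B \<partial>kern (p t) x)" using int GB[of x] by (intro integral_mono) auto
    finally show ?thesis unfolding inner by (simp add: K.prob_space)
  qed
  have GBm: "(\<lambda>z :: real \<times> real. ennreal (g (fst z) * \<psi> (snd z) + B)) \<in> borel_measurable borel"
    using bounded_borel_measurable[OF G] by measurable
  have "ennreal ((\<integral>z. g (fst z) * \<psi> (snd z) \<partial>?\<pi>) + B) = (\<integral>\<^sup>+z. ennreal (g (fst z) * \<psi> (snd z) + B) \<partial>?\<pi>)"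
    by (rule integral_shift(2)[OF P G, symmetric]) (rule GB)
  also have "\<dots> = (\<integral>\<^sup>+z. (\<integral>\<^sup>+y. ennreal (g (fst z) * \<psi> y + B) * ennreal (p t (fst z) y) \<partial>lborel) \<partial>?\<pi>)"
    using mean_occ_disintegration[OF sol td T t GBm] by simp
  also have "\<dots> = (\<integral>\<^sup>+z. ennreal (g (fst z) * ?P (fst z) + B) \<partial>?\<pi>)"
  proof (rule nn_integral_cong)
    fix z :: "real \<times> real"
    have "(\<lambda>y. ennreal (g (fst z) * \<psi> y + B)) \<in> borel_measurable borel"
      using bounded_borel_measurable[OF \<psi>] by measurable
    then have "(\<integral>\<^sup>+y. ennreal (g (fst z) * \<psi> y + B) * ennreal (p t (fst z) y) \<partial>lborel)
        = (\<integral>\<^sup>+y. ennreal (g (fst z) * \<psi> y + B) \<partial>kern (p t) (fst z))"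
      by (rule k(3)[symmetric])
    also have "\<dots> = ennreal ((\<integral>y. g (fst z) * \<psi> y \<partial>kern (p t) (fst z)) + B)"
      by (rule integral_shift(2)[OF k(1,2) b\<psi>]) (rule GB)
    finally show "(\<integral>\<^sup>+y. ennreal (g (fst z) * \<psi> y + B) * ennreal (p t (fst z) y) \<partial>lborel)
        = ennreal (g (fst z) * ?P (fst z) + B)" unfolding inner .
  qed
  also have "\<dots> = ennreal ((\<integral>z. g (fst z) * ?P (fst z) \<partial>?\<pi>) + B)"
    by (rule integral_shift(2)[OF P G']) (rule PB)
  finally have e: "ennreal ((\<integral>z. g (fst z) * \<psi> (snd z) \<partial>?\<pi>) + B) = ennreal ((\<integral>z. g (fst z) * ?P (fst z) \<partial>?\<pi>) + B)" .
  have nn: "0 \<le> (\<integral>z. Q z \<partial>?\<pi>) + B" if Q: "bounded_borel Q" "\<And>z. \<bar>Q z\<bar> \<le> B" for Q :: "real \<times> real \<Rightarrow> real"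
  proof -
    have nz: "0 \<le> Q z + B" for z using Q(2)[of z] by linarith
    have "0 \<le> (\<integral>z. Q z + B \<partial>?\<pi>)" using nz by (intro integral_nonneg_AE) auto
    then show ?thesis using bounded_borel_integrable[OF P(1) Q(1) P(2)] by (simp add: P.prob_space)
  qed
  show ?thesis using e nn[OF G GB] nn[OF G' PB] by simp
qed

section \<open>Integrated squares, basis functions and Gram matrices\<close>

text \<open>Pythagoras for the distance from \<open>r\<close> to the span of an orthonormal family, when \<open>r\<close> is integrable but perhaps
not square integrable. The coefficients \<open>q l\<close> still exist since the \<open>\<psi> l\<close> are bounded, and if the remainder is
infinite then so is the left-hand side.\<close>

lemma nn_integral_square_decomposition:
  fixes \<psi> :: "nat \<Rightarrow> real \<Rightarrow> real" and r :: "real \<Rightarrow> real"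
  assumes \<psi>: "\<And>l. l < n \<Longrightarrow> bounded_borel (\<psi> l)"
    and int: "\<And>l k. l < n \<Longrightarrow> k < n \<Longrightarrow> integrable lborel (\<lambda>y. \<psi> l y * \<psi> k y)"
    and on: "\<And>l k. l < n \<Longrightarrow> k < n \<Longrightarrow> (\<integral>y. \<psi> l y * \<psi> k y \<partial>lborel) = (if l = k then 1 else 0)"
    and r: "integrable lborel r"
  defines "q \<equiv> \<lambda>l. \<integral>y. r y * \<psi> l y \<partial>lborel"
  shows "(\<integral>\<^sup>+y. ennreal (((\<Sum>l<n. c l * \<psi> l y) - r y)\<^sup>2) \<partial>lborel)
    = ennreal (\<Sum>l<n. (c l - q l)\<^sup>2) + (\<integral>\<^sup>+y. ennreal (((\<Sum>l<n. q l * \<psi> l y) - r y)\<^sup>2) \<partial>lborel)"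
proof -
  define w where "w y = (\<Sum>l<n. q l * \<psi> l y) - r y" for y
  define d where "d l = c l - q l" for l
  define v where "v y = (\<Sum>l<n. d l * \<psi> l y)" for y
  have vw: "(\<Sum>l<n. c l * \<psi> l y) - r y = v y + w y" for y
    by (simp add: v_def w_def d_def left_diff_distrib sum_subtractf)
  have rm[measurable]: "r \<in> borel_measurable borel" using borel_measurable_integrable[OF r] by simp
  have \<psi>m[measurable]: "\<psi> l \<in> borel_measurable borel" if "l < n" for l
    using \<psi>[OF that] by (simp add: bounded_borel_def)
  have vm[measurable]: "v \<in> borel_measurable borel" unfolding v_def[abs_def] by measurable
  have wm[measurable]: "w \<in> borel_measurable borel" unfolding w_def[abs_def] by measurable
  have r\<psi>: "integrable lborel (\<lambda>y. r y * \<psi> l y)" if l: "l < n" for l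
  proof -
    obtain B where B: "\<And>y. \<bar>\<psi> l y\<bar> \<le> B" using \<psi>[OF l] by (auto simp: bounded_borel_def)
    show ?thesis
    proof (rule Bochner_Integration.integrable_bound[where f = "\<lambda>y. B * r y"])
      show "integrable lborel (\<lambda>y. B * r y)" using r by simp
      show "AE y in lborel. norm (r y * \<psi> l y) \<le> norm (B * r y)"
      proof (rule AE_I2)
        fix y
        have "\<bar>r y\<bar> * \<bar>\<psi> l y\<bar> \<le> \<bar>r y\<bar> * \<bar>B\<bar>" using B[of y] by (intro mult_left_mono) auto
        then show "norm (r y * \<psi> l y) \<le> norm (B * r y)" by (simp add: abs_mult mult.commute)
      qed
    qed (use l in measurable)
  qed
  have \<psi>v: "integrable lborel (\<lambda>y. \<psi> l y * v y)" "(\<integral>y. \<psi> l y * v y \<partial>lborel) = d l" if l: "l < n" for l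
  proof -
    have I: "integrable lborel (\<lambda>y. d k * (\<psi> l y * \<psi> k y))" if "k < n" for k
      using int[OF l that] by simp
    have e: "\<psi> l y * v y = (\<Sum>k<n. d k * (\<psi> l y * \<psi> k y))" for y
      by (simp add: v_def sum_distrib_left mult_ac)
    show "integrable lborel (\<lambda>y. \<psi> l y * v y)" unfolding e using I by (intro Bochner_Integration.integrable_sum) auto
    have "(\<integral>y. \<psi> l y * v y \<partial>lborel) = (\<Sum>k<n. \<integral>y. d k * (\<psi> l y * \<psi> k y) \<partial>lborel)"
      unfolding e using I by (intro Bochner_Integration.integral_sum) auto
    also have "\<dots> = (\<Sum>k<n. if k = l then d l else 0)"
      using on l by (intro sum.cong refl) auto
    finally show "(\<integral>y. \<psi> l y * v y \<partial>lborel) = d l" using l by simp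
  qed
  have v2: "integrable lborel (\<lambda>y. (v y)\<^sup>2)" "(\<integral>y. (v y)\<^sup>2 \<partial>lborel) = (\<Sum>l<n. (d l)\<^sup>2)"
  proof -
    have e: "(v y)\<^sup>2 = (\<Sum>l<n. d l * (\<psi> l y * v y))" for y
      unfolding power2_eq_square v_def[of y] sum_distrib_right by (simp add: v_def mult.assoc)
    show "integrable lborel (\<lambda>y. (v y)\<^sup>2)" unfolding e using \<psi>v(1) by (intro Bochner_Integration.integrable_sum integrable_mult_right) auto
    have "(\<integral>y. (v y)\<^sup>2 \<partial>lborel) = (\<Sum>l<n. \<integral>y. d l * (\<psi> l y * v y) \<partial>lborel)"
      unfolding e using \<psi>v(1) by (intro Bochner_Integration.integral_sum integrable_mult_right) auto
    also have "\<dots> = (\<Sum>l<n. (d l)\<^sup>2)" using \<psi>v(2) by (intro sum.cong) (auto simp: power2_eq_square)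
    finally show "(\<integral>y. (v y)\<^sup>2 \<partial>lborel) = (\<Sum>l<n. (d l)\<^sup>2)" .
  qed
  have \<psi>w: "integrable lborel (\<lambda>y. \<psi> l y * w y)" "(\<integral>y. \<psi> l y * w y \<partial>lborel) = 0" if l: "l < n" for l
  proof -
    have I: "integrable lborel (\<lambda>y. q k * (\<psi> l y * \<psi> k y))" if "k < n" for k
      using int[OF l that] by simp
    have IS: "integrable lborel (\<lambda>y. \<Sum>k<n. q k * (\<psi> l y * \<psi> k y))"
      using I by (intro Bochner_Integration.integrable_sum) auto
    have e: "\<psi> l y * w y = (\<Sum>k<n. q k * (\<psi> l y * \<psi> k y)) - r y * \<psi> l y" for y
      by (simp add: w_def right_diff_distrib sum_distrib_left mult_ac)
    show "integrable lborel (\<lambda>y. \<psi> l y * w y)" unfolding e using IS r\<psi>[OF l] by simp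
    have "(\<integral>y. \<psi> l y * w y \<partial>lborel) = (\<integral>y. (\<Sum>k<n. q k * (\<psi> l y * \<psi> k y)) \<partial>lborel) - q l"
      unfolding e using IS r\<psi>[OF l] by (simp add: q_def)
    also have "(\<integral>y. (\<Sum>k<n. q k * (\<psi> l y * \<psi> k y)) \<partial>lborel) = (\<Sum>k<n. \<integral>y. q k * (\<psi> l y * \<psi> k y) \<partial>lborel)"
      using I by (intro Bochner_Integration.integral_sum) auto
    also have "\<dots> = (\<Sum>k<n. if k = l then q l else 0)"
      using on l by (intro sum.cong refl) auto
    finally show "(\<integral>y. \<psi> l y * w y \<partial>lborel) = 0" using l by simp
  qed
  have vwI: "integrable lborel (\<lambda>y. v y * w y)" "(\<integral>y. v y * w y \<partial>lborel) = 0"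
  proof -
    have e: "v y * w y = (\<Sum>l<n. d l * (\<psi> l y * w y))" for y
      by (simp add: v_def sum_distrib_right mult.assoc)
    show "integrable lborel (\<lambda>y. v y * w y)" unfolding e using \<psi>w(1) by (intro Bochner_Integration.integrable_sum integrable_mult_right) auto
    have "(\<integral>y. v y * w y \<partial>lborel) = (\<Sum>l<n. \<integral>y. d l * (\<psi> l y * w y) \<partial>lborel)"
      unfolding e using \<psi>w(1) by (intro Bochner_Integration.integral_sum integrable_mult_right) auto
    then show "(\<integral>y. v y * w y \<partial>lborel) = 0" using \<psi>w(2) by simp
  qed
  have v2nn: "(\<integral>\<^sup>+y. ennreal ((v y)\<^sup>2) \<partial>lborel) = ennreal (\<Sum>l<n. (d l)\<^sup>2)"
    using nn_integral_eq_integral[OF v2(1)] v2(2) by simp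
  have "(\<integral>\<^sup>+y. ennreal ((v y + w y)\<^sup>2) \<partial>lborel) = ennreal (\<Sum>l<n. (d l)\<^sup>2) + (\<integral>\<^sup>+y. ennreal ((w y)\<^sup>2) \<partial>lborel)"
  proof (cases "(\<integral>\<^sup>+y. ennreal ((w y)\<^sup>2) \<partial>lborel) = \<infinity>")
    case True
    have "(\<integral>\<^sup>+y. ennreal ((w y)\<^sup>2) \<partial>lborel) \<le> (\<integral>\<^sup>+y. 2 * ennreal ((v y + w y)\<^sup>2) + 2 * ennreal ((v y)\<^sup>2) \<partial>lborel)"
    proof (rule nn_integral_mono)
      fix y
      have "(w y)\<^sup>2 \<le> 2 * (v y + w y)\<^sup>2 + 2 * (v y)\<^sup>2"
        using zero_le_power2[of "2 * v y + w y"] by (simp add: power2_eq_square algebra_simps)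
      then have "ennreal ((w y)\<^sup>2) \<le> ennreal (2 * (v y + w y)\<^sup>2 + 2 * (v y)\<^sup>2)" by (rule ennreal_leI)
      then show "ennreal ((w y)\<^sup>2) \<le> 2 * ennreal ((v y + w y)\<^sup>2) + 2 * ennreal ((v y)\<^sup>2)"
        by (simp add: ennreal_mult)
    qed
    also have "\<dots> = 2 * (\<integral>\<^sup>+y. ennreal ((v y + w y)\<^sup>2) \<partial>lborel) + 2 * ennreal (\<Sum>l<n. (d l)\<^sup>2)"
      unfolding v2nn[symmetric] by (subst nn_integral_add) (auto simp: nn_integral_cmult)
    finally have "2 * (\<integral>\<^sup>+y. ennreal ((v y + w y)\<^sup>2) \<partial>lborel) + 2 * ennreal (\<Sum>l<n. (d l)\<^sup>2) = \<infinity>"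
      using True by (simp add: top_unique)
    then have "(\<integral>\<^sup>+y. ennreal ((v y + w y)\<^sup>2) \<partial>lborel) = \<infinity>"
      by (auto simp: ennreal_mult_eq_top_iff ennreal_add_eq_top)
    then show ?thesis using True by simp
  next
    case False
    have w2: "integrable lborel (\<lambda>y. (w y)\<^sup>2)"
      using False by (intro integrableI_nonneg) (auto simp: top.not_eq_extremum)
    have eq: "(v y + w y)\<^sup>2 = (v y)\<^sup>2 + 2 * (v y * w y) + (w y)\<^sup>2" for y by (simp add: power2_sum)
    have I: "integrable lborel (\<lambda>y. (v y + w y)\<^sup>2)"
      unfolding eq using v2(1) vwI(1) w2 by simp
    have "(\<integral>\<^sup>+y. ennreal ((v y + w y)\<^sup>2) \<partial>lborel) = ennreal (\<integral>y. (v y + w y)\<^sup>2 \<partial>lborel)"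
      using I by (intro nn_integral_eq_integral) auto
    also have "(\<integral>y. (v y + w y)\<^sup>2 \<partial>lborel) = (\<Sum>l<n. (d l)\<^sup>2) + (\<integral>y. (w y)\<^sup>2 \<partial>lborel)"
      unfolding eq using v2 vwI w2 by simp
    also have "ennreal \<dots> = ennreal (\<Sum>l<n. (d l)\<^sup>2) + ennreal (\<integral>y. (w y)\<^sup>2 \<partial>lborel)"
      by (intro ennreal_plus sum_nonneg) auto
    also have "ennreal (\<integral>y. (w y)\<^sup>2 \<partial>lborel) = (\<integral>\<^sup>+y. ennreal ((w y)\<^sup>2) \<partial>lborel)"
      using w2 by (intro nn_integral_eq_integral[symmetric]) auto
    finally show ?thesis .
  qed
  then show ?thesis unfolding vw d_def[symmetric] w_def[symmetric] .
qed

lemma frakL_finite_bounds: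
  assumes fin: "frakL I \<phi> m \<noteq> \<infinity>" and off: "\<And>j x. j \<in> {1..m} \<Longrightarrow> x \<notin> I \<Longrightarrow> \<phi> j x = 0"
  shows "1 \<le> enn2real (frakL I \<phi> m)" "(\<Sum>j<m. (\<phi> (Suc j) x)\<^sup>2) \<le> enn2real (frakL I \<phi> m)"
proof -
  have e: "frakL I \<phi> m = ennreal (enn2real (frakL I \<phi> m))" using fin by (simp add: top.not_eq_extremum)
  have "1 \<le> frakL I \<phi> m" by (simp add: frakL_def)
  then show one: "1 \<le> enn2real (frakL I \<phi> m)" by (subst (asm) e) simp
  show "(\<Sum>j<m. (\<phi> (Suc j) x)\<^sup>2) \<le> enn2real (frakL I \<phi> m)"
  proof (cases "x \<in> I")
    case True
    have "ennreal (\<Sum>j=1..m. (\<phi> j x)\<^sup>2) \<le> (SUP x\<in>I. ennreal (\<Sum>j=1..m. (\<phi> j x)\<^sup>2))"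
      using True by (rule SUP_upper)
    also have "\<dots> \<le> frakL I \<phi> m" by (simp add: frakL_def)
    finally have "ennreal (\<Sum>j=1..m. (\<phi> j x)\<^sup>2) \<le> ennreal (enn2real (frakL I \<phi> m))" using e by simp
    then show ?thesis by (simp add: sum.atLeast1_atMost_eq)
  next
    case False
    then have "(\<Sum>j<m. (\<phi> (Suc j) x)\<^sup>2) = 0" using off by (intro sum.neutral) auto
    then show ?thesis using one by simp
  qed
qed

lemma orthonormal_family_bounded_borel:
  assumes orth: "orthonormal_family I n \<phi>" and I: "is_interval I" and m: "m \<le> n"
    and fin: "frakL I \<phi> m \<noteq> \<infinity>" and j: "j < m"
  shows "bounded_borel (\<phi> (Suc j))"
proof (rule bounded_borelI)
  have off: "\<phi> k x = 0" if "k \<in> {1..n}" "x \<notin> I" for k x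
    using orth that by (simp add: orthonormal_family_def)
  have "continuous_on I (\<phi> (Suc j))" using orth j m by (simp add: orthonormal_family_def)
  then have "(\<lambda>x. indicator I x *\<^sub>R \<phi> (Suc j) x) \<in> borel_measurable borel"
    by (rule borel_measurable_continuous_on_indicator[OF real_interval_borel_measurable[OF I]])
  moreover have "(\<lambda>x. indicator I x *\<^sub>R \<phi> (Suc j) x) = \<phi> (Suc j)"
  proof (rule ext)
    fix x
    show "indicator I x *\<^sub>R \<phi> (Suc j) x = \<phi> (Suc j) x" using off[of "Suc j" x] j m by (cases "x \<in> I") auto
  qed
  ultimately show "\<phi> (Suc j) \<in> borel_measurable borel" by simp
  fix x
  have "(\<phi> (Suc j) x)\<^sup>2 \<le> (\<Sum>k<m. (\<phi> (Suc k) x)\<^sup>2)"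
    by (rule member_le_sum[of j "{..<m}" "\<lambda>k. (\<phi> (Suc k) x)\<^sup>2"]) (use j in auto)
  also have "\<dots> \<le> enn2real (frakL I \<phi> m)" by (rule frakL_finite_bounds(2)[OF fin]) (use off m in auto)
  finally show "\<bar>\<phi> (Suc j) x\<bar> \<le> sqrt (enn2real (frakL I \<phi> m))" by (simp add: real_le_rsqrt)
qed

lemma mean_occ_first_marginal_integral:
  fixes g :: "real \<Rightarrow> real"
  assumes sol: "strong_solution M (2 * T) b \<sigma> x0 W X" and td: "transition_density M X T p" and T: "0 < T"
    and g: "g \<in> borel_measurable borel"
  shows "(\<integral>z. g (fst z) \<partial>mean_occ M X T t) = (LBINT x. g x * mean_density p x0 T x)"
proof -
  have fst_m: "(fst :: real \<times> real \<Rightarrow> real) \<in> borel_measurable borel"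
    by (intro borel_measurable_continuous_onI continuous_on_fst continuous_on_id)
  then have fm: "fst \<in> measurable (mean_occ M X T t) lborel"
    by (simp add: mean_occ_def)
  have "distr (mean_occ M X T t) lborel fst = density lborel (\<lambda>x. ennreal (mean_density p x0 T x))"
  proof (rule measure_eqI)
    fix A assume "A \<in> sets (distr (mean_occ M X T t) lborel fst)"
    then have A[measurable]: "A \<in> sets borel" by simp
    have "emeasure (distr (mean_occ M X T t) lborel fst) A = (\<integral>\<^sup>+x. indicator A x \<partial>distr (mean_occ M X T t) lborel fst)"
      by (rule nn_integral_indicator[symmetric]) simp
    also have "\<dots> = (\<integral>\<^sup>+z. indicator A (fst z) \<partial>mean_occ M X T t)"
      by (rule nn_integral_distr[OF fm]) simp
    also have "\<dots> = (\<integral>\<^sup>+x. indicator A x * ennreal (mean_density p x0 T x) \<partial>lborel)"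
      by (rule mean_occ_first_marginal[OF sol td T]) simp
    also have "\<dots> = emeasure (density lborel (\<lambda>x. ennreal (mean_density p x0 T x))) A"
      using mean_density_measurable[OF td T] by (subst emeasure_density) (auto simp: mult.commute)
    finally show "emeasure (distr (mean_occ M X T t) lborel fst) A = emeasure (density lborel (\<lambda>x. ennreal (mean_density p x0 T x))) A" .
  qed simp
  moreover have "(\<integral>z. g (fst z) \<partial>mean_occ M X T t) = (\<integral>x. g x \<partial>distr (mean_occ M X T t) lborel fst)"
    using g by (intro integral_distr[OF fm, symmetric]) simp
  ultimately show ?thesis
    using g mean_density_measurable[OF td T] mean_density_nonneg[OF td T]
    by (simp add: integral_density mult.commute)
qed

context indep_random_measures
begin

lemma Av_Cauchy_Schwarz_zero:
  assumes "bounded_borel G" "bounded_borel H" "\<omega> \<in> space M" "Av (\<lambda>z. (H z)\<^sup>2) \<omega> = 0"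
  shows "Av (\<lambda>z. G z * H z) \<omega> = 0"
proof -
  have bb: "bounded_borel (\<lambda>z. (G z)\<^sup>2)" "bounded_borel (\<lambda>z. G z * H z)" "bounded_borel (\<lambda>z. (H z)\<^sup>2)"
    by (intro bounded_borel_power2 bounded_borel_mult assms)+
  have "(Av (\<lambda>z. G z * H z) \<omega>)\<^sup>2 \<le> Av (\<lambda>z. (G z)\<^sup>2) \<omega> * Av (\<lambda>z. (H z)\<^sup>2) \<omega>"
  proof (rule discriminant_bound)
    show "0 \<le> Av (\<lambda>z. (H z)\<^sup>2) \<omega>" using assms by simp
    fix x
    have "0 \<le> Av (\<lambda>z. (G z + x * H z)\<^sup>2) \<omega>" using assms by (intro Av_nonneg) auto
    also have "(\<lambda>z. (G z + x * H z)\<^sup>2) = (\<lambda>z. (G z)\<^sup>2 + ((2 * x) * (G z * H z) + x\<^sup>2 * (H z)\<^sup>2))"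
      by (rule ext) (simp add: power2_sum power_mult_distrib)
    also have "Av \<dots> \<omega> = Av (\<lambda>z. (G z)\<^sup>2) \<omega> + 2 * Av (\<lambda>z. G z * H z) \<omega> * x + Av (\<lambda>z. (H z)\<^sup>2) \<omega> * x\<^sup>2"
      using bb assms(3) by (simp add: Av_add Av_cmult bounded_borel_add bounded_borel_cmult)
    finally show "0 \<le> Av (\<lambda>z. (G z)\<^sup>2) \<omega> + 2 * Av (\<lambda>z. G z * H z) \<omega> * x + Av (\<lambda>z. (H z)\<^sup>2) \<omega> * x\<^sup>2" .
  qed
  then show ?thesis using assms(4) by simp
qed

text \<open>A kernel vector of the mean Gram matrix is a combination with zero mean square, so its empirical mean square
vanishes almost surely, and it is a kernel vector of the empirical Gram matrix as well.\<close>

lemma mean_gram_invertible: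
  fixes \<phi> :: "nat \<Rightarrow> real \<times> real \<Rightarrow> real"
  assumes \<phi>: "\<And>j. j < m \<Longrightarrow> bounded_borel (\<phi> j)"
    and inv: "AE \<omega> in M. invertible_mat (mat m m (\<lambda>(j, k). Av (\<lambda>z. \<phi> j z * \<phi> k z) \<omega>))"
  shows "invertible_mat (mat m m (\<lambda>(j, k). \<integral>z. \<phi> j z * \<phi> k z \<partial>\<pi>))"
proof -
  define A where "A = mat m m (\<lambda>(j, k). \<integral>z. \<phi> j z * \<phi> k z \<partial>\<pi>)"
  have A: "A \<in> carrier_mat m m" by (simp add: A_def)
  have "det A \<noteq> 0"
  proof
    assume "det A = 0"
    then obtain v where v: "v \<in> carrier_vec m" "v \<noteq> 0\<^sub>v m" "A *\<^sub>v v = 0\<^sub>v m"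
      using det_0_iff_vec_prod_zero[OF A] by blast
    let ?g = "\<lambda>z. \<Sum>k<m. v $ k * \<phi> k z"
    have g: "bounded_borel ?g" by (intro bounded_borel_sum bounded_borel_cmult \<phi>) auto
    have g2: "bounded_borel (\<lambda>z. (?g z)\<^sup>2)" by (rule bounded_borel_power2[OF g])
    have lin: "L (\<lambda>z. \<phi> j z * ?g z) = (\<Sum>k<m. v $ k * L (\<lambda>z. \<phi> j z * \<phi> k z))" if j: "j < m"
      and L: "\<And>G. (\<And>k. k < m \<Longrightarrow> bounded_borel (G k)) \<Longrightarrow> L (\<lambda>z. \<Sum>k<m. v $ k * G k z) = (\<Sum>k<m. v $ k * L (G k))"
      for j and L :: "(real \<times> real \<Rightarrow> real) \<Rightarrow> real"
    proof -
      have "(\<lambda>z. \<phi> j z * ?g z) = (\<lambda>z. \<Sum>k<m. v $ k * (\<phi> j z * \<phi> k z))"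
        by (simp add: sum_distrib_left mult_ac)
      then show ?thesis using L[of "\<lambda>k z. \<phi> j z * \<phi> k z"] bounded_borel_mult[OF \<phi>[OF j] \<phi>] by simp
    qed
    have L\<pi>: "(\<integral>z. (\<Sum>k<m. v $ k * G k z) \<partial>\<pi>) = (\<Sum>k<m. v $ k * (\<integral>z. G k z \<partial>\<pi>))"
      if "\<And>k. k < m \<Longrightarrow> bounded_borel (G k)" for G :: "nat \<Rightarrow> real \<times> real \<Rightarrow> real"
    proof -
      have "(\<integral>z. (\<Sum>k<m. v $ k * G k z) \<partial>\<pi>) = (\<Sum>k<m. \<integral>z. v $ k * G k z \<partial>\<pi>)"
        using that by (intro Bochner_Integration.integral_sum integrable_mult_right integrable_\<pi>) auto
      then show ?thesis by simp
    qed
    have zero: "(\<integral>z. \<phi> j z * ?g z \<partial>\<pi>) = 0" if j: "j < m" for j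
    proof -
      have "(\<integral>z. \<phi> j z * ?g z \<partial>\<pi>) = (\<Sum>k<m. v $ k * (\<integral>z. \<phi> j z * \<phi> k z \<partial>\<pi>))"
        by (rule lin[OF j L\<pi>])
      also have "\<dots> = (A *\<^sub>v v) $ j"
        using mult_mat_vec_index[OF A v(1) j] j by (simp add: A_def mult.commute)
      finally show ?thesis using v(3) j by simp
    qed
    have "(\<integral>z. (?g z)\<^sup>2 \<partial>\<pi>) = (\<integral>z. (\<Sum>k<m. v $ k * (\<phi> k z * ?g z)) \<partial>\<pi>)"
      by (simp add: power2_eq_square sum_distrib_right mult.assoc)
    also have "\<dots> = 0" using L\<pi>[of "\<lambda>k z. \<phi> k z * ?g z"] bounded_borel_mult[OF \<phi> g] zero by simp
    finally have "expectation (Av (\<lambda>z. (?g z)\<^sup>2)) = 0" using Av_mean[OF g2] by simp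
    moreover have "AE \<omega> in M. 0 \<le> Av (\<lambda>z. (?g z)\<^sup>2) \<omega>" by (intro AE_I2 Av_nonneg) auto
    ultimately have "AE \<omega> in M. Av (\<lambda>z. (?g z)\<^sup>2) \<omega> = 0"
      using integral_nonneg_eq_0_iff_AE Av_mean[OF g2] by blast
    with inv AE_space have good: "AE \<omega> in M. \<omega> \<in> space M \<and>
        invertible_mat (mat m m (\<lambda>(j, k). Av (\<lambda>z. \<phi> j z * \<phi> k z) \<omega>)) \<and> Av (\<lambda>z. (?g z)\<^sup>2) \<omega> = 0"
      by eventually_elim auto
    have "AE \<omega> in M. False"
    proof (rule AE_mp[OF good], rule AE_I2, rule impI, elim conjE)
      fix \<omega> assume w: "\<omega> \<in> space M" and ib: "invertible_mat (mat m m (\<lambda>(j, k). Av (\<lambda>z. \<phi> j z * \<phi> k z) \<omega>))"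
        and z: "Av (\<lambda>z. (?g z)\<^sup>2) \<omega> = 0"
      define B where "B = mat m m (\<lambda>(j, k). Av (\<lambda>z. \<phi> j z * \<phi> k z) \<omega>)"
      have B: "B \<in> carrier_mat m m" by (simp add: B_def)
      have "B *\<^sub>v v = 0\<^sub>v m"
      proof (rule eq_vecI)
        fix j assume "j < dim_vec (0\<^sub>v m :: real vec)"
        then have j: "j < m" by simp
        have "(B *\<^sub>v v) $ j = (\<Sum>k<m. v $ k * Av (\<lambda>z. \<phi> j z * \<phi> k z) \<omega>)"
          using mult_mat_vec_index[OF B v(1) j] j by (simp add: B_def mult.commute)
        also have "\<dots> = Av (\<lambda>z. \<phi> j z * ?g z) \<omega>"
        proof (rule lin[OF j, symmetric])
          fix G :: "nat \<Rightarrow> real \<times> real \<Rightarrow> real" assume "\<And>k. k < m \<Longrightarrow> bounded_borel (G k)"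
          then show "Av (\<lambda>z. \<Sum>k<m. v $ k * G k z) \<omega> = (\<Sum>k<m. v $ k * Av (G k) \<omega>)"
            using w by (subst Av_sum) (auto simp: Av_cmult bounded_borel_cmult)
        qed
        also have "\<dots> = 0" by (rule Av_Cauchy_Schwarz_zero[OF \<phi>[OF j] g w z])
        finally show "(B *\<^sub>v v) $ j = 0\<^sub>v m $ j" using j by simp
      qed (use B in simp)
      note B' = inv_mat_inverse[OF B ib[folded B_def]]
      have "v = (inv_mat B * B) *\<^sub>v v" using B' v by simp
      also have "\<dots> = inv_mat B *\<^sub>v (B *\<^sub>v v)" by (rule assoc_mult_mat_vec[OF B'(1) B v(1)])
      also have "\<dots> = 0\<^sub>v m" unfolding \<open>B *\<^sub>v v = 0\<^sub>v m\<close> using B'(1) by (intro eq_vecI) auto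
      finally show False using v(2) by simp
    qed
    then show False by simp
  qed
  then have "A \<in> Units (ring_mat TYPE(real) m ())" by (rule det_non_zero_imp_unit[OF A])
  then obtain D where "D \<in> carrier_mat m m" "D * A = 1\<^sub>m m" "A * D = 1\<^sub>m m"
    by (auto simp: Units_def ring_mat_def)
  then show ?thesis
    using A unfolding A_def[symmetric] invertible_mat_def inverts_mat_def by (auto intro!: exI[of _ D])
qed

end

section \<open>The oracle inequality\<close>

lemma Av_occ_formula:
  assumes T: "0 < T" and t: "t \<in> {0<..T}"
    and cont: "\<And>i. i \<in> {1..N} \<Longrightarrow> continuous_on {0..2 * T} (\<lambda>u. Xs i u \<omega>)"
    and G: "(G :: real \<times> real \<Rightarrow> real) \<in> borel_measurable borel"
  shows "(1 / real N) * (\<Sum>i\<in>{1..N}. \<integral>z. G z \<partial>occ (Xs i) T t \<omega>)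
    = 1 / (real N * T) * (\<Sum>i=1..N. LBINT s:{0..T}. G (Xs i s \<omega>, Xs i (s + t) \<omega>))"
proof -
  have "(\<integral>z. G z \<partial>occ (Xs i) T t \<omega>) = (1 / T) * (LBINT s:{0..T}. G (Xs i s \<omega>, Xs i (s + t) \<omega>))"
    if i: "i \<in> {1..N}" for i
  proof -
    have m1: "(\<lambda>s. Xs i (clip (2 * T) s) \<omega>) \<in> borel_measurable borel"
      by (rule clipped_path_measurable[where X = "Xs i", OF T cont[OF i]])
    have m2: "(\<lambda>s. Xs i (clip (2 * T) (s + t)) \<omega>) \<in> borel_measurable borel"
      by (rule measurable_compose[OF _ m1]) measurable
    have m: "(\<lambda>s. (Xs i (clip (2 * T) s) \<omega>, Xs i (clip (2 * T) (s + t)) \<omega>)) \<in> borel_measurable borel"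
      unfolding borel_prod[symmetric] using m1 m2 by (rule measurable_Pair)
    have "(\<integral>z. G z \<partial>occ (Xs i) T t \<omega>)
        = (1 / T) * (LBINT s:{0..T}. G (Xs i (clip (2 * T) s) \<omega>, Xs i (clip (2 * T) (s + t)) \<omega>))"
      unfolding occ_basic(4)[where X = "Xs i", OF T cont[OF i] G]
      by (rule integral_time_unif[OF T measurable_compose[OF m G]])
    also have "(LBINT s:{0..T}. G (Xs i (clip (2 * T) s) \<omega>, Xs i (clip (2 * T) (s + t)) \<omega>))
        = (LBINT s:{0..T}. G (Xs i s \<omega>, Xs i (s + t) \<omega>))"
      by (rule set_lebesgue_integral_cong) (use t in \<open>auto simp: clip_id\<close>)
    finally show ?thesis .
  qed
  then have "(\<Sum>i\<in>{1..N}. \<integral>z. G z \<partial>occ (Xs i) T t \<omega>)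
      = (\<Sum>i\<in>{1..N}. (1 / T) * (LBINT s:{0..T}. G (Xs i s \<omega>, Xs i (s + t) \<omega>)))"
    by (intro sum.cong) auto
  then show ?thesis by (simp add: sum_distrib_left[symmetric] sum_divide_distrib[symmetric])
qed

lemma occ_nn_integral_first:
  assumes T: "0 < T" and cont: "continuous_on {0..2 * T} (\<lambda>u. X u \<omega>)" and h: "h \<in> borel_measurable borel"
  shows "(\<integral>\<^sup>+s\<in>{0..T}. h (X s \<omega>) \<partial>lborel) = ennreal T * (\<integral>\<^sup>+z. h (fst z) \<partial>occ X T t \<omega>)"
proof -
  have fst_m: "(fst :: real \<times> real \<Rightarrow> real) \<in> borel_measurable borel"
    by (intro borel_measurable_continuous_onI continuous_on_fst continuous_on_id)
  have m1: "(\<lambda>s. X (clip (2 * T) s) \<omega>) \<in> borel_measurable borel"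
    by (rule clipped_path_measurable[where X = X, OF T cont])
  have "(\<integral>\<^sup>+z. h (fst z) \<partial>occ X T t \<omega>) = (\<integral>\<^sup>+s. h (X (clip (2 * T) s) \<omega>) \<partial>time_unif T)"
    using occ_basic(3)[where X = X, OF T cont measurable_compose[OF fst_m h]] by simp
  also have "\<dots> = ennreal (1 / T) * (\<integral>\<^sup>+s\<in>{0..T}. h (X (clip (2 * T) s) \<omega>) \<partial>lborel)"
    by (rule nn_integral_time_unif[OF T measurable_compose[OF m1 h]])
  also have "(\<integral>\<^sup>+s\<in>{0..T}. h (X (clip (2 * T) s) \<omega>) \<partial>lborel) = (\<integral>\<^sup>+s\<in>{0..T}. h (X s \<omega>) \<partial>lborel)"
    by (intro nn_integral_cong) (auto simp: indicator_def clip_id)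
  finally have "ennreal T * (\<integral>\<^sup>+z. h (fst z) \<partial>occ X T t \<omega>)
      = (ennreal T * ennreal (1 / T)) * (\<integral>\<^sup>+s\<in>{0..T}. h (X s \<omega>) \<partial>lborel)" by (simp add: mult.assoc)
  also have "ennreal T * ennreal (1 / T) = 1" using T by (simp add: ennreal_mult[symmetric])
  finally show ?thesis by simp
qed

text \<open>The constant \<open>c_Lambda T q\<close> is tuned so that the failure probability is at most \<open>m (N T)^(- (2 q + 10))\<close>. As
\<open>m \<le> N T + 1\<close> and the noise energy is of order \<open>N^q\<close>, this leaves a contribution of order \<open>1 / N\<close>.\<close>

lemma bad_event_contribution:
  fixes N m q :: nat and T c L :: real
  assumes T: "0 < T" and NT: "1 < real N * T" and m: "m \<le> max_dim N T" and L: "0 \<le> L" "L \<le> c * real N ^ q" and c: "0 < c"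
  defines "K \<equiv> c_Lambda T q / 2 * (real N * T / ln (real N * T))"
  shows "0 < K" "4 * L * (real m * exp (- ((1 - ln 2) * real N / (2 * K)))) \<le> (8 * c / T ^ (q + 1)) / real N"
proof -
  let ?x = "real N * T"
  have lnx: "0 < ln ?x" using NT by simp
  have N0: "0 < real N" using NT T by (cases "N = 0") auto
  have l2: "0 < 1 - ln (2::real)" using ln_2_less_1 by simp
  have cL: "c_Lambda T q = (1 - ln 2) / ((2 * real q + 10) * T)"
    by (simp add: c_Lambda_def Let_def algebra_simps)
  show K0: "0 < K" unfolding K_def cL using l2 T lnx N0 by simp
  have x0: "0 < ?x" using NT by simp
  have f: "(1 - ln 2) * real N / (2 * K) = real (2 * q + 10) * ln ?x"
    unfolding K_def cL using l2 T lnx N0 by (simp add: field_simps)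
  have "exp (real (2 * q + 10) * ln ?x) = ?x ^ (2 * q + 10)"
    by (simp only: exp_of_nat_mult exp_ln[OF x0])
  then have e: "exp (- ((1 - ln 2) * real N / (2 * K))) = 1 / ?x ^ (2 * q + 10)"
    unfolding f exp_minus by (simp only: inverse_eq_divide)
  have m2: "real m \<le> 2 * ?x"
  proof -
    have "real m \<le> real (max_dim N T)" using m by simp
    also have "\<dots> \<le> ?x + 1" using NT by (simp add: max_dim_def) 
    finally show ?thesis using NT by simp
  qed
  have "4 * L * (real m * (1 / ?x ^ (2 * q + 10))) \<le> 4 * (c * real N ^ q) * ((2 * ?x) * (1 / ?x ^ (2 * q + 10)))"
    using L m2 NT by (intro mult_mono) auto
  also have "\<dots> = 8 * c * real N ^ q / ?x ^ (2 * q + 9)"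
  proof -
    have "?x ^ (2 * q + 10) = ?x * ?x ^ (2 * q + 9)" using power_Suc[of ?x "2 * q + 9"] by (simp add: numeral_eq_Suc)
    then show ?thesis using NT by simp
  qed
  also have "\<dots> \<le> 8 * c * real N ^ q / ?x ^ (q + 1)"
  proof (rule divide_left_mono)
    show "?x ^ (q + 1) \<le> ?x ^ (2 * q + 9)" using NT by (intro power_increasing) auto
    show "0 \<le> 8 * c * real N ^ q" using c by simp
    show "0 < ?x ^ (2 * q + 9) * ?x ^ (q + 1)" by (intro mult_pos_pos zero_less_power x0)
  qed
  also have "\<dots> = (8 * c / T ^ (q + 1)) / real N"
    using N0 T by (simp add: power_mult_distrib field_simps)
  finally show "4 * L * (real m * exp (- ((1 - ln 2) * real N / (2 * K)))) \<le> (8 * c / T ^ (q + 1)) / real N"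
    unfolding e .
qed

text \<open>The elements of \<open>tensor_space\<close> in the form that regression uses: for each \<open>l\<close> a combination of the \<open>\<phi> j\<close>, with
indices shifted to start at \<open>0\<close>.\<close>

definition tensor_comb ::
  "nat \<Rightarrow> nat \<Rightarrow> (nat \<Rightarrow> real \<Rightarrow> real) \<Rightarrow> (nat \<Rightarrow> real \<Rightarrow> real) \<Rightarrow> (nat \<Rightarrow> nat \<Rightarrow> real) \<Rightarrow> real \<Rightarrow> real \<Rightarrow> real" where
  "tensor_comb m1 m2 \<phi> \<psi> a x y = (\<Sum>l<m2. (\<Sum>j<m1. a l j * \<phi> (Suc j) x) * \<psi> (Suc l) y)"

lemma tensor_comb_eq:
  "(\<Sum>j=1..m1. \<Sum>l=1..m2. a j l * (\<phi> j x * \<psi> l y))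
    = tensor_comb m1 m2 \<phi> \<psi> (\<lambda>l j. a (Suc j) (Suc l)) x y"
proof -
  have "(\<Sum>j=1..m1. \<Sum>l=1..m2. a j l * (\<phi> j x * \<psi> l y))
      = (\<Sum>j<m1. \<Sum>l<m2. a (Suc j) (Suc l) * (\<phi> (Suc j) x * \<psi> (Suc l) y))"
    by (simp add: sum.atLeast1_atMost_eq)
  also have "\<dots> = (\<Sum>l<m2. \<Sum>j<m1. a (Suc j) (Suc l) * (\<phi> (Suc j) x * \<psi> (Suc l) y))" by (rule sum.swap)
  finally show ?thesis by (simp add: tensor_comb_def sum_distrib_right mult.assoc)
qed

lemma tensor_space_iff: "\<tau> \<in> tensor_space \<phi> \<psi> m1 m2 \<longleftrightarrow> (\<exists>a. \<tau> = tensor_comb m1 m2 \<phi> \<psi> a)"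
proof
  assume "\<tau> \<in> tensor_space \<phi> \<psi> m1 m2"
  then obtain a where "\<tau> = (\<lambda>x y. \<Sum>j=1..m1. \<Sum>l=1..m2. a j l * (\<phi> j x * \<psi> l y))"
    by (auto simp: tensor_space_def)
  then show "\<exists>a. \<tau> = tensor_comb m1 m2 \<phi> \<psi> a" unfolding tensor_comb_eq by blast
next
  assume "\<exists>a. \<tau> = tensor_comb m1 m2 \<phi> \<psi> a"
  then obtain a where a: "\<tau> = tensor_comb m1 m2 \<phi> \<psi> a" by blast
  have "\<tau> x y = (\<Sum>j=1..m1. \<Sum>l=1..m2. a (l - 1) (j - 1) * (\<phi> j x * \<psi> l y))" for x y
    unfolding a using tensor_comb_eq[where a = "\<lambda>j l. a (l - 1) (j - 1)" and \<phi> = \<phi> and \<psi> = \<psi> and x = x and y = y, of m2 m1]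
    by simp
  then have "\<tau> = (\<lambda>x y. \<Sum>j=1..m1. \<Sum>l=1..m2. a (l - 1) (j - 1) * (\<phi> j x * \<psi> l y))"
    by (intro ext)
  then show "\<tau> \<in> tensor_space \<phi> \<psi> m1 m2"
    unfolding tensor_space_def by (intro CollectI exI[of _ "\<lambda>j l. a (l - 1) (j - 1)"] conjI TrueI)
qed

lemma least_squares_normal_equations:
  fixes F Z :: "nat \<times> nat \<Rightarrow> real"
  assumes inv: "invertible_mat (mat m m F)" and j: "j < m" and l: "l < n"
  shows "(\<Sum>k<m. F (j, k) * (inv_mat (mat m m F) * mat m n Z) $$ (k, l)) = Z (j, l)"
proof -
  let ?P = "mat m m F" and ?Z = "mat m n Z"
  have P: "?P \<in> carrier_mat m m" and Z: "?Z \<in> carrier_mat m n" by auto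
  note B = inv_mat_inverse[OF P inv]
  have Ac: "inv_mat ?P * ?Z \<in> carrier_mat m n" using B(1) Z by (rule mult_carrier_mat)
  have "?P * (inv_mat ?P * ?Z) = ?Z"
    using assoc_mult_mat[OF P B(1) Z] B(2) Z by simp
  then have "(?P * (inv_mat ?P * ?Z)) $$ (j, l) = Z (j, l)" using j l by simp
  moreover have "(?P * C) $$ (j, l) = (\<Sum>k<m. F (j, k) * C $$ (k, l))" if "C \<in> carrier_mat m n" for C
    using j l that by (simp add: scalar_prod_def atLeast0LessThan)
  ultimately show ?thesis using Ac by simp
qed

text \<open>The statement for fixed \<open>N\<close>, dimensions and lag, with an explicit constant. What remains is bookkeeping: the
matrices in the hypotheses are Gram matrices of \<open>\<pi>\<close> and of the empirical average \<open>R.Av\<close>, the estimator satisfies the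
normal equations, and both norms differ from regression errors by terms with the same expectation.\<close>

lemma oracle_inequality:
  fixes \<phi> \<psi> :: "nat \<Rightarrow> real \<Rightarrow> real"
  assumes T: "0 < T" and sol: "strong_solution M0 (2 * T) b \<sigma> x0 W X" and td: "transition_density M0 X T p"
    and I: "is_interval I" and J: "is_interval J"
    and oI: "orthonormal_family I (max_dim N T) \<phi>" and oJ: "orthonormal_family J (max_dim N T) \<psi>"
    and c: "0 < c" and NT: "1 < real N * T"
    and m1: "m1 \<in> {1..max_dim N T}" and m2: "m2 \<in> {1..max_dim N T}"
    and copies: "independent_copies M0 X (2 * T) b \<sigma> x0 N M Ws Xs"
    and inv: "AE \<omega> in M. invertible_mat (Psi_hat N T Xs \<phi> m1 \<omega>)"
    and LJ: "frakL J \<psi> m2 \<le> ennreal (c * real N ^ q)"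
    and LI: "frakL I \<phi> m1 * ennreal (max (op_norm (inv_mat (Psi (mean_density p x0 T) \<phi> m1))) 1)
       \<le> ennreal (c_Lambda T q / 2 * (real N * T / ln (real N * T)))"
    and t: "t \<in> {0<..T}"
  shows "\<exists>\<tau>.
        is_arg_min (\<lambda>\<tau>. sqnorm_f (mean_density p x0 T) (\<lambda>x y. \<tau> x y - restrict_to I J (p t) x y))
          (\<lambda>\<tau>. \<tau> \<in> tensor_space \<phi> \<psi> m1 m2) \<tau> \<and>
        (\<integral>\<^sup>+\<omega>. sqnorm_N N T Xs \<omega>
            (\<lambda>x y. p_hat N T Xs \<phi> \<psi> m1 m2 t \<omega> x y - restrict_to I J (p t) x y) \<partial>M)
          \<le> sqnorm_f (mean_density p x0 T) (\<lambda>x y. \<tau> x y - restrict_to I J (p t) x y)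
            + 2 * of_nat m1 * frakL J \<psi> m2 / of_nat N + ennreal ((8 * c / T ^ (q + 1)) / real N)"
proof -
  have N: "0 < N" using NT T by (cases "N = 0") auto
  have fst_m: "(fst :: real \<times> real \<Rightarrow> real) \<in> borel_measurable borel"
    and snd_m: "(snd :: real \<times> real \<Rightarrow> real) \<in> borel_measurable borel"
    by (intro borel_measurable_continuous_onI continuous_on_fst continuous_on_snd continuous_on_id)+
  define f where "f = mean_density p x0 T"
  define \<pi> where "\<pi> = mean_occ M0 X T t"
  define F where "F i = vimage_algebra (space M) (path (2 * T) (Xs i)) (path_space (2 * T))" for i
  define \<mu> where "\<mu> i = occ (Xs i) T t" for i
  interpret R: indep_random_measures M N F \<mu> \<pi>
    unfolding F_def[abs_def] \<mu>_def[abs_def] \<pi>_def by (rule independent_copies_random_measures[OF T N sol copies])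
  note sl = transition_density_slice[OF td t]
  note kr = kern_basic[OF sl(1,2,3)]
  have cont: "continuous_on {0..2 * T} (\<lambda>u. Xs i u \<omega>)" if "i \<in> {1..N}" "\<omega> \<in> space M" for i \<omega>
  proof (rule strong_solution_regular(3))
    show "strong_solution M (2 * T) b \<sigma> x0 (Ws i) (Xs i)"
      using copies that by (simp add: independent_copies_def)
  qed (rule that)

  \<comment> \<open>The bound on the Gram condition reads \<open>L\<phi> * \<kappa> \<le> K\<close> in real numbers; finiteness of the left
    factor, hence boundedness of the basis functions, is part of the hypothesis.\<close>
  define K where "K = c_Lambda T q / 2 * (real N * T / ln (real N * T))"
  define \<kappa> where "\<kappa> = max (op_norm (inv_mat (Psi f \<phi> m1))) 1"
  have K0: "0 < K" unfolding K_def by (rule bad_event_contribution(1)[OF T NT _ order_refl _ c, of 0 q]) (use c in auto)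
  have finJ: "frakL J \<psi> m2 \<noteq> \<infinity>" using LJ by (auto simp: top_unique)
  have finI: "frakL I \<phi> m1 \<noteq> \<infinity>"
  proof
    assume "frakL I \<phi> m1 = \<infinity>"
    moreover have "ennreal \<kappa> \<noteq> 0" by (simp add: \<kappa>_def)
    ultimately have "frakL I \<phi> m1 * ennreal \<kappa> = \<infinity>" by (simp add: ennreal_top_mult)
    then show False using LI unfolding \<kappa>_def f_def by (simp add: top_unique)
  qed
  have offI: "\<phi> j x = 0" if "j \<in> {1..max_dim N T}" "x \<notin> I" for j x
    using oI that by (simp add: orthonormal_family_def)
  have offJ: "\<psi> j x = 0" if "j \<in> {1..max_dim N T}" "x \<notin> J" for j x
    using oJ that by (simp add: orthonormal_family_def)
  define L\<phi> where "L\<phi> = enn2real (frakL I \<phi> m1)"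
  define L where "L = enn2real (frakL J \<psi> m2)"
  have L\<phi>: "1 \<le> L\<phi>" "(\<Sum>j<m1. (\<phi> (Suc j) x)\<^sup>2) \<le> L\<phi>" for x
    unfolding L\<phi>_def by (rule frakL_finite_bounds[OF finI]; use offI m1 in auto)+
  have L: "1 \<le> L" "(\<Sum>j<m2. (\<psi> (Suc j) x)\<^sup>2) \<le> L" for x
    unfolding L_def by (rule frakL_finite_bounds[OF finJ]; use offJ m2 in auto)+
  have eL: "frakL J \<psi> m2 = ennreal L" "frakL I \<phi> m1 = ennreal L\<phi>"
    using finI finJ by (simp_all add: L_def L\<phi>_def top.not_eq_extremum)
  have Lc: "L \<le> c * real N ^ q" using LJ L(1) c unfolding eL by (subst (asm) ennreal_le_iff) auto
  have LK: "L\<phi> * \<kappa> \<le> K"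
  proof -
    have "ennreal (L\<phi> * \<kappa>) = ennreal L\<phi> * ennreal \<kappa>" using L\<phi>(1) by (intro ennreal_mult) (auto simp: \<kappa>_def)
    then have "ennreal (L\<phi> * \<kappa>) \<le> ennreal K" using LI unfolding eL K_def \<kappa>_def f_def by simp
    then show ?thesis using K0 by (subst (asm) ennreal_le_iff) auto
  qed

  \<comment> \<open>\<open>P l x\<close> is the coefficient of the restricted density \<open>p t x\<close> on \<open>\<psi> l\<close>. The indicator of \<open>I\<close>
    accounts for the restriction in \<open>x\<close>; the one in \<open>y\<close> is automatic, as \<open>\<psi> l\<close> vanishes off \<open>J\<close>.\<close>
  define \<phi>' where "\<phi>' j = \<phi> (Suc j)" for j
  define \<psi>' where "\<psi>' l = \<psi> (Suc l)" for l
  define P where "P l x = indicator I x * (\<integral>y. \<psi>' l y \<partial>kern (p t) x)" for l x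
  have \<phi>b: "bounded_borel (\<phi>' j)" if "j < m1" for j
    unfolding \<phi>'_def by (rule orthonormal_family_bounded_borel[OF oI I _ finI that]) (use m1 in simp)
  have \<psi>b: "bounded_borel (\<psi>' l)" if "l < m2" for l
    unfolding \<psi>'_def by (rule orthonormal_family_bounded_borel[OF oJ J _ finJ that]) (use m2 in simp)
  have \<phi>off: "\<phi>' j x = 0" if "j < m1" "x \<notin> I" for j x
    using offI[of "Suc j" x] that m1 by (simp add: \<phi>'_def)
  have \<psi>off: "\<psi>' l y = 0" if "l < m2" "y \<notin> J" for l y
    using offJ[of "Suc l" y] that m2 by (simp add: \<psi>'_def)
  have IB: "I \<in> sets borel" "J \<in> sets borel" using I J by (auto intro: real_interval_borel_measurable)
  have indI: "bounded_borel (indicator I :: real \<Rightarrow> real)"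
    by (rule bounded_borelI[of _ 1]) (use IB in \<open>auto simp: indicator_def\<close>)
  have kb: "bounded_borel (\<lambda>x. \<integral>y. \<psi>' l y \<partial>kern (p t) x)" if "l < m2" for l
    by (rule kern_integral_bounded_borel[OF sl(1,2,3) \<psi>b[OF that]])
  have Pb: "bounded_borel (P l)" if "l < m2" for l
    unfolding P_def[abs_def] by (rule bounded_borel_mult[OF indI kb[OF that]])
  have LP: "(\<Sum>l<m2. (P l x)\<^sup>2) \<le> L" for x
  proof -
    have "(\<Sum>l<m2. (P l x)\<^sup>2) \<le> (\<Sum>l<m2. (\<integral>y. \<psi>' l y \<partial>kern (p t) x)\<^sup>2)"
      by (intro sum_mono) (simp add: P_def indicator_def)
    also have "\<dots> \<le> L"
      by (rule kern_sum_squares_le[OF sl(1,2,3) \<psi>b]) (use L in \<open>auto simp: \<psi>'_def\<close>)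
    finally show ?thesis .
  qed
  have f1: "bounded_borel (\<lambda>z :: real \<times> real. g (fst z))" if "bounded_borel g" for g :: "real \<Rightarrow> real"
    by (rule bounded_borel_comp[OF that fst_m])
  have f2: "bounded_borel (\<lambda>z :: real \<times> real. g (snd z))" if "bounded_borel g" for g :: "real \<Rightarrow> real"
    by (rule bounded_borel_comp[OF that snd_m])
  have cond: "(\<integral>z. g (fst z) * (\<psi>' l (snd z) - P l (fst z)) \<partial>\<pi>) = 0"
    if l: "l < m2" and g: "bounded_borel g" and off: "\<And>x. x \<notin> I \<Longrightarrow> g x = 0" for l g
  proof -
    have i1: "integrable \<pi> (\<lambda>z. g (fst z) * \<psi>' l (snd z))"
      by (intro R.integrable_\<pi> bounded_borel_mult f1 f2 g \<psi>b l)
    have i2: "integrable \<pi> (\<lambda>z. g (fst z) * (\<integral>y. \<psi>' l y \<partial>kern (p t) (fst z)))"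
      by (intro R.integrable_\<pi> bounded_borel_mult f1[OF g] f1[OF kb] l)
    have "g x * (\<psi>' l y - P l x) = g x * \<psi>' l y - g x * (\<integral>y. \<psi>' l y \<partial>kern (p t) x)" for x y
      using off[of x] by (cases "x \<in> I") (auto simp: P_def right_diff_distrib)
    then have "(\<integral>z. g (fst z) * (\<psi>' l (snd z) - P l (fst z)) \<partial>\<pi>)
        = (\<integral>z. g (fst z) * \<psi>' l (snd z) \<partial>\<pi>) - (\<integral>z. g (fst z) * (\<integral>y. \<psi>' l y \<partial>kern (p t) (fst z)) \<partial>\<pi>)"
      using i1 i2 by simp
    then show ?thesis unfolding \<pi>_def
      using mean_occ_conditional_mean[OF sol td T t g \<psi>b[OF l]] by simp
  qed

  have bb\<phi>: "bounded_borel (\<lambda>z :: real \<times> real. \<phi>' j (fst z))" if "j < m1" for j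
    by (intro f1 \<phi>b that)
  have Psi_eq: "Psi f \<phi> m1 = mat m1 m1 (\<lambda>(j, k). \<integral>z. \<phi>' j (fst z) * \<phi>' k (fst z) \<partial>\<pi>)"
    unfolding Psi_def
  proof (rule cong_mat)
    fix j k assume jk: "j < m1" "k < m1"
    have m: "(\<lambda>x. \<phi>' j x * \<phi>' k x) \<in> borel_measurable borel"
      by (intro bounded_borel_measurable bounded_borel_mult \<phi>b jk)
    show "(case (j, k) of (j, j') \<Rightarrow> LBINT x. \<phi> (j + 1) x * \<phi> (j' + 1) x * f x)
        = (case (j, k) of (j, k) \<Rightarrow> \<integral>z. \<phi>' j (fst z) * \<phi>' k (fst z) \<partial>\<pi>)"
      using mean_occ_first_marginal_integral[OF sol td T m, of t] by (simp add: \<pi>_def f_def \<phi>'_def)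
  qed auto
  have Av_eq: "R.Av G \<omega> = 1 / (real N * T) * (\<Sum>i=1..N. LBINT s:{0..T}. G (Xs i s \<omega>, Xs i (s + t) \<omega>))"
    if "G \<in> borel_measurable borel" "\<omega> \<in> space M" for G \<omega>
    unfolding R.Av_def \<mu>_def by (rule Av_occ_formula[OF T t cont that(1)]) (use that in auto)
  have Psi_hat_eq: "Psi_hat N T Xs \<phi> m1 \<omega> = mat m1 m1 (\<lambda>(j, k). R.Av (\<lambda>z. \<phi>' j (fst z) * \<phi>' k (fst z)) \<omega>)"
    if w: "\<omega> \<in> space M" for \<omega>
    unfolding Psi_hat_def
  proof (rule cong_mat)
    fix j k assume jk: "j < m1" "k < m1"
    have m: "(\<lambda>z :: real \<times> real. \<phi>' j (fst z) * \<phi>' k (fst z)) \<in> borel_measurable borel"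
      by (intro bounded_borel_measurable bounded_borel_mult bb\<phi> jk)
    show "(case (j, k) of (j, j') \<Rightarrow> 1 / (real N * T) * (\<Sum>i=1..N. LBINT s:{0..T}. \<phi> (j + 1) (Xs i s \<omega>) * \<phi> (j' + 1) (Xs i s \<omega>)))
        = (case (j, k) of (j, k) \<Rightarrow> R.Av (\<lambda>z. \<phi>' j (fst z) * \<phi>' k (fst z)) \<omega>)"
      using Av_eq[OF m w] by (simp add: \<phi>'_def)
  qed auto
  have Z_hat_eq: "Z_hat N T Xs \<phi> \<psi> m1 m2 t \<omega> = mat m1 m2 (\<lambda>(j, l). R.Av (\<lambda>z. \<phi>' j (fst z) * \<psi>' l (snd z)) \<omega>)"
    if w: "\<omega> \<in> space M" for \<omega>
    unfolding Z_hat_def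
  proof (rule cong_mat)
    fix j l assume jl: "j < m1" "l < m2"
    have m: "(\<lambda>z :: real \<times> real. \<phi>' j (fst z) * \<psi>' l (snd z)) \<in> borel_measurable borel"
      by (intro bounded_borel_measurable bounded_borel_mult bb\<phi> f2 \<psi>b jl)
    show "(case (j, l) of (j, l) \<Rightarrow> 1 / (real N * T) * (\<Sum>i=1..N. LBINT s:{0..T}. \<phi> (j + 1) (Xs i s \<omega>) * \<psi> (l + 1) (Xs i (s + t) \<omega>)))
        = (case (j, l) of (j, l) \<Rightarrow> R.Av (\<lambda>z. \<phi>' j (fst z) * \<psi>' l (snd z)) \<omega>)"
      using Av_eq[OF m w] by (simp add: \<phi>'_def \<psi>'_def)
  qed auto
  have "AE \<omega> in M. invertible_mat (mat m1 m1 (\<lambda>(j, k). R.Av (\<lambda>z. \<phi>' j (fst z) * \<phi>' k (fst z)) \<omega>))"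
    using inv AE_space by eventually_elim (simp add: Psi_hat_eq)
  from R.mean_gram_invertible[OF bb\<phi> this] have invPsi: "invertible_mat (Psi f \<phi> m1)"
    unfolding Psi_eq by simp
  have quadPsi: "(\<Sum>j<m1. \<Sum>k<m1. d j * Psi f \<phi> m1 $$ (j, k) * d k) = (\<integral>z. (\<Sum>j<m1. d j * \<phi>' j (fst z))\<^sup>2 \<partial>\<pi>)" for d
  proof -
    have I1: "integrable \<pi> (\<lambda>z. (d j * d k) * (\<phi>' j (fst z) * \<phi>' k (fst z)))" if "j < m1" "k < m1" for j k
      by (intro integrable_mult_right R.integrable_\<pi> bounded_borel_mult bb\<phi> that)
    have "(\<integral>z. (\<Sum>j<m1. d j * \<phi>' j (fst z))\<^sup>2 \<partial>\<pi>)
        = (\<integral>z. (\<Sum>j<m1. \<Sum>k<m1. (d j * d k) * (\<phi>' j (fst z) * \<phi>' k (fst z))) \<partial>\<pi>)"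
      by (simp add: power2_eq_square sum_product mult_ac)
    also have "\<dots> = (\<Sum>j<m1. \<integral>z. (\<Sum>k<m1. (d j * d k) * (\<phi>' j (fst z) * \<phi>' k (fst z))) \<partial>\<pi>)"
      using I1 by (intro Bochner_Integration.integral_sum Bochner_Integration.integrable_sum) auto
    also have "\<dots> = (\<Sum>j<m1. \<Sum>k<m1. \<integral>z. (d j * d k) * (\<phi>' j (fst z) * \<phi>' k (fst z)) \<partial>\<pi>)"
      using I1 by (intro sum.cong refl Bochner_Integration.integral_sum) auto
    also have "\<dots> = (\<Sum>j<m1. \<Sum>k<m1. d j * Psi f \<phi> m1 $$ (j, k) * d k)"
      by (intro sum.cong refl) (simp add: Psi_eq)
    finally show ?thesis by simp
  qed
  have coer: "(\<Sum>j<m1. (d j)\<^sup>2) \<le> \<kappa> * (\<integral>z. (\<Sum>j<m1. d j * \<phi>' j (fst z))\<^sup>2 \<partial>\<pi>)" for d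
  proof -
    have "(\<Sum>j<m1. (d j)\<^sup>2) \<le> op_norm (inv_mat (Psi f \<phi> m1)) * (\<Sum>j<m1. \<Sum>k<m1. d j * Psi f \<phi> m1 $$ (j, k) * d k)"
    proof (rule quadratic_form_ge_op_norm_inverse[OF _ _ invPsi])
      show "Psi f \<phi> m1 \<in> carrier_mat m1 m1" by (simp add: Psi_def)
      show "0 < m1" using m1 by simp
      show "Psi f \<phi> m1 $$ (j, k) = Psi f \<phi> m1 $$ (k, j)" if "j < m1" "k < m1" for j k
        using that by (simp add: Psi_def mult.commute)
      show "0 \<le> (\<Sum>j<m1. \<Sum>k<m1. v j * Psi f \<phi> m1 $$ (j, k) * v k)" for v
        unfolding quadPsi by simp
    qed
    also have "\<dots> \<le> \<kappa> * (\<integral>z. (\<Sum>j<m1. d j * \<phi>' j (fst z))\<^sup>2 \<partial>\<pi>)"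
      unfolding quadPsi \<kappa>_def by (intro mult_right_mono) auto
    finally show ?thesis .
  qed

  obtain b0 V where opt: "\<And>b'. (\<Sum>l<m2. \<integral>z. ((\<Sum>j<m1. b0 l j * \<phi>' j (fst z)) - P l (fst z))\<^sup>2 \<partial>\<pi>)
        \<le> (\<Sum>l<m2. \<integral>z. ((\<Sum>j<m1. b' l j * \<phi>' j (fst z)) - P l (fst z))\<^sup>2 \<partial>\<pi>)"
    and Vm: "V \<in> borel_measurable M" and V0: "\<And>\<omega>. 0 \<le> V \<omega>"
    and VE: "(\<integral>\<^sup>+\<omega>. ennreal (V \<omega>) \<partial>M) \<le> ennreal (2 * real m1 * L / real N + 4 * L * (real m1 * exp (- ((1 - ln 2) * real N / (2 * K)))))"
    and Vreg: "\<And>\<omega> a. \<omega> \<in> space M \<Longrightarrow>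
       (\<And>j l. j < m1 \<Longrightarrow> l < m2 \<Longrightarrow> R.Av (\<lambda>z. \<phi>' j (fst z) * (\<Sum>k<m1. a l k * \<phi>' k (fst z))) \<omega>
            = R.Av (\<lambda>z. \<phi>' j (fst z) * \<psi>' l (snd z)) \<omega>) \<Longrightarrow>
       (\<Sum>l<m2. R.Av (\<lambda>z. ((\<Sum>j<m1. a l j * \<phi>' j (fst z)) - P l (fst z))\<^sup>2) \<omega>)
       \<le> (\<Sum>l<m2. R.Av (\<lambda>z. ((\<Sum>j<m1. b0 l j * \<phi>' j (fst z)) - P l (fst z))\<^sup>2) \<omega>) + V \<omega>"
    by (rule R.regression_oracle[of m1 \<phi>' I \<kappa> L\<phi> K m2 \<psi>' P L])
      (use \<phi>b \<phi>off coer L\<phi>(2) LK K0 \<psi>b Pb L(2) LP cond in \<open>auto simp: \<phi>'_def \<psi>'_def\<close>)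

  \<comment> \<open>At each \<open>x\<close> the integral in \<open>y\<close> is \<open>S a x\<close>, a regression error, plus \<open>n' x\<close>, the energy of the
    density outside the span of the \<open>\<psi> l\<close>. The remainder \<open>n'\<close> may be infinite, which is why it stays in
    \<open>ennreal\<close>: it appears with the same expectation on both sides of the inequality.\<close>
  define rp where "rp = restrict_to I J (p t)"
  define S where "S a x = (\<Sum>l<m2. ((\<Sum>j<m1. a l j * \<phi>' j x) - P l x)\<^sup>2)" for a x
  define n' where "n' x = (\<integral>\<^sup>+y. ennreal (((\<Sum>l<m2. P l x * \<psi>' l y) - rp x y)\<^sup>2) \<partial>lborel)" for x
  have rp_eq: "rp x y = indicator I x * indicator J y * p t x y" for x y
    by (simp add: rp_def restrict_to_def indicator_def)
  have pm[measurable]: "(\<lambda>z. p t (fst z) (snd z)) \<in> borel_measurable (borel \<Otimes>\<^sub>M lborel)"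
    using sl(1) by (simp add: borel_prod[symmetric] case_prod_unfold cong: measurable_cong_sets)
  have rpm: "(\<lambda>z. rp (fst z) (snd z)) \<in> borel_measurable (borel \<Otimes>\<^sub>M lborel)"
    unfolding rp_eq using IB by measurable
  have p_int: "integrable lborel (p t x)" for x
    by (rule integrableI_nonneg) (use kr(5) sl(2,3) in auto)
  have rp_int: "integrable lborel (rp x)" for x
  proof (rule Bochner_Integration.integrable_bound[OF p_int[of x]])
    show "rp x \<in> borel_measurable lborel" unfolding rp_eq[abs_def] using kr(5)[of x] IB by measurable
    show "AE y in lborel. norm (rp x y) \<le> norm (p t x y)" using sl(2) by (auto simp: rp_eq indicator_def)
  qed
  have PL: "P l x = (\<integral>y. rp x y * \<psi>' l y \<partial>lborel)" if l: "l < m2" for l x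
  proof -
    have e: "rp x y * \<psi>' l y = indicator I x * (p t x y * \<psi>' l y)" for y
      using \<psi>off[OF l, of y] by (cases "y \<in> J") (auto simp: rp_eq)
    show ?thesis unfolding P_def e using kr(4)[OF bounded_borel_measurable[OF \<psi>b[OF l]], of x] by simp
  qed
  have inner: "(\<integral>\<^sup>+y. ennreal ((tensor_comb m1 m2 \<phi> \<psi> a x y - rp x y)\<^sup>2) \<partial>lborel) = ennreal (S a x) + n' x" for a x
  proof -
    have \<psi>int: "integrable lborel (\<lambda>y. \<psi>' l y * \<psi>' k y)" "(\<integral>y. \<psi>' l y * \<psi>' k y \<partial>lborel) = (if l = k then 1 else 0)"
      if "l < m2" "k < m2" for l k
      using oJ m2 that by (simp_all add: orthonormal_family_def \<psi>'_def)
    have "(\<integral>\<^sup>+y. ennreal (((\<Sum>l<m2. (\<Sum>j<m1. a l j * \<phi>' j x) * \<psi>' l y) - rp x y)\<^sup>2) \<partial>lborel)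
        = ennreal (\<Sum>l<m2. ((\<Sum>j<m1. a l j * \<phi>' j x) - (\<integral>y. rp x y * \<psi>' l y \<partial>lborel))\<^sup>2)
          + (\<integral>\<^sup>+y. ennreal (((\<Sum>l<m2. (\<integral>y. rp x y * \<psi>' l y \<partial>lborel) * \<psi>' l y) - rp x y)\<^sup>2) \<partial>lborel)"
      by (rule nn_integral_square_decomposition[OF \<psi>b \<psi>int rp_int])
    then show ?thesis by (simp add: tensor_comb_def \<phi>'_def[symmetric] \<psi>'_def[symmetric] S_def n'_def PL)
  qed
  have Sb: "bounded_borel (S a)" for a
    unfolding S_def[abs_def]
    by (intro bounded_borel_sum bounded_borel_power2 bounded_borel_diff bounded_borel_cmult \<phi>b Pb) auto
  have S0: "0 \<le> S a x" for a x unfolding S_def by (intro sum_nonneg) auto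
  have Sl: "bounded_borel (\<lambda>z :: real \<times> real. ((\<Sum>j<m1. a l j * \<phi>' j (fst z)) - P l (fst z))\<^sup>2)" if "l < m2" for a l
    using that by (intro bounded_borel_sum bounded_borel_power2 bounded_borel_diff bounded_borel_cmult bb\<phi> f1 Pb) auto
  have n'm: "n' \<in> borel_measurable borel"
  proof -
    have [measurable]: "P l \<in> borel_measurable borel" "\<psi>' l \<in> borel_measurable borel" if "l < m2" for l
      using Pb[OF that] \<psi>b[OF that] by (auto simp: bounded_borel_def)
    note rpm[measurable]
    show ?thesis unfolding n'_def[abs_def]
      by (rule lborel.borel_measurable_nn_integral) (simp add: case_prod_unfold)
  qed
  have innerm: "(\<lambda>x. ennreal (S a x) + n' x) \<in> borel_measurable borel" for a
    using n'm bounded_borel_measurable[OF Sb] by measurable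
  have norm_f: "sqnorm_f f (\<lambda>x y. tensor_comb m1 m2 \<phi> \<psi> a x y - rp x y)
      = ennreal (\<Sum>l<m2. \<integral>z. ((\<Sum>j<m1. a l j * \<phi>' j (fst z)) - P l (fst z))\<^sup>2 \<partial>\<pi>) + (\<integral>\<^sup>+z. n' (fst z) \<partial>\<pi>)" for a
  proof -
    have "sqnorm_f f (\<lambda>x y. tensor_comb m1 m2 \<phi> \<psi> a x y - rp x y) = (\<integral>\<^sup>+x. (ennreal (S a x) + n' x) * ennreal (f x) \<partial>lborel)"
      unfolding sqnorm_f_def
    proof (intro nn_integral_cong)
      fix x
      have "rp x \<in> borel_measurable borel" using rp_int[of x] borel_measurable_integrable by fastforce
      then have [measurable]: "(\<lambda>y. tensor_comb m1 m2 \<phi> \<psi> a x y - rp x y) \<in> borel_measurable borel"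
        unfolding tensor_comb_def \<psi>'_def[symmetric]
        using bounded_borel_measurable[OF \<psi>b] by (intro borel_measurable_diff borel_measurable_sum borel_measurable_times) auto
      have "(\<integral>\<^sup>+y. ennreal ((tensor_comb m1 m2 \<phi> \<psi> a x y - rp x y)\<^sup>2 * f x) \<partial>lborel)
          = (\<integral>\<^sup>+y. ennreal ((tensor_comb m1 m2 \<phi> \<psi> a x y - rp x y)\<^sup>2) * ennreal (f x) \<partial>lborel)"
        using mean_density_nonneg[OF td T] by (intro nn_integral_cong ennreal_mult) (auto simp: f_def)
      also have "\<dots> = (\<integral>\<^sup>+y. ennreal ((tensor_comb m1 m2 \<phi> \<psi> a x y - rp x y)\<^sup>2) \<partial>lborel) * ennreal (f x)"
        by (rule nn_integral_multc) measurable
      finally show "(\<integral>\<^sup>+y. ennreal ((tensor_comb m1 m2 \<phi> \<psi> a x y - rp x y)\<^sup>2 * f x) \<partial>lborel)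
          = (ennreal (S a x) + n' x) * ennreal (f x)" unfolding inner .
    qed
    also have "\<dots> = (\<integral>\<^sup>+z. ennreal (S a (fst z)) + n' (fst z) \<partial>\<pi>)"
      unfolding f_def \<pi>_def by (rule mean_occ_first_marginal[OF sol td T innerm, symmetric])
    also have "\<dots> = (\<integral>\<^sup>+z. ennreal (S a (fst z)) \<partial>\<pi>) + (\<integral>\<^sup>+z. n' (fst z) \<partial>\<pi>)"
    proof (rule nn_integral_add)
      show "(\<lambda>z. ennreal (S a (fst z))) \<in> borel_measurable \<pi>" "(\<lambda>z. n' (fst z)) \<in> borel_measurable \<pi>"
        using bounded_borel_measurable[OF f1[OF Sb]] measurable_compose[OF fst_m n'm] R.\<pi>_sets
        by (auto cong: measurable_cong_sets)
    qed
    also have "(\<integral>\<^sup>+z. ennreal (S a (fst z)) \<partial>\<pi>) = ennreal (\<integral>z. S a (fst z) \<partial>\<pi>)"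
      by (intro nn_integral_eq_integral R.integrable_\<pi> f1 Sb) (simp add: S0)
    also have "(\<integral>z. S a (fst z) \<partial>\<pi>) = (\<Sum>l<m2. \<integral>z. ((\<Sum>j<m1. a l j * \<phi>' j (fst z)) - P l (fst z))\<^sup>2 \<partial>\<pi>)"
      unfolding S_def by (intro Bochner_Integration.integral_sum R.integrable_\<pi> Sl) auto
    finally show ?thesis .
  qed
  define nh where "nh \<omega> = ennreal (1 / real N) * (\<Sum>i=1..N. \<integral>\<^sup>+z. n' (fst z) \<partial>\<mu> i \<omega>)" for \<omega>
  have norm_N: "sqnorm_N N T Xs \<omega> (\<lambda>x y. tensor_comb m1 m2 \<phi> \<psi> a x y - rp x y)
      = ennreal (\<Sum>l<m2. R.Av (\<lambda>z. ((\<Sum>j<m1. a l j * \<phi>' j (fst z)) - P l (fst z))\<^sup>2) \<omega>) + nh \<omega>"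
    if w: "\<omega> \<in> space M" for a \<omega>
  proof -
    have one: "(\<integral>\<^sup>+s\<in>{0..T}. (\<integral>\<^sup>+y. ennreal ((tensor_comb m1 m2 \<phi> \<psi> a (Xs i s \<omega>) y - rp (Xs i s \<omega>) y)\<^sup>2) \<partial>lborel) \<partial>lborel)
        = ennreal T * (ennreal (\<integral>z. S a (fst z) \<partial>\<mu> i \<omega>) + (\<integral>\<^sup>+z. n' (fst z) \<partial>\<mu> i \<omega>))" if i: "i \<in> {1..N}" for i
    proof -
      have "(\<integral>\<^sup>+s\<in>{0..T}. (\<integral>\<^sup>+y. ennreal ((tensor_comb m1 m2 \<phi> \<psi> a (Xs i s \<omega>) y - rp (Xs i s \<omega>) y)\<^sup>2) \<partial>lborel) \<partial>lborel)
          = ennreal T * (\<integral>\<^sup>+z. ennreal (S a (fst z)) + n' (fst z) \<partial>\<mu> i \<omega>)"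
        unfolding inner \<mu>_def by (rule occ_nn_integral_first[where X = "Xs i", OF T cont[OF i w] innerm])
      also have "(\<integral>\<^sup>+z. ennreal (S a (fst z)) + n' (fst z) \<partial>\<mu> i \<omega>)
          = (\<integral>\<^sup>+z. ennreal (S a (fst z)) \<partial>\<mu> i \<omega>) + (\<integral>\<^sup>+z. n' (fst z) \<partial>\<mu> i \<omega>)"
      proof (rule nn_integral_add)
        show "(\<lambda>z. ennreal (S a (fst z))) \<in> borel_measurable (\<mu> i \<omega>)" "(\<lambda>z. n' (fst z)) \<in> borel_measurable (\<mu> i \<omega>)"
          using bounded_borel_measurable[OF f1[OF Sb]] measurable_compose[OF fst_m n'm] R.\<mu>_sets[OF i w]
          by (auto cong: measurable_cong_sets)
      qed
      also have "(\<integral>\<^sup>+z. ennreal (S a (fst z)) \<partial>\<mu> i \<omega>) = ennreal (\<integral>z. S a (fst z) \<partial>\<mu> i \<omega>)"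
        by (intro nn_integral_eq_integral R.integrable_\<mu> f1 Sb i w) (simp add: S0)
      finally show ?thesis .
    qed
    have "sqnorm_N N T Xs \<omega> (\<lambda>x y. tensor_comb m1 m2 \<phi> \<psi> a x y - rp x y)
        = ennreal (1 / (real N * T)) * (\<Sum>i=1..N. ennreal T * (ennreal (\<integral>z. S a (fst z) \<partial>\<mu> i \<omega>) + (\<integral>\<^sup>+z. n' (fst z) \<partial>\<mu> i \<omega>)))"
      unfolding sqnorm_N_def by (intro arg_cong2[where f = "(*)"] sum.cong refl one)
    also have "\<dots> = (ennreal (1 / (real N * T)) * ennreal T) * (\<Sum>i=1..N. ennreal (\<integral>z. S a (fst z) \<partial>\<mu> i \<omega>) + (\<integral>\<^sup>+z. n' (fst z) \<partial>\<mu> i \<omega>))"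
      by (simp add: sum_distrib_left[symmetric] mult.assoc)
    also have "ennreal (1 / (real N * T)) * ennreal T = ennreal (1 / real N)"
      using T N by (simp add: ennreal_mult[symmetric])
    also have "ennreal (1 / real N) * (\<Sum>i=1..N. ennreal (\<integral>z. S a (fst z) \<partial>\<mu> i \<omega>) + (\<integral>\<^sup>+z. n' (fst z) \<partial>\<mu> i \<omega>))
        = ennreal (1 / real N) * (\<Sum>i=1..N. ennreal (\<integral>z. S a (fst z) \<partial>\<mu> i \<omega>)) + nh \<omega>"
      by (simp add: sum.distrib distrib_left nh_def)
    also have "ennreal (1 / real N) * (\<Sum>i=1..N. ennreal (\<integral>z. S a (fst z) \<partial>\<mu> i \<omega>)) = ennreal (R.Av (\<lambda>z. S a (fst z)) \<omega>)"
    proof -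
      have e: "(\<Sum>i=1..N. ennreal (\<integral>z. S a (fst z) \<partial>\<mu> i \<omega>)) = ennreal (\<Sum>i=1..N. \<integral>z. S a (fst z) \<partial>\<mu> i \<omega>)"
        by (intro sum_ennreal integral_nonneg_AE) (simp add: S0)
      have "0 \<le> (\<Sum>i=1..N. \<integral>z. S a (fst z) \<partial>\<mu> i \<omega>)" by (intro sum_nonneg integral_nonneg_AE) (simp add: S0)
      then show ?thesis unfolding R.Av_def e by (intro ennreal_mult[symmetric]) auto
    qed
    also have "R.Av (\<lambda>z. S a (fst z)) \<omega> = (\<Sum>l<m2. R.Av (\<lambda>z. ((\<Sum>j<m1. a l j * \<phi>' j (fst z)) - P l (fst z))\<^sup>2) \<omega>)"
      unfolding S_def using w Sl by (intro R.Av_sum) auto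
    finally show ?thesis .
  qed
  have nh_mean: "(\<integral>\<^sup>+\<omega>. nh \<omega> \<partial>M) = (\<integral>\<^sup>+z. n' (fst z) \<partial>\<pi>)" and nh_m: "nh \<in> borel_measurable M"
  proof -
    have n'f: "(\<lambda>z :: real \<times> real. n' (fst z)) \<in> borel_measurable borel" by (rule measurable_compose[OF fst_m n'm])
    have m: "(\<lambda>\<omega>. \<integral>\<^sup>+z. n' (fst z) \<partial>\<mu> i \<omega>) \<in> borel_measurable M" if "i \<in> {1..N}" for i
      by (rule R.F_measurable[OF that R.nn_measurable[OF that n'f]])
    then have ms: "(\<lambda>\<omega>. \<Sum>i=1..N. \<integral>\<^sup>+z. n' (fst z) \<partial>\<mu> i \<omega>) \<in> borel_measurable M"
      by (rule borel_measurable_sum)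
    show "nh \<in> borel_measurable M" unfolding nh_def[abs_def] using ms by measurable
    have "(\<integral>\<^sup>+\<omega>. nh \<omega> \<partial>M) = ennreal (1 / real N) * (\<Sum>i=1..N. \<integral>\<^sup>+\<omega>. \<integral>\<^sup>+z. n' (fst z) \<partial>\<mu> i \<omega> \<partial>M)"
      unfolding nh_def nn_integral_cmult[OF ms] by (intro arg_cong2[where f = "(*)"] refl nn_integral_sum m)
    also have "\<dots> = ennreal (1 / real N) * (\<Sum>i=1..N. \<integral>\<^sup>+z. n' (fst z) \<partial>\<pi>)"
      by (intro arg_cong2[where f = "(*)"] sum.cong refl R.nn_mean n'f) auto
    also have "\<dots> = (ennreal (1 / real N) * of_nat N) * (\<integral>\<^sup>+z. n' (fst z) \<partial>\<pi>)" by (simp add: mult.assoc)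
    also have "ennreal (1 / real N) * of_nat N = 1"
      using N by (simp add: ennreal_of_nat_eq_real_of_nat ennreal_mult[symmetric])
    finally show "(\<integral>\<^sup>+\<omega>. nh \<omega> \<partial>M) = (\<integral>\<^sup>+z. n' (fst z) \<partial>\<pi>)" by simp
  qed

  define \<tau> where "\<tau> = tensor_comb m1 m2 \<phi> \<psi> b0"
  have min: "is_arg_min (\<lambda>\<tau>. sqnorm_f f (\<lambda>x y. \<tau> x y - rp x y)) (\<lambda>\<tau>. \<tau> \<in> tensor_space \<phi> \<psi> m1 m2) \<tau>"
    unfolding is_arg_min_def tensor_space_iff \<tau>_def
  proof (intro conjI notI)
    show "\<exists>a. tensor_comb m1 m2 \<phi> \<psi> b0 = tensor_comb m1 m2 \<phi> \<psi> a" by blast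
    assume "\<exists>y. (\<exists>a. y = tensor_comb m1 m2 \<phi> \<psi> a) \<and>
        sqnorm_f f (\<lambda>x ya. y x ya - rp x ya) < sqnorm_f f (\<lambda>x y. tensor_comb m1 m2 \<phi> \<psi> b0 x y - rp x y)"
    then obtain a where "sqnorm_f f (\<lambda>x y. tensor_comb m1 m2 \<phi> \<psi> a x y - rp x y) < sqnorm_f f (\<lambda>x y. tensor_comb m1 m2 \<phi> \<psi> b0 x y - rp x y)"
      by blast
    moreover have "sqnorm_f f (\<lambda>x y. tensor_comb m1 m2 \<phi> \<psi> b0 x y - rp x y) \<le> sqnorm_f f (\<lambda>x y. tensor_comb m1 m2 \<phi> \<psi> a x y - rp x y)"
      unfolding norm_f using opt by (intro add_right_mono ennreal_leI) auto
    ultimately show False by simp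
  qed
  let ?A0 = "\<lambda>\<omega>. \<Sum>l<m2. R.Av (\<lambda>z. ((\<Sum>j<m1. b0 l j * \<phi>' j (fst z)) - P l (fst z))\<^sup>2) \<omega>"
  have path: "sqnorm_N N T Xs \<omega> (\<lambda>x y. p_hat N T Xs \<phi> \<psi> m1 m2 t \<omega> x y - rp x y)
      \<le> ennreal (?A0 \<omega>) + nh \<omega> + ennreal (V \<omega>)"
    if w: "\<omega> \<in> space M" and iv: "invertible_mat (Psi_hat N T Xs \<phi> m1 \<omega>)" for \<omega>
  proof -
    define C where "C = inv_mat (Psi_hat N T Xs \<phi> m1 \<omega>) * Z_hat N T Xs \<phi> \<psi> m1 m2 t \<omega>"
    define a where "a l j = C $$ (j, l)" for l j
    have ph: "p_hat N T Xs \<phi> \<psi> m1 m2 t \<omega> = tensor_comb m1 m2 \<phi> \<psi> a"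
    proof (intro ext)
      fix x y
      show "p_hat N T Xs \<phi> \<psi> m1 m2 t \<omega> x y = tensor_comb m1 m2 \<phi> \<psi> a x y"
        unfolding p_hat_def C_def[symmetric]
        using tensor_comb_eq[where a = "\<lambda>j l. C $$ (j - 1, l - 1)" and \<phi> = \<phi> and \<psi> = \<psi> and x = x and y = y, of m2 m1]
        by (simp add: a_def[abs_def])
    qed
    have ne: "R.Av (\<lambda>z. \<phi>' j (fst z) * (\<Sum>k<m1. a l k * \<phi>' k (fst z))) \<omega> = R.Av (\<lambda>z. \<phi>' j (fst z) * \<psi>' l (snd z)) \<omega>"
      if jl: "j < m1" "l < m2" for j l
    proof -
      have "R.Av (\<lambda>z. \<phi>' j (fst z) * (\<Sum>k<m1. a l k * \<phi>' k (fst z))) \<omega>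
          = R.Av (\<lambda>z. \<Sum>k<m1. a l k * (\<phi>' j (fst z) * \<phi>' k (fst z))) \<omega>"
        by (simp add: sum_distrib_left mult_ac)
      also have "\<dots> = (\<Sum>k<m1. R.Av (\<lambda>z. a l k * (\<phi>' j (fst z) * \<phi>' k (fst z))) \<omega>)"
        using w jl by (intro R.Av_sum bounded_borel_cmult bounded_borel_mult bb\<phi>) auto
      also have "\<dots> = (\<Sum>k<m1. R.Av (\<lambda>z. \<phi>' j (fst z) * \<phi>' k (fst z)) \<omega> * C $$ (k, l))"
        by (simp add: R.Av_cmult a_def mult.commute)
      also have "\<dots> = R.Av (\<lambda>z. \<phi>' j (fst z) * \<psi>' l (snd z)) \<omega>"
        using least_squares_normal_equations[OF iv[unfolded Psi_hat_eq[OF w]] jl,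
            of "\<lambda>(j, l). R.Av (\<lambda>z. \<phi>' j (fst z) * \<psi>' l (snd z)) \<omega>"]
        by (simp add: C_def Psi_hat_eq[OF w] Z_hat_eq[OF w])
      finally show ?thesis .
    qed
    have A0: "0 \<le> ?A0 \<omega>" by (intro sum_nonneg R.Av_nonneg w) auto
    have "ennreal (\<Sum>l<m2. R.Av (\<lambda>z. ((\<Sum>j<m1. a l j * \<phi>' j (fst z)) - P l (fst z))\<^sup>2) \<omega>) \<le> ennreal (?A0 \<omega> + V \<omega>)"
      by (rule ennreal_leI[OF Vreg[OF w ne]])
    also have "\<dots> = ennreal (?A0 \<omega>) + ennreal (V \<omega>)" using A0 V0 by (rule ennreal_plus)
    finally show ?thesis unfolding ph norm_N[OF w] by (simp add: add_right_mono add.assoc add.commute add.left_commute)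
  qed
  have A0m: "?A0 \<in> borel_measurable M" using Sl by (intro borel_measurable_sum R.Av_measurable) auto
  have A0E: "(\<integral>\<^sup>+\<omega>. ennreal (?A0 \<omega>) \<partial>M) = ennreal (\<Sum>l<m2. \<integral>z. ((\<Sum>j<m1. b0 l j * \<phi>' j (fst z)) - P l (fst z))\<^sup>2 \<partial>\<pi>)"
  proof -
    have I1: "integrable M (R.Av (\<lambda>z. ((\<Sum>j<m1. b0 l j * \<phi>' j (fst z)) - P l (fst z))\<^sup>2))" if "l < m2" for l
      using R.Av_mean[OF Sl[OF that]] by blast
    have "(\<integral>\<^sup>+\<omega>. ennreal (?A0 \<omega>) \<partial>M) = ennreal (\<integral>\<omega>. ?A0 \<omega> \<partial>M)"
      using I1 by (intro nn_integral_eq_integral Bochner_Integration.integrable_sum AE_I2 sum_nonneg R.Av_nonneg) auto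
    also have "(\<integral>\<omega>. ?A0 \<omega> \<partial>M) = (\<Sum>l<m2. \<integral>\<omega>. R.Av (\<lambda>z. ((\<Sum>j<m1. b0 l j * \<phi>' j (fst z)) - P l (fst z))\<^sup>2) \<omega> \<partial>M)"
      using I1 by (intro Bochner_Integration.integral_sum) auto
    also have "\<dots> = (\<Sum>l<m2. \<integral>z. ((\<Sum>j<m1. b0 l j * \<phi>' j (fst z)) - P l (fst z))\<^sup>2 \<partial>\<pi>)"
      using R.Av_mean[OF Sl] by (intro sum.cong refl) auto
    finally show ?thesis .
  qed
  have "(\<integral>\<^sup>+\<omega>. sqnorm_N N T Xs \<omega> (\<lambda>x y. p_hat N T Xs \<phi> \<psi> m1 m2 t \<omega> x y - rp x y) \<partial>M)
      \<le> (\<integral>\<^sup>+\<omega>. ennreal (?A0 \<omega>) + nh \<omega> + ennreal (V \<omega>) \<partial>M)"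
  proof (rule nn_integral_mono_AE)
    show "AE \<omega> in M. sqnorm_N N T Xs \<omega> (\<lambda>x y. p_hat N T Xs \<phi> \<psi> m1 m2 t \<omega> x y - rp x y) \<le> ennreal (?A0 \<omega>) + nh \<omega> + ennreal (V \<omega>)"
      using inv AE_space by eventually_elim (rule path)
  qed
  also have "\<dots> = (\<integral>\<^sup>+\<omega>. ennreal (?A0 \<omega>) \<partial>M) + (\<integral>\<^sup>+\<omega>. nh \<omega> \<partial>M) + (\<integral>\<^sup>+\<omega>. ennreal (V \<omega>) \<partial>M)"
    using A0m nh_m Vm by (simp add: nn_integral_add)
  also have "\<dots> = sqnorm_f f (\<lambda>x y. \<tau> x y - rp x y) + (\<integral>\<^sup>+\<omega>. ennreal (V \<omega>) \<partial>M)"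
    unfolding A0E nh_mean \<tau>_def norm_f by simp
  also have "\<dots> \<le> sqnorm_f f (\<lambda>x y. \<tau> x y - rp x y) + (ennreal (2 * real m1 * L / real N) + ennreal ((8 * c / T ^ (q + 1)) / real N))"
  proof (rule add_left_mono)
    have "4 * L * (real m1 * exp (- ((1 - ln 2) * real N / (2 * K)))) \<le> (8 * c / T ^ (q + 1)) / real N"
      unfolding K_def by (rule bad_event_contribution(2)[OF T NT _ _ Lc c]) (use m1 L in auto)
    then have "(\<integral>\<^sup>+\<omega>. ennreal (V \<omega>) \<partial>M) \<le> ennreal (2 * real m1 * L / real N + (8 * c / T ^ (q + 1)) / real N)"
      by (intro order_trans[OF VE] ennreal_leI) simp
    also have "\<dots> = ennreal (2 * real m1 * L / real N) + ennreal ((8 * c / T ^ (q + 1)) / real N)"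
      using L c T by (intro ennreal_plus) auto
    finally show "(\<integral>\<^sup>+\<omega>. ennreal (V \<omega>) \<partial>M) \<le> ennreal (2 * real m1 * L / real N) + ennreal ((8 * c / T ^ (q + 1)) / real N)" .
  qed
  also have "ennreal (2 * real m1 * L / real N) = 2 * of_nat m1 * frakL J \<psi> m2 / of_nat N"
  proof -
    have "ennreal (2 * real m1 * L / real N) = ennreal (2 * real m1 * L) / ennreal (real N)"
      using N L by (intro divide_ennreal[symmetric]) auto
    also have "ennreal (2 * real m1 * L) = 2 * of_nat m1 * frakL J \<psi> m2"
      using L unfolding eL by (simp add: ennreal_mult ennreal_of_nat_eq_real_of_nat)
    finally show ?thesis by (simp add: ennreal_of_nat_eq_real_of_nat)
  qed
  finally have "(\<integral>\<^sup>+\<omega>. sqnorm_N N T Xs \<omega> (\<lambda>x y. p_hat N T Xs \<phi> \<psi> m1 m2 t \<omega> x y - rp x y) \<partial>M)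
      \<le> sqnorm_f f (\<lambda>x y. \<tau> x y - rp x y) + 2 * of_nat m1 * frakL J \<psi> m2 / of_nat N
        + ennreal ((8 * c / T ^ (q + 1)) / real N)" by (simp add: add.assoc)
  then show ?thesis using min unfolding f_def rp_def by blast
qed

theorem theorem4p2:
  fixes T x0 \<alpha> A c :: real and q :: nat
    and b \<sigma> :: "real \<Rightarrow> real"
    and M0 :: "'b measure" and W X :: "real \<Rightarrow> 'b \<Rightarrow> real"
    and p :: "real \<Rightarrow> real \<Rightarrow> real \<Rightarrow> real"
    and I J :: "real set"
    and \<phi> \<psi> :: "nat \<Rightarrow> nat \<Rightarrow> real \<Rightarrow> real"
  assumes "T > 0"
    and "b C1_differentiable_on UNIV" and "bounded (range (deriv b))"
    and "\<sigma> C1_differentiable_on UNIV" and "bounded (range (deriv \<sigma>))"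
    and "\<alpha> > 0" and "A > 0"
    and "\<forall>x. \<alpha> \<le> \<bar>\<sigma> x\<bar> \<and> \<bar>\<sigma> x\<bar> \<le> \<alpha> + A"
    and "strong_solution M0 (2 * T) b \<sigma> x0 W X"
    and "transition_density M0 X T p"
    and "is_interval I" and "I \<noteq> {}" and "is_interval J" and "J \<noteq> {}"
    and "\<forall>N. real N * T > 1 \<longrightarrow>
           orthonormal_family I (max_dim N T) (\<phi> N) \<and> orthonormal_family J (max_dim N T) (\<psi> N)"
    and "c > 0" and "q \<ge> 1"
  shows "\<exists>C>0. \<forall>N m1 m2. \<forall>(M :: 'a measure) Ws Xs.
     real N * T > 1 \<longrightarrow>
     m1 \<in> {1..max_dim N T} \<longrightarrow> m2 \<in> {1..max_dim N T} \<longrightarrow>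
     independent_copies M0 X (2 * T) b \<sigma> x0 N M Ws Xs \<longrightarrow>
     (AE \<omega> in M. invertible_mat (Psi_hat N T Xs (\<phi> N) m1 \<omega>)) \<longrightarrow>
     frakL J (\<psi> N) m2 \<le> ennreal (c * real N ^ q) \<longrightarrow>
     frakL I (\<phi> N) m1 * ennreal (max (op_norm (inv_mat (Psi (mean_density p x0 T) (\<phi> N) m1))) 1)
       \<le> ennreal (c_Lambda T q / 2 * (real N * T / ln (real N * T))) \<longrightarrow>
     (\<forall>t\<in>{0<..T}. \<exists>\<tau>.
        is_arg_min (\<lambda>\<tau>. sqnorm_f (mean_density p x0 T) (\<lambda>x y. \<tau> x y - restrict_to I J (p t) x y))
          (\<lambda>\<tau>. \<tau> \<in> tensor_space (\<phi> N) (\<psi> N) m1 m2) \<tau> \<and>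
        (\<integral>\<^sup>+\<omega>. sqnorm_N N T Xs \<omega>
            (\<lambda>x y. p_hat N T Xs (\<phi> N) (\<psi> N) m1 m2 t \<omega> x y - restrict_to I J (p t) x y) \<partial>M)
          \<le> sqnorm_f (mean_density p x0 T) (\<lambda>x y. \<tau> x y - restrict_to I J (p t) x y)
            + 2 * of_nat m1 * frakL J (\<psi> N) m2 / of_nat N + ennreal (C / real N))"
proof -
  have pos: "0 < 8 * c / T ^ (q + 1)" using assms(1,16) by simp
  show ?thesis
  proof (intro exI[of _ "8 * c / T ^ (q + 1)"] conjI pos allI impI ballI)
    fix N m1 m2 :: nat and M :: "'a measure" and Ws Xs :: "nat \<Rightarrow> real \<Rightarrow> 'a \<Rightarrow> real" and t :: real
    assume NT: "1 < real N * T"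
      and hyps: "m1 \<in> {1..max_dim N T}" "m2 \<in> {1..max_dim N T}"
        "independent_copies M0 X (2 * T) b \<sigma> x0 N M Ws Xs"
        "AE \<omega> in M. invertible_mat (Psi_hat N T Xs (\<phi> N) m1 \<omega>)"
        "frakL J (\<psi> N) m2 \<le> ennreal (c * real N ^ q)"
        "frakL I (\<phi> N) m1 * ennreal (max (op_norm (inv_mat (Psi (mean_density p x0 T) (\<phi> N) m1))) 1)
          \<le> ennreal (c_Lambda T q / 2 * (real N * T / ln (real N * T)))"
        "t \<in> {0<..T}"
    have "orthonormal_family I (max_dim N T) (\<phi> N)" "orthonormal_family J (max_dim N T) (\<psi> N)"
      using assms(15) NT by auto
    from oracle_inequality[OF assms(1) assms(9,10) assms(11,13) this assms(16) NT hyps]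
    show "\<exists>\<tau>.
        is_arg_min (\<lambda>\<tau>. sqnorm_f (mean_density p x0 T) (\<lambda>x y. \<tau> x y - restrict_to I J (p t) x y))
          (\<lambda>\<tau>. \<tau> \<in> tensor_space (\<phi> N) (\<psi> N) m1 m2) \<tau> \<and>
        (\<integral>\<^sup>+\<omega>. sqnorm_N N T Xs \<omega>
            (\<lambda>x y. p_hat N T Xs (\<phi> N) (\<psi> N) m1 m2 t \<omega> x y - restrict_to I J (p t) x y) \<partial>M)
          \<le> sqnorm_f (mean_density p x0 T) (\<lambda>x y. \<tau> x y - restrict_to I J (p t) x y)
            + 2 * of_nat m1 * frakL J (\<psi> N) m2 / of_nat N + ennreal ((8 * c / T ^ (q + 1)) / real N)" .
  qed
qed

end
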